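(* Let $X$ be a separable Hilbert space and $f\in C^1(X,\mathbb{R})$ be such that $\nabla f$ is a compact perturbation of the identity, i.e. $\nabla f=\mathbf{1}_X-K$ with $K:X\to X$ compact. Assume that $X^{-},X^{+}$ are closed subspaces of $X$ with $X=X^{-}\oplus X^{+}$, that $\mu=\dim X^{+}<\infty$, and that there exists $\kappa>0$ such that $$-\langle \nabla f(v+w_1)-\nabla f(v+w_2),\,w_1-w_2\rangle\ \ge\ \kappa\|w_1-w_2\|^2\qquad\text{for all } v\in X^{-},\ w_1,w_2\in X^{+}.$$ Let $\psi:X^-\to X^+$ and $\varphi:X^-\to\mathbb{R}$ be the associated saddle point reduction, i.e. $\varphi(v)=f(v+\psi(v))=\max_{w\in X^{+}}f(v+w)$ for $v\in X^-$, and let $\bar v\in X^-$ be an isolated critical point of $\varphi$. Then $$\operatorname{ind}(\nabla f,\bar v+\psi(\bar v))=(-1)^{\mu}\operatorname{ind}(\nabla\varphi,\bar v).$$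
   Context: Saddle point reduction: under the stated monotonicity condition, for each $v\in X^-$ the function $w\mapsto f(v+w)$ on $X^+$ has a unique maximizer $\psi(v)$; it is known that $\psi\in C(X^-,X^+)$, $\varphi\in C^1(X^-,\mathbb{R})$, and $v$ is a critical point of $\varphi$ if and only if $v+\psi(v)$ is a critical point of $f$. A compact operator is a continuous (possibly nonlinear) map sending bounded sets to relatively compact sets. It is known that, when $\nabla f=\mathbf 1_X-K$ with $K$ compact, also $\nabla\varphi=\mathbf 1_{X^-}-Q$ with $Q:X^-\to X^-$ compact. For a compact perturbation $T$ of the identity and an isolated zero $u$ of $T$, $\operatorname{ind}(T,u)$ denotes the Leray--Schauder index of $T$ at $u$, i.e. the Leray--Schauder degree $\deg(T,B_r(u),0)$ for small $r>0$. *)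

theory Defs
  imports "HOL-Analysis.Analysis" "HOL-Homology.Brouwer_Degree"
begin

definition finite_dimensional_on :: "'a::real_vector set \<Rightarrow> bool" where
  "finite_dimensional_on F \<longleftrightarrow> (\<exists>B. finite B \<and> span B = F)"

definition direct_sum :: "'a::real_vector set \<Rightarrow> 'a set \<Rightarrow> bool" where
  "direct_sum A B \<longleftrightarrow> A \<inter> B = {0} \<and> (\<forall>x. \<exists>a\<in>A. \<exists>b\<in>B. x = a + b)"

definition C1 :: "('a::real_normed_vector \<Rightarrow> real) \<Rightarrow> bool" where
  "C1 f \<longleftrightarrow> (\<exists>f' :: 'a \<Rightarrow> 'a \<Rightarrow>\<^sub>L real.
      (\<forall>x. (f has_derivative blinfun_apply (f' x)) (at x)) \<and> continuous_on UNIV f')"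

(* A closed subspace S is regarded as a Hilbert space with the inherited inner product, so
   the gradient of a function on S is required to lie in S (which makes it unique). *)
definition gradient_on :: "'a::real_inner set \<Rightarrow> ('a \<Rightarrow> real) \<Rightarrow> 'a \<Rightarrow> 'a" where
  "gradient_on S f x =
     (THE g. g \<in> S \<and> (f has_derivative (\<lambda>h. inner g h)) (at x within S))"

definition isolated_zero_on :: "'a::real_normed_vector set \<Rightarrow> ('a \<Rightarrow> 'a) \<Rightarrow> 'a \<Rightarrow> bool" where
  "isolated_zero_on S T u \<longleftrightarrow> u \<in> S \<and> T u = 0 \<and>
     (\<exists>e>0. \<forall>x\<in>S. 0 < norm (x - u) \<and> norm (x - u) < e \<longrightarrow> T x \<noteq> 0)"

definition compact_map_on :: "'a::real_normed_vector set \<Rightarrow> ('a \<Rightarrow> 'a) \<Rightarrow> bool" where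
  "compact_map_on S K \<longleftrightarrow> K ` S \<subseteq> S \<and> continuous_on S K \<and>
     (\<forall>B\<subseteq>S. bounded B \<longrightarrow> compact (closure (K ` B)))"

definition orthonormal_basis :: "'a::real_inner set \<Rightarrow> nat \<Rightarrow> (nat \<Rightarrow> 'a) \<Rightarrow> bool" where
  "orthonormal_basis F n b \<longleftrightarrow> span (b ` {..<n}) = F \<and>
     (\<forall>i<n. \<forall>j<n. inner (b i) (b j) = (if i = j then 1 else 0))"

(* The map x |-> g (u + r x) / |g (u + r x)| of the unit sphere of F, in coordinates with
   respect to b. Points of nsphere (n - 1) are sequences vanishing from index n on. *)
definition sphere_map ::
  "nat \<Rightarrow> (nat \<Rightarrow> 'a::real_inner) \<Rightarrow> ('a \<Rightarrow> 'a) \<Rightarrow> 'a \<Rightarrow> real \<Rightarrow> (nat \<Rightarrow> real) \<Rightarrow> nat \<Rightarrow> real" where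
  "sphere_map n b g u r x =
     (let y = g (u + r *\<^sub>R (\<Sum>j<n. x j *\<^sub>R b j))
      in (\<lambda>i. if i < n then inner (b i) y / norm y else 0))"

(* Brouwer degree deg (g, B_r(u) \<inter> F, 0) of a continuous map g from the closed ball of the
   finite-dimensional space F (containing u) to F without zeros on the boundary sphere: the
   degree of the normalized boundary map, which does not depend on the basis. If F = {0}, then
   g is the identity map of a point, whose degree is 1. *)
definition Brouwer_degree_ball ::
  "'a::real_inner set \<Rightarrow> ('a \<Rightarrow> 'a) \<Rightarrow> 'a \<Rightarrow> real \<Rightarrow> int" where
  "Brouwer_degree_ball F g u r =
     (if dim F = 0 then 1
      else Brouwer_degree2 (dim F - 1)
             (sphere_map (dim F) (SOME b. orthonormal_basis F (dim F) b) g u r))"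

(* Leray-Schauder degree deg (T, B_r(u), 0) of T = 1 - K on the closed subspace S containing u:
   K is approximated on the closed ball by a map L with values in a finite-dimensional subspace
   F of S, with error less than the distance of 0 from the image under T of the boundary sphere
   (delta separates the two, also if the sphere is empty). F may always be enlarged so that it
   contains u, and then B_r(u) \<inter> F is a ball in F. *)
definition LS_degree ::
  "'a::real_inner set \<Rightarrow> ('a \<Rightarrow> 'a) \<Rightarrow> 'a \<Rightarrow> real \<Rightarrow> int" where
  "LS_degree S T u r =
     (THE d. \<exists>F L \<delta>. subspace F \<and> finite_dimensional_on F \<and> F \<subseteq> S \<and> u \<in> F \<and>
        continuous_on (cball u r \<inter> S) L \<and> L ` (cball u r \<inter> S) \<subseteq> F \<and>
        (\<forall>x \<in> cball u r \<inter> S. norm (L x - (x - T x)) < \<delta>) \<and>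
        (\<forall>x \<in> sphere u r \<inter> S. \<delta> \<le> norm (T x)) \<and>
        d = Brouwer_degree_ball F (\<lambda>x. x - L x) u r)"

definition LS_index :: "'a::real_inner set \<Rightarrow> ('a \<Rightarrow> 'a) \<Rightarrow> 'a \<Rightarrow> int" where
  "LS_index S T u = (THE d. \<forall>\<^sub>F r in at_right 0. LS_degree S T u r = d)"

end

(* With P and R the orthogonal projections onto Xm and Xp, the map P + R is positive definite and
   of the form identity + finite rank, so grad f may be replaced by P (grad f) + R (grad f), whose
   components in Xm and Xp can be deformed separately. Strong concavity along Xp pairs with
   w - psi v to exclude zeros while the second component is deformed to -(w - psi v) and the first
   to grad phi v; deforming further the projection along Xp into P makes the decomposition
   orthogonal and the map becomes grad phi (v0 + P z) - (z - P z), z = x - u. A finite-dimensional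
   approximation of this map acts as a negative multiple of the identity on a complement of
   dimension dim Xp, and each such dimension changes the sign of the Brouwer degree, because
   suspension preserves the degree and a reflection has degree -1. The same suspension argument
   with positive multiples shows that the Leray-Schauder degree is well defined. *)

theory Submission
  imports Defs
begin

section \<open>Suspension and reflection of sphere maps\<close>

text \<open>The obstacle is that \<open>Xm\<close> and \<open>Xp\<close> need not be orthogonal. The
  gradient of \<open>\<phi>\<close> sees only the \<open>P\<close>-part of grad f, concavity sees
  only the \<open>R\<close>-part, and points are decomposed by the oblique projection
  \<open>\<pi>\<close>; these three projections have to be reconciled. Orthogonality is needed at
  the end because Brouwer degrees in different dimensions are compared in orthonormal coordinates.
  No differentiability of \<open>\<psi>\<close> is available. It enters through one estimate: the
  distance of w to \<open>\<psi> v\<close> is at most the norm of R (grad f (v + w)) divided by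
  \<open>\<kappa>\<close>. This gives uniqueness, continuity and boundedness, and bounded values in
  the finite-dimensional \<open>Xp\<close> make \<open>\<psi>\<close> compact. The degree is a
  definite description, so each evaluation exhibits an explicit approximation. The homotopy lemma
  for it allows the radius to vary, so the same lemma shows that the index does not depend on the
  radius. The unit sphere of a line consists of two points and has no equator to restrict to, so the
  last drop of dimension is checked by hand against the convention that the zero space has degree
  1.\<close>

lemma nsphere_eq_top_of_set:
  "nsphere n = top_of_set {x. (\<Sum>i\<le>n. (x i)\<^sup>2) = 1 \<and> (\<forall>i>n. x i = 0)}"
  unfolding nsphere by (simp add: euclidean_product_topology)

lemma topspace_nsphere_iff:
  "x \<in> topspace (nsphere n) \<longleftrightarrow> (\<Sum>i\<le>n. (x i)\<^sup>2) = 1 \<and> (\<forall>i>n. x i = 0)"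
  by (simp add: nsphere_eq_top_of_set)

lemma continuous_on_coordinate: "continuous_on A (\<lambda>x. x i)"
  by (rule continuous_on_subset [OF continuous_on_product_coordinates subset_UNIV])

lemma Brouwer_degree2_equator:
  assumes cmf: "continuous_map (nsphere (Suc n)) (nsphere (Suc n)) f"
    and up: "\<And>x. x \<in> topspace (nsphere (Suc n)) \<Longrightarrow> 0 \<le> x (Suc n) \<Longrightarrow> 0 \<le> f x (Suc n)"
    and lo: "\<And>x. x \<in> topspace (nsphere (Suc n)) \<Longrightarrow> x (Suc n) \<le> 0 \<Longrightarrow> f x (Suc n) \<le> 0"
  shows "Brouwer_degree2 (Suc n) f = Brouwer_degree2 n f"
proof -
  \<comment> \<open>The functoriality rules for relative homology want set inclusions on whole half-spaces,
    hence the extension of \<^term>\<open>f\<close> by the identity. As it preserves both hemispheres, it commutes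
    with the suspension isomorphism.\<close>
  define r where "r \<equiv> \<lambda>x. if x \<in> topspace (nsphere (Suc n)) then f x else x"
  have cmr: "continuous_map (nsphere (Suc n)) (nsphere (Suc n)) r"
    by (rule continuous_map_eq [OF cmf]) (simp add: r_def)
  have rsub: "r \<in> {x. 0 \<le> x (Suc n)} \<rightarrow> {x. 0 \<le> x (Suc n)}"
             "r \<in> {x. x (Suc n) \<le> 0} \<rightarrow> {x. x (Suc n) \<le> 0}"
    using up lo by (auto simp: r_def)
  \<comment> \<open>On the equator both hypotheses apply, so the last coordinate of the image is
    squeezed to 0.\<close>
  have rsub0: "r \<in> {x. x (Suc n) = 0} \<rightarrow> {x. x (Suc n) = 0}"
    using up lo by (force simp: r_def)
  have eqn: "nsphere n = subtopology (nsphere (Suc n)) {x. x (Suc n) = 0}"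
    by (simp add: subtopology_nsphere_equator)
  have cmrn: "continuous_map (nsphere n) (nsphere n) r"
    unfolding eqn using cmr rsub0
    by (metis (no_types, lifting) IntE Pi_iff continuous_map_from_subtopology
        continuous_map_into_subtopology topspace_subtopology)
  let ?p = "int n"
  let ?sub = "subtopology (nsphere (Suc n)) {x. x (Suc n) \<ge> 0}"
  let ?G2 = "relative_homology_group (1 + ?p) ?sub {x. x (Suc n) = 0}"
  let ?r2 = "hom_induced (1 + ?p) ?sub {x. x (Suc n) = 0} ?sub {x. x (Suc n) = 0} r"
  let ?j = "\<lambda>p n. hom_induced p (nsphere n) {} (nsphere n) {} r"
  have cmrs: "continuous_map ?sub ?sub r"
    by (metis (no_types, lifting) IntE Pi_iff cmr continuous_map_from_subtopology
        continuous_map_into_subtopology rsub(1) topspace_subtopology)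
  \<comment> \<open>The suspension isomorphism is assembled from three natural ones: the inverse of
    the boundary map of the upper hemisphere relative to the equator, the inclusion of that pair
    into the sphere relative to the lower hemisphere (excision), and the inverse of the passage from
    absolute to relative homology.\<close>
  have "\<exists>\<Phi> \<in> iso (reduced_homology_group ?p (nsphere n))
                 (reduced_homology_group (1 + ?p) (nsphere (Suc n))).
        \<forall>c \<in> carrier (reduced_homology_group ?p (nsphere n)). ?j (1 + ?p) (Suc n) (\<Phi> c) = \<Phi> (?j ?p n c)"
  proof (rule isomorphism_trans)
    let ?f = "hom_boundary (1 + ?p) ?sub {x. x (Suc n) = 0}"
    show "\<exists>f\<in>Group.iso (reduced_homology_group ?p (nsphere n)) ?G2.
           \<forall>c\<in>carrier (reduced_homology_group ?p (nsphere n)). ?r2 (f c) = f (?j ?p n c)"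
    proof (rule isomorphism_sym)
      show "?f \<in> Group.iso ?G2 (reduced_homology_group ?p (nsphere n))"
        using iso_upper_hemisphere_reduced_homology_group
        by (metis add.commute)
    next
      fix c
      assume "c \<in> carrier ?G2"
      have "hom_induced ?p (nsphere n) {} (nsphere n) {} r \<circ> hom_boundary (1 + ?p) ?sub {x. x (Suc n) = 0}
          = hom_boundary (1 + ?p) ?sub {x. x (Suc n) = 0} \<circ>
            hom_induced (1 + ?p) ?sub {x. x (Suc n) = 0} ?sub {x. x (Suc n) = 0} r"
        using naturality_hom_induced [OF cmrs rsub0, symmetric, of "1 + ?p", simplified]
        by (simp add: Pi_iff subtopology_subtopology subtopology_nsphere_equator flip: Collect_conj_eq cong: rev_conj_cong)
      then show "?j ?p n (?f c) = ?f (hom_induced (1 + ?p) ?sub {x. x (Suc n) = 0} ?sub {x. x (Suc n) = 0} r c)"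
        by (metis comp_def)
    next
      fix c
      assume "c \<in> carrier ?G2"
      show "hom_induced (1 + ?p) ?sub {x. x (Suc n) = 0} ?sub {x. x (Suc n) = 0} r c \<in> carrier ?G2"
        using hom_induced_carrier by blast
    qed auto
  next
    let ?H2 = "relative_homology_group (1 + ?p) (nsphere (Suc n)) {x. x (Suc n) \<le> 0}"
    let ?s2 = "hom_induced (1 + ?p) (nsphere (Suc n)) {x. x (Suc n) \<le> 0} (nsphere (Suc n)) {x. x (Suc n) \<le> 0} r"
    show "\<exists>f\<in>Group.iso ?G2 (reduced_homology_group (1 + ?p) (nsphere (Suc n))). \<forall>c\<in>carrier ?G2. ?j (1 + ?p) (Suc n) (f c)
            = f (?r2 c)"
    proof (rule isomorphism_trans)
      show "\<exists>f\<in>Group.iso ?G2 ?H2.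
                 \<forall>c\<in>carrier ?G2.
                    ?s2 (f c) = f (hom_induced (1 + ?p) ?sub {x. x (Suc n) = 0} ?sub {x. x (Suc n) = 0} r c)"
      proof (intro ballI bexI)
        fix c
        assume "c \<in> carrier (relative_homology_group (1 + ?p) ?sub {x. x (Suc n) = 0})"
        show "?s2 (hom_induced (1 + ?p) ?sub {x. x (Suc n) = 0} (nsphere (Suc n)) {x. x (Suc n) \<le> 0} id c)
            = hom_induced (1 + ?p) ?sub {x. x (Suc n) = 0} (nsphere (Suc n)) {x. x (Suc n) \<le> 0} id (?r2 c)"
          by (simp add: rsub rsub0 hom_induced_compose' Collect_mono_iff cmr)
             (subst hom_induced_compose', use cmrs rsub0 in \<open>auto simp: continuous_map_from_subtopology\<close>)
      qed (simp add: iso_relative_homology_group_upper_hemisphere)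
    next
      let ?h = "hom_induced (1 + ?p) (nsphere (Suc n)) {} (nsphere (Suc n)) {x. x (Suc n) \<le> 0} id"
      show "\<exists>f\<in>Group.iso ?H2 (reduced_homology_group (1 + ?p) (nsphere (Suc n))).
               \<forall>c\<in>carrier ?H2. ?j (1 + ?p) (Suc n) (f c) = f (?s2 c)"
      proof (rule isomorphism_sym)
        show "?h \<in> Group.iso (reduced_homology_group (1 + ?p) (nsphere (Suc n)))
               (relative_homology_group (1 + ?p) (nsphere (Suc n)) {x. x (Suc n) \<le> 0})"
          using iso_reduced_homology_group_lower_hemisphere by blast
      next
        fix c
        assume "c \<in> carrier (reduced_homology_group (1 + ?p) (nsphere (Suc n)))"
        show "?s2 (?h c) = ?h (?j (1 + ?p) (Suc n)  c)"
          by (simp add: hom_induced_compose' cmr rsub)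
      next
        fix c
        assume "c \<in> carrier (reduced_homology_group (1 + ?p) (nsphere (Suc n)))"
        then show "hom_induced (1 + ?p) (nsphere (Suc n)) {} (nsphere (Suc n)) {} r c
        \<in> carrier (reduced_homology_group (1 + ?p) (nsphere (Suc n)))"
          by (simp add: hom_induced_reduced)
      qed auto
    qed
  qed
  then obtain \<Phi> where iso: "\<Phi> \<in> iso (reduced_homology_group ?p (nsphere n))
                 (reduced_homology_group (1 + ?p) (nsphere (Suc n)))"
    and nat: "\<And>c. c \<in> carrier (reduced_homology_group ?p (nsphere n)) \<Longrightarrow>
                ?j (1 + ?p) (Suc n) (\<Phi> c) = \<Phi> (?j ?p n c)"
    by blast
  let ?G = "reduced_homology_group ?p (nsphere n)"
  let ?G1 = "reduced_homology_group (1 + ?p) (nsphere (Suc n))"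
  have eq: "carrier ?G1 = \<Phi> ` carrier ?G"
    using iso by (simp add: iso_iff)
  interpret group_hom ?G ?G1 \<Phi>
    using iso by (simp add: group_hom_axioms_def group_hom_def iso_imp_homomorphism)
  \<comment> \<open>The degree is the exponent by which the induced map acts. A homomorphism carries
    the exponent along, and surjectivity of \<open>\<Phi>\<close> makes it valid on the whole target
    group.\<close>
  have "hom_induced (1 + ?p) (nsphere (Suc n)) {} (nsphere (Suc n)) {} r (\<Phi> y)
          = \<Phi> y [^]\<^bsub>?G1\<^esub> (Brouwer_degree2 n r)"
    if "y \<in> carrier ?G" for y
    by (simp add: that nat Brouwer_degree2 hom_int_pow)
  then have "Brouwer_degree2 (Suc n) r = Brouwer_degree2 n r"
    by (intro Brouwer_degree2_unique [OF cmr]) (auto simp: eq)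
  moreover have "Brouwer_degree2 (Suc n) r = Brouwer_degree2 (Suc n) f"
    by (rule Brouwer_degree2_eq) (simp add: r_def)
  moreover have "Brouwer_degree2 n r = Brouwer_degree2 n f"
    by (rule Brouwer_degree2_eq) (simp add: r_def eqn)
  ultimately show ?thesis by simp
qed

text \<open>Conjugating the reflection in coordinate 0 by the transposition of coordinates 0 and
  \<open>k\<close> gives the reflection in coordinate \<open>k\<close>. The transposition is an
  involution, so its degree squares to 1 and cancels, whatever its sign.\<close>

lemma Brouwer_degree2_reflection_coordinate:
  assumes "k \<le> n"
  shows "Brouwer_degree2 n (\<lambda>x i. if i = k then - x i else x i) = -1"
proof -
  define \<tau> :: "(nat \<Rightarrow> real) \<Rightarrow> nat \<Rightarrow> real" where "\<tau> \<equiv> \<lambda>x i. x (Transposition.transpose 0 k i)"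
  define \<rho> :: "nat \<Rightarrow> (nat \<Rightarrow> real) \<Rightarrow> nat \<Rightarrow> real" where "\<rho> \<equiv> \<lambda>j x i. if i = j then - x i else x i"
  have perm: "Transposition.transpose 0 k permutes {..n}"
    using assms by (intro permutes_swap_id) auto
  have "(\<Sum>i\<le>n. (x (Transposition.transpose 0 k i))\<^sup>2) = (\<Sum>i\<le>n. (x i)\<^sup>2)" for x :: "nat \<Rightarrow> real"
    using sum.permute [OF perm, of "\<lambda>i. (x i)\<^sup>2"] by (simp add: o_def)
  moreover have "Transposition.transpose 0 k i = i" if "i > n" for i
    using assms that by (simp add: Transposition.transpose_def)
  ultimately have \<tau>: "continuous_map (nsphere n) (nsphere n) \<tau>"
    unfolding nsphere_eq_top_of_set
    by (auto simp: \<tau>_def continuous_map_in_subtopology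
        intro!: continuous_on_coordinatewise_then_product continuous_on_coordinate)
  have \<rho>: "continuous_map (nsphere n) (nsphere n) (\<rho> j)" for j
    unfolding \<rho>_def by (rule continuous_map_nsphere_reflection)
  have eq: "\<rho> k = \<tau> \<circ> \<rho> 0 \<circ> \<tau>"
    by (auto simp: \<rho>_def \<tau>_def fun_eq_iff Transposition.transpose_def)
  have "\<tau> \<circ> \<tau> = id"
    by (auto simp: \<tau>_def fun_eq_iff)
  then have "Brouwer_degree2 n \<tau> * Brouwer_degree2 n \<tau> = 1"
    by (metis Brouwer_degree2_compose Brouwer_degree2_id \<tau>)
  moreover have "Brouwer_degree2 n (\<rho> k)
      = Brouwer_degree2 n \<tau> * Brouwer_degree2 n (\<rho> 0) * Brouwer_degree2 n \<tau>"
    unfolding eq by (metis Brouwer_degree2_compose \<tau> \<rho> continuous_map_compose)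
  moreover have "Brouwer_degree2 n (\<rho> 0) = -1"
    unfolding \<rho>_def by (rule Brouwer_degree2_reflection)
  ultimately have "Brouwer_degree2 n (\<rho> k) = -1"
    by simp
  then show ?thesis
    by (simp add: \<rho>_def)
qed

section \<open>The Brouwer degree on balls of finite-dimensional subspaces\<close>

lemma continuous_map_nsphere_iff:
  "continuous_map (nsphere m) (nsphere n) f \<longleftrightarrow>
     continuous_on (topspace (nsphere m)) f \<and> f \<in> topspace (nsphere m) \<rightarrow> topspace (nsphere n)"
  unfolding nsphere_eq_top_of_set continuous_map_in_subtopology
  by simp

lemma continuous_map_Times_nsphere_iff:
  "continuous_map (prod_topology (top_of_set A) (nsphere m)) (nsphere n) f \<longleftrightarrow>
     continuous_on (A \<times> topspace (nsphere m)) f \<and> f \<in> A \<times> topspace (nsphere m) \<rightarrow> topspace (nsphere n)"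
  unfolding nsphere_eq_top_of_set continuous_map_in_subtopology
  by simp

section \<open>Orthonormal bases of finite-dimensional subspaces\<close>

lemma orthonormal_basisD:
  assumes "orthonormal_basis F n b"
  shows "span (b ` {..<n}) = F" "subspace F"
    "\<And>i j. i < n \<Longrightarrow> j < n \<Longrightarrow> inner (b i) (b j) = (if i = j then 1 else 0)"
    "\<And>i. i < n \<Longrightarrow> b i \<in> F"
  using assms unfolding orthonormal_basis_def by (auto intro: span_base)

lemma inner_orthonormal_sum:
  assumes "orthonormal_basis F n b" "i < n"
  shows "inner (b i) (\<Sum>j<n. x j *\<^sub>R b j) = x i"
  using assms by (simp add: inner_sum_right orthonormal_basisD(3) if_distrib sum.delta cong: if_cong)

lemma orthonormal_sum_in:
  assumes "orthonormal_basis F n b"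
  shows "(\<Sum>j<n. x j *\<^sub>R b j) \<in> F"
  using orthonormal_basisD [OF assms] by (auto intro!: subspace_sum subspace_scale)

lemma norm_orthonormal_sum:
  assumes "orthonormal_basis F n b"
  shows "(norm (\<Sum>j<n. x j *\<^sub>R b j))\<^sup>2 = (\<Sum>j<n. (x j)\<^sup>2)"
proof -
  have "(norm (\<Sum>j<n. x j *\<^sub>R b j))\<^sup>2 = (\<Sum>i<n. x i * inner (b i) (\<Sum>j<n. x j *\<^sub>R b j))"
    unfolding power2_norm_eq_inner by (subst inner_sum_left) simp
  also have "\<dots> = (\<Sum>i<n. (x i)\<^sup>2)"
    by (intro sum.cong) (auto simp: inner_orthonormal_sum [OF assms] power2_eq_square)
  finally show ?thesis .
qed

lemma orthonormal_expansion:
  assumes "orthonormal_basis F n b" "y \<in> F"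
  shows "(\<Sum>j<n. inner (b j) y *\<^sub>R b j) = y"
proof -
  have "y \<in> span (b ` {..<n})"
    using assms orthonormal_basisD(1) by blast
  then show ?thesis
  proof (induction rule: span_induct_alt)
    case (step c z y)
    then obtain k where k: "k < n" "z = b k" by auto
    have "(\<Sum>j<n. inner (b j) z *\<^sub>R b j) = (\<Sum>j<n. if k = j then b j else 0)"
      using k by (intro sum.cong) (auto simp: orthonormal_basisD(3) [OF assms(1)])
    also have "\<dots> = z"
      using k by simp
    finally show ?case
      using step by (simp add: inner_add_right scaleR_add_left sum.distrib flip: scaleR_scaleR scaleR_sum_right)
  qed simp
qed

lemma orthonormal_basis_independent:
  assumes "orthonormal_basis F n b"
  shows "inj_on b {..<n}" "independent (b ` {..<n})" "dim F = n"
proof -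
  note b = orthonormal_basisD [OF assms]
  show inj: "inj_on b {..<n}"
    using b(3) by (metis inj_onI lessThan_iff zero_neq_one)
  show ind: "independent (b ` {..<n})"
  proof
    assume "dependent (b ` {..<n})"
    then obtain u v where u: "(\<Sum>v\<in>b ` {..<n}. u v *\<^sub>R v) = 0" and v: "v \<in> b ` {..<n}" "u v \<noteq> 0"
      by (auto simp: dependent_finite)
    then obtain k where k: "k < n" "v = b k" by auto
    have "inner (b k) (\<Sum>j<n. u (b j) *\<^sub>R b j) = 0"
      using u by (simp add: sum.reindex [OF inj])
    then show False
      using inner_orthonormal_sum [OF assms \<open>k < n\<close>, of "\<lambda>j. u (b j)"] v k by simp
  qed
  have "dim F = card (b ` {..<n})"
    using dim_span_eq_card_independent [OF ind] b(1) by simp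
  then show "dim F = n"
    using card_image [OF inj] by simp
qed

text \<open>A longest orthonormal extension inside \<open>F\<close> exists, since its length is
  bounded by the size of a finite spanning set; if it missed a vector of \<open>F\<close>, the
  normalized residual of that vector would lengthen it. Keeping the first \<open>k\<close> vectors
  is what allows degrees on a subspace and on \<open>F\<close> to be compared in the same
  coordinates.\<close>

lemma orthonormal_basis_extend:
  assumes F: "subspace F" "finite_dimensional_on F"
    and b: "orthonormal_basis E k b" and EF: "E \<subseteq> F"
  obtains n b' where "k \<le> n" "orthonormal_basis F n b'" "\<And>i. i < k \<Longrightarrow> b' i = b i"
proof -
  obtain B where B: "finite B" "span B = F"
    using F(2) by (auto simp: finite_dimensional_on_def)
  let ?P = "\<lambda>n. k \<le> n \<and> (\<exists>b' E'. orthonormal_basis E' n b' \<and> E' \<subseteq> F \<and> (\<forall>i<k. b' i = b i))"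
  have Pk: "?P k"
    using b EF by blast
  have bound: "n \<le> card B" if Pn: "?P n" for n
  proof -
    obtain b' E' where b': "orthonormal_basis E' n b'" "E' \<subseteq> F"
      using Pn by blast
    have "b' ` {..<n} \<subseteq> span B"
      using b' B orthonormal_basisD(4) [OF b'(1)] by auto
    then have "card (b' ` {..<n}) \<le> card B"
      using independent_span_bound [OF B(1) orthonormal_basis_independent(2) [OF b'(1)]] by blast
    then show ?thesis
      using card_image [OF orthonormal_basis_independent(1) [OF b'(1)]] by simp
  qed
  define n where "n = (GREATEST n. ?P n)"
  have "?P n"
    unfolding n_def by (rule GreatestI_nat [of ?P k "card B"]) (use Pk bound in auto)
  then obtain b' E' where b': "orthonormal_basis E' n b'" "E' \<subseteq> F" "\<forall>i<k. b' i = b i" and kn: "k \<le> n"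
    by blast
  have "F \<subseteq> E'"
  proof (rule ccontr)
    assume "\<not> F \<subseteq> E'"
    then obtain x where x: "x \<in> F" "x \<notin> E'" by blast
    define p where "p = (\<Sum>j<n. inner (b' j) x *\<^sub>R b' j)"
    define e where "e = (x - p) /\<^sub>R norm (x - p)"
    have p: "p \<in> E'"
      unfolding p_def by (rule orthonormal_sum_in [OF b'(1)])
    then have "norm (x - p) \<noteq> 0"
      using x by auto
    then have "norm e = 1"
      by (simp add: e_def)
    then have e1: "inner e e = 1"
      by (simp add: dot_square_norm)
    have eb: "inner (b' i) e = 0" if "i < n" for i
      using inner_orthonormal_sum [OF b'(1) that, of "\<lambda>j. inner (b' j) x"]
      by (simp add: e_def p_def inner_diff_right)
    have eF: "e \<in> F"
      unfolding e_def using F(1) x p b'(2) by (auto intro: subspace_scale subspace_diff)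
    define b2 where "b2 = b'(n := e)"
    have "orthonormal_basis (span (b2 ` {..<Suc n})) (Suc n) b2"
      unfolding orthonormal_basis_def b2_def
      using e1 eb orthonormal_basisD(3) [OF b'(1)] by (auto simp: less_Suc_eq inner_commute)
    moreover have "span (b2 ` {..<Suc n}) \<subseteq> F"
      using eF b'(2) orthonormal_basisD(4) [OF b'(1)] F(1)
      by (intro span_minimal) (auto simp: b2_def less_Suc_eq)
    moreover have "\<forall>i<k. b2 i = b i"
      using b'(3) kn by (auto simp: b2_def)
    ultimately have "?P (Suc n)"
      using kn by (meson le_SucI)
    then have "Suc n \<le> n"
      unfolding n_def by (rule Greatest_le_nat [of ?P _ "card B"]) (use bound in auto)
    then show False by simp
  qed
  then have "E' = F"
    using b'(2) by blast
  then show thesis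
    using that kn b' by blast
qed

lemma orthonormal_basis_exists:
  assumes "subspace F" "finite_dimensional_on F"
  obtains b where "orthonormal_basis F (dim F) b"
proof -
  have "orthonormal_basis {0} 0 (\<lambda>_. 0)"
    by (auto simp: orthonormal_basis_def)
  moreover have "{0} \<subseteq> F"
    using assms(1) by (simp add: subspace_0)
  ultimately obtain n b where "orthonormal_basis F n b"
    using orthonormal_basis_extend [OF assms] by metis
  then show thesis
    using that orthonormal_basis_independent(3) by metis
qed

section \<open>Normalized boundary maps in coordinates\<close>

lemma orthonormal_sum_in_sphere:
  assumes "orthonormal_basis F (Suc m) b" "x \<in> topspace (nsphere m)"
  shows "(\<Sum>j<Suc m. x j *\<^sub>R b j) \<in> sphere 0 1 \<inter> F"
proof -
  have "(norm (\<Sum>j<Suc m. x j *\<^sub>R b j))\<^sup>2 = 1"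
    using assms(2) unfolding norm_orthonormal_sum [OF assms(1)] topspace_nsphere_iff
    by (simp add: lessThan_Suc_atMost)
  then have "norm (\<Sum>j<Suc m. x j *\<^sub>R b j) = 1"
    by (metis norm_ge_zero one_power2 power2_eq_imp_eq zero_le_one)
  then show ?thesis
    using orthonormal_sum_in [OF assms(1)] by simp
qed

lemma normalized_coordinates_in_nsphere:
  assumes "orthonormal_basis F (Suc m) b" "y \<in> F" "y \<noteq> 0"
  shows "(\<lambda>i. if i < Suc m then inner (b i) y / norm y else 0) \<in> topspace (nsphere m)"
proof -
  have "(\<Sum>i<Suc m. (inner (b i) y)\<^sup>2) = (norm y)\<^sup>2"
    using norm_orthonormal_sum [OF assms(1), of "\<lambda>i. inner (b i) y"]
      orthonormal_expansion [OF assms(1,2)] by simp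
  then have "(\<Sum>i\<le>m. (inner (b i) y / norm y)\<^sup>2) = 1"
    using assms(3) by (simp add: power_divide lessThan_Suc_atMost flip: sum_divide_distrib)
  then show ?thesis
    unfolding topspace_nsphere_iff by simp
qed

lemma sphere_map_homotopic:
  fixes H :: "real \<Rightarrow> 'a::real_inner \<Rightarrow> 'a"
  assumes b: "orthonormal_basis F (Suc m) b"
    and cont: "continuous_on ({0..1} \<times> (sphere 0 1 \<inter> F)) (\<lambda>(t, x). H t x)"
    and H: "\<And>t x. t \<in> {0..1} \<Longrightarrow> x \<in> sphere 0 1 \<inter> F \<Longrightarrow> H t x \<in> F - {0}"
  shows "homotopic_with (\<lambda>_. True) (nsphere m) (nsphere m)
           (sphere_map (Suc m) b (H 0) 0 1) (sphere_map (Suc m) b (H 1) 0 1)"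
proof -
  let ?S = "topspace (nsphere m)"
  let ?h = "\<lambda>(t, x). sphere_map (Suc m) b (H t) 0 1 x"
  have cy: "continuous_on ({0..1} \<times> ?S) (\<lambda>(t, x). H t (\<Sum>j<Suc m. x j *\<^sub>R b j))"
  proof -
    have sn: "continuous_on ({0..1} \<times> ?S) (\<lambda>p. snd p j)" for j
      by (rule continuous_on_compose2 [OF continuous_on_coordinate [of UNIV] continuous_on_snd]) auto
    have "continuous_on ({0..1} \<times> ?S) (\<lambda>p. \<Sum>j<Suc m. snd p j *\<^sub>R b j)"
      by (intro continuous_on_sum continuous_on_scaleR sn continuous_on_const)
    moreover have "(fst p, \<Sum>j<Suc m. snd p j *\<^sub>R b j) \<in> {0..1} \<times> (sphere 0 1 \<inter> F)"
      if "p \<in> {0..1} \<times> ?S" for p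
      using that orthonormal_sum_in_sphere [OF b, of "snd p"] by (auto simp del: sum.lessThan_Suc)
    ultimately have "continuous_on ({0..1} \<times> ?S) (\<lambda>p. (\<lambda>(t, x). H t x) (fst p, \<Sum>j<Suc m. snd p j *\<^sub>R b j))"
      by (intro continuous_on_compose2 [OF cont] continuous_on_Pair continuous_on_fst continuous_on_id) auto
    then show ?thesis
      by (simp add: case_prod_unfold)
  qed
  have "continuous_on ({0..1} \<times> ?S) ?h"
  proof (rule continuous_on_coordinatewise_then_product)
    fix i
    have "continuous_on ({0..1} \<times> ?S) (\<lambda>p. inner (b i) ((\<lambda>(t, x). H t (\<Sum>j<Suc m. x j *\<^sub>R b j)) p)
                / norm ((\<lambda>(t, x). H t (\<Sum>j<Suc m. x j *\<^sub>R b j)) p))"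
    proof (intro continuous_on_divide continuous_on_inner continuous_on_norm continuous_on_const cy ballI)
      fix p :: "real \<times> (nat \<Rightarrow> real)"
      assume "p \<in> {0..1} \<times> ?S"
      then show "norm ((\<lambda>(t, x). H t (\<Sum>j<Suc m. x j *\<^sub>R b j)) p) \<noteq> 0"
        using H [of "fst p", OF _ orthonormal_sum_in_sphere [OF b, of "snd p"]]
        by (auto simp: case_prod_unfold simp del: sum.lessThan_Suc)
    qed
    then show "continuous_on ({0..1} \<times> ?S) (\<lambda>p. ?h p i)"
      by (cases "i < Suc m") (simp_all add: sphere_map_def Let_def case_prod_unfold del: sum.lessThan_Suc)
  qed
  moreover have "?h p \<in> ?S" if "p \<in> {0..1} \<times> ?S" for p
  proof -
    have "H (fst p) (\<Sum>j<Suc m. snd p j *\<^sub>R b j) \<in> F - {0}"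
      using that H orthonormal_sum_in_sphere [OF b, of "snd p"] by auto
    then show ?thesis
      using normalized_coordinates_in_nsphere [OF b, of "H (fst p) (\<Sum>j<Suc m. snd p j *\<^sub>R b j)"]
      by (simp add: case_prod_unfold sphere_map_def Let_def del: sum.lessThan_Suc)
  qed
  ultimately have "continuous_map (prod_topology (top_of_set {0..1}) (nsphere m)) (nsphere m) ?h"
    unfolding continuous_map_Times_nsphere_iff by blast
  then show ?thesis
    unfolding homotopic_with_def by (intro exI [of _ ?h]) auto
qed

lemma continuous_map_sphere_map:
  assumes b: "orthonormal_basis F (Suc m) b"
    and g: "continuous_on (sphere 0 1 \<inter> F) g" "\<And>x. x \<in> sphere 0 1 \<inter> F \<Longrightarrow> g x \<in> F - {0}"
  shows "continuous_map (nsphere m) (nsphere m) (sphere_map (Suc m) b g 0 1)"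
proof -
  have "continuous_on ({0..1::real} \<times> (sphere 0 1 \<inter> F)) (\<lambda>(t, x). g x)"
    unfolding case_prod_unfold by (intro continuous_on_compose2 [OF g(1)] continuous_intros) auto
  from sphere_map_homotopic [OF b, of "\<lambda>_. g", OF this g(2)] show ?thesis
    using homotopic_with_imp_continuous_maps by blast
qed

text \<open>Needed because the degree is defined with a basis chosen by \<open>SOME\<close>. The
  change of coordinates conjugates one boundary map into the other; the two changes are mutually
  inverse on the sphere, so their degrees multiply to 1 and no determinant has to be
  computed.\<close>

lemma Brouwer_degree2_sphere_map_basis:
  fixes g :: "'a::real_inner \<Rightarrow> 'a"
  assumes b: "orthonormal_basis F (Suc m) b" and c: "orthonormal_basis F (Suc m) c"
    and g: "continuous_on (sphere 0 1 \<inter> F) g" "\<And>x. x \<in> sphere 0 1 \<inter> F \<Longrightarrow> g x \<in> F - {0}"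
  shows "Brouwer_degree2 m (sphere_map (Suc m) b g 0 1) = Brouwer_degree2 m (sphere_map (Suc m) c g 0 1)"
proof -
  define A :: "(nat \<Rightarrow> 'a) \<Rightarrow> (nat \<Rightarrow> 'a) \<Rightarrow> (nat \<Rightarrow> real) \<Rightarrow> nat \<Rightarrow> real"
    where "A b c x = (\<lambda>i. if i < Suc m then inner (b i) (\<Sum>j<Suc m. x j *\<^sub>R c j) else 0)" for b c x
  have sumA: "(\<Sum>j<Suc m. A b c x j *\<^sub>R b j) = (\<Sum>j<Suc m. x j *\<^sub>R c j)"
    if "orthonormal_basis F (Suc m) b" "orthonormal_basis F (Suc m) c" for b c :: "nat \<Rightarrow> 'a" and x
  proof -
    have "(\<Sum>j<Suc m. A b c x j *\<^sub>R b j) = (\<Sum>j<Suc m. inner (b j) (\<Sum>j<Suc m. x j *\<^sub>R c j) *\<^sub>R b j)"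
      by (intro sum.cong) (auto simp: A_def)
    then show ?thesis
      using orthonormal_expansion [OF that(1) orthonormal_sum_in [OF that(2)]] by simp
  qed
  have cA: "continuous_map (nsphere m) (nsphere m) (A b c)"
    if "orthonormal_basis F (Suc m) b" "orthonormal_basis F (Suc m) c" for b c :: "nat \<Rightarrow> 'a"
  proof -
    have "continuous_on (topspace (nsphere m)) (A b c)"
    proof (rule continuous_on_coordinatewise_then_product)
      fix i
      show "continuous_on (topspace (nsphere m)) (\<lambda>x. A b c x i)"
        by (cases "i < Suc m") (auto simp: A_def simp del: sum.lessThan_Suc intro!: continuous_intros continuous_on_coordinate)
    qed
    moreover have "A b c x \<in> topspace (nsphere m)" if x: "x \<in> topspace (nsphere m)" for x
    proof -
      have y: "(\<Sum>j<Suc m. x j *\<^sub>R c j) \<in> sphere 0 1 \<inter> F"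
        by (rule orthonormal_sum_in_sphere [OF \<open>orthonormal_basis F (Suc m) c\<close> x])
      then have "norm (\<Sum>j<Suc m. x j *\<^sub>R c j) = 1" "(\<Sum>j<Suc m. x j *\<^sub>R c j) \<in> F"
        by simp_all
      moreover from this have "(\<Sum>j<Suc m. x j *\<^sub>R c j) \<noteq> 0"
        by (metis norm_zero zero_neq_one)
      ultimately show ?thesis
        using normalized_coordinates_in_nsphere [OF \<open>orthonormal_basis F (Suc m) b\<close>, of "\<Sum>j<Suc m. x j *\<^sub>R c j"]
        by (simp only: A_def div_by_1 simp_thms)
    qed
    ultimately show ?thesis
      unfolding continuous_map_nsphere_iff by blast
  qed
  have AA: "A b c (A c b x) = x" if x: "x \<in> topspace (nsphere m)" for x
  proof
    fix i
    show "A b c (A c b x) i = x i"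
    proof (cases "i < Suc m")
      case True
      then have "A b c (A c b x) i = inner (b i) (\<Sum>j<Suc m. x j *\<^sub>R b j)"
        unfolding A_def [of b c] by (simp only: sumA [OF c b] if_True)
      then show ?thesis
        using inner_orthonormal_sum [OF b True] by simp
    next
      case False
      then show ?thesis
        using x by (simp add: A_def topspace_nsphere_iff)
    qed
  qed
  let ?g = "sphere_map (Suc m) c g 0 1"
  have cg: "continuous_map (nsphere m) (nsphere m) ?g"
    by (rule continuous_map_sphere_map [OF c g])
  have eq: "sphere_map (Suc m) b g 0 1 x = (A b c \<circ> (?g \<circ> A c b)) x" if "x \<in> topspace (nsphere m)" for x
  proof -
    define y where "y = g (\<Sum>j<Suc m. x j *\<^sub>R b j)"
    have y: "y \<in> F"
      unfolding y_def using g(2) orthonormal_sum_in_sphere [OF b that] by blast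
    have 1: "sphere_map (Suc m) b g 0 1 x = (\<lambda>i. if i < Suc m then inner (b i) y / norm y else 0)"
      by (simp add: sphere_map_def Let_def y_def del: sum.lessThan_Suc cong: if_cong)
    have 2: "?g (A c b x) = (\<lambda>i. if i < Suc m then inner (c i) y / norm y else 0)"
      by (simp add: sphere_map_def Let_def y_def sumA [OF c b] del: sum.lessThan_Suc cong: if_cong)
    have "(\<Sum>j<Suc m. ?g (A c b x) j *\<^sub>R c j) = (\<Sum>j<Suc m. (inner (c j) y / norm y) *\<^sub>R c j)"
      unfolding 2 by (intro sum.cong) auto
    also have "\<dots> = (1 / norm y) *\<^sub>R (\<Sum>j<Suc m. inner (c j) y *\<^sub>R c j)"
      by (simp add: scaleR_sum_right del: sum.lessThan_Suc)
    also have "\<dots> = (1 / norm y) *\<^sub>R y"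
      by (simp only: orthonormal_expansion [OF c y])
    finally have "A b c (?g (A c b x)) = (\<lambda>i. if i < Suc m then inner (b i) y / norm y else 0)"
      unfolding A_def [of b c] by (simp add: fun_eq_iff del: sum.lessThan_Suc)
    with 1 show ?thesis by simp
  qed
  have "Brouwer_degree2 m (A b c) * Brouwer_degree2 m (A c b) = Brouwer_degree2 m (A b c \<circ> A c b)"
    using Brouwer_degree2_compose cA b c by metis
  also have "\<dots> = Brouwer_degree2 m id"
    by (rule Brouwer_degree2_eq) (simp add: AA)
  finally have one: "Brouwer_degree2 m (A b c) * Brouwer_degree2 m (A c b) = 1"
    by simp
  have "Brouwer_degree2 m (sphere_map (Suc m) b g 0 1) = Brouwer_degree2 m (A b c \<circ> (?g \<circ> A c b))"
    by (rule Brouwer_degree2_eq [OF eq])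
  also have "\<dots> = Brouwer_degree2 m (A b c) * (Brouwer_degree2 m ?g * Brouwer_degree2 m (A c b))"
    using Brouwer_degree2_compose cA cg b c continuous_map_compose by metis
  also have "\<dots> = Brouwer_degree2 m ?g"
    using one by (simp add: algebra_simps)
  finally show ?thesis .
qed


section \<open>The Brouwer degree on the unit ball and its homotopy invariance\<close>

lemma sphere_map_rescale: "sphere_map n b g u r = sphere_map n b (\<lambda>x. g (u + r *\<^sub>R x)) 0 1"
  by (simp add: fun_eq_iff sphere_map_def)

text \<open>With centre and radius absorbed into the map, every degree argument takes place on the
  unit sphere, and a radius that varies with time becomes an ordinary homotopy.\<close>

lemma Brouwer_degree_ball_rescale:
  "Brouwer_degree_ball F g u r = Brouwer_degree_ball F (\<lambda>x. g (u + r *\<^sub>R x)) 0 1"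
  unfolding Brouwer_degree_ball_def by (subst sphere_map_rescale) simp

lemma Brouwer_degree_ball_eq:
  fixes g :: "'a::real_inner \<Rightarrow> 'a"
  assumes b: "orthonormal_basis F (Suc m) b"
    and g: "continuous_on (sphere 0 1 \<inter> F) g" "\<And>x. x \<in> sphere 0 1 \<inter> F \<Longrightarrow> g x \<in> F - {0}"
  shows "Brouwer_degree_ball F g 0 1 = Brouwer_degree2 m (sphere_map (Suc m) b g 0 1)"
proof -
  have dim: "dim F = Suc m"
    by (rule orthonormal_basis_independent(3) [OF b])
  have "orthonormal_basis F (Suc m) (SOME b. orthonormal_basis F (Suc m) b)"
    by (rule someI [of "orthonormal_basis F (Suc m)", OF b])
  then show ?thesis
    using Brouwer_degree2_sphere_map_basis [OF _ b g] by (simp add: Brouwer_degree_ball_def dim)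
qed

lemma Brouwer_degree_ball_homotopic:
  fixes H :: "real \<Rightarrow> 'a::real_inner \<Rightarrow> 'a"
  assumes F: "subspace F" "finite_dimensional_on F"
    and cont: "continuous_on ({0..1} \<times> (sphere 0 1 \<inter> F)) (\<lambda>(t, x). H t x)"
    and H: "\<And>t x. t \<in> {0..1} \<Longrightarrow> x \<in> sphere 0 1 \<inter> F \<Longrightarrow> H t x \<in> F - {0}"
  shows "Brouwer_degree_ball F (H 0) 0 1 = Brouwer_degree_ball F (H 1) 0 1"
proof (cases "dim F")
  case 0
  then show ?thesis by (simp add: Brouwer_degree_ball_def)
next
  case (Suc m)
  then obtain b where b: "orthonormal_basis F (Suc m) b"
    using orthonormal_basis_exists [OF F] by metis
  have c: "continuous_on (sphere 0 1 \<inter> F) (H t)" if "t \<in> {0..1}" for t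
  proof -
    have "continuous_on (sphere 0 1 \<inter> F) (\<lambda>x. (\<lambda>(t, x). H t x) (t, x))"
      using that by (intro continuous_on_compose2 [OF cont] continuous_intros) auto
    then show ?thesis by simp
  qed
  show ?thesis
    using Brouwer_degree2_homotopic [OF sphere_map_homotopic [OF b cont H]]
      Brouwer_degree_ball_eq [OF b c [of 0] H [of 0]] Brouwer_degree_ball_eq [OF b c [of 1] H [of 1]]
    by simp
qed

section \<open>Splitting off orthogonal directions\<close>

lemma orthonormal_basis_prefix:
  assumes "orthonormal_basis F n b" "k \<le> n"
  shows "orthonormal_basis (span (b ` {..<k})) k b"
  using assms by (auto simp: orthonormal_basis_def)

lemma orthonormal_prefix_iff:
  assumes b: "orthonormal_basis F (Suc k) b" and y: "y \<in> F"
  shows "y \<in> span (b ` {..<k}) \<longleftrightarrow> inner (b k) y = 0"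
proof
  assume "y \<in> span (b ` {..<k})"
  then show "inner (b k) y = 0"
    by (induction rule: span_induct_alt)
       (use orthonormal_basisD(3) [OF b] in \<open>auto simp: inner_add_right less_Suc_eq\<close>)
next
  assume "inner (b k) y = 0"
  then have "y = (\<Sum>j<k. inner (b j) y *\<^sub>R b j)"
    using orthonormal_expansion [OF b y] by simp
  also have "\<dots> \<in> span (b ` {..<k})"
    by (intro orthonormal_sum_in [OF orthonormal_basis_prefix [OF b]]) simp
  finally show "y \<in> span (b ` {..<k})" .
qed

text \<open>Coordinate \<open>k\<close> of the boundary map is a multiple of \<open>x k\<close>
  whose sign is that of \<open>c\<close>. After a reflection when \<open>c\<close> is negative, the
  map preserves both hemispheres, so its degree is that of its restriction to the equator, which is
  the boundary map of the span of the first \<open>k\<close> basis vectors.\<close>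

lemma Brouwer_degree_ball_reduction_step:
  fixes g :: "'a::real_inner \<Rightarrow> 'a"
  assumes b: "orthonormal_basis F (Suc k) b"
    and g: "continuous_on (sphere 0 1 \<inter> F) g" "\<And>x. x \<in> sphere 0 1 \<inter> F \<Longrightarrow> g x \<in> F - {0}"
    and c: "c \<noteq> 0" "\<And>x. x \<in> sphere 0 1 \<inter> F \<Longrightarrow> inner (b k) (g x) = c * inner (b k) x"
  shows "Brouwer_degree_ball F g 0 1
           = (if 0 < c then 1 else -1) * Brouwer_degree_ball (span (b ` {..<k})) g 0 1"
proof -
  define E where "E = span (b ` {..<k})"
  \<comment> \<open>The sign of \<open>c\<close>, so that multiplying coordinate \<open>k\<close> by
    \<open>s\<close> turns the factor \<open>c\<close> into its absolute value.\<close>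
  define s :: real where "s = (if 0 < c then 1 else -1)"
  define \<rho> where "\<rho> \<equiv> \<lambda>(x::nat\<Rightarrow>real) i. if i = k then s * x i else x i"
  have deg\<rho>: "Brouwer_degree2 k \<rho> = (if 0 < c then 1 else -1)"
  proof (cases "0 < c")
    case True
    then have "\<rho> = id" by (auto simp: \<rho>_def s_def fun_eq_iff)
    with True show ?thesis by simp
  next
    case False
    then have "\<rho> = (\<lambda>x i. if i = k then - x i else x i)" by (auto simp: \<rho>_def s_def fun_eq_iff)
    with False show ?thesis by (simp add: Brouwer_degree2_reflection_coordinate)
  qed
  have cm\<rho>: "continuous_map (nsphere k) (nsphere k) \<rho>"
  proof (cases "0 < c")
    case True
    then have "\<rho> = id" by (auto simp: \<rho>_def s_def fun_eq_iff)
    then show ?thesis by simp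
  next
    case False
    then have "\<rho> = (\<lambda>x i. if i = k then - x i else x i)" by (auto simp: \<rho>_def s_def fun_eq_iff)
    then show ?thesis by (simp add: continuous_map_nsphere_reflection)
  qed
  have ss: "s * s = 1" "s * c = \<bar>c\<bar>" "c = s * \<bar>c\<bar>"
    by (auto simp: s_def)
  let ?f = "sphere_map (Suc k) b g 0 1"
  have cmf: "continuous_map (nsphere k) (nsphere k) ?f"
    by (rule continuous_map_sphere_map [OF b g])
  have onE: "orthonormal_basis E k b"
    unfolding E_def using orthonormal_basis_prefix [OF b] by simp
  have EF: "E \<subseteq> F"
    unfolding E_def using orthonormal_basisD [OF b] by (intro span_minimal) auto
  have DF: "Brouwer_degree_ball F g 0 1 = Brouwer_degree2 k ?f"
    by (rule Brouwer_degree_ball_eq [OF b g])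
  have fk: "?f x k = c * x k / norm (g (\<Sum>j<Suc k. x j *\<^sub>R b j))" if "x \<in> topspace (nsphere k)" for x
    using c(2) [OF orthonormal_sum_in_sphere [OF b that]] inner_orthonormal_sum [OF b, of k x]
    by (simp add: sphere_map_def Let_def del: sum.lessThan_Suc)
  have D\<rho>: "Brouwer_degree2 k (\<rho> \<circ> ?f) = (if 0 < c then 1 else -1) * Brouwer_degree2 k ?f"
    using Brouwer_degree2_compose [OF cmf cm\<rho>] deg\<rho> by simp
  have "Brouwer_degree2 k (\<rho> \<circ> ?f) = Brouwer_degree_ball E g 0 1"
  proof (cases k)
    \<comment> \<open>Here \<open>F\<close> is a line and the sphere has no equator. The corrected
      map is the identity on its two points, which agrees with the convention that the degree on the
      zero space is 1.\<close>
    case 0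
    have "dim E = 0"
      using orthonormal_basis_independent(3) [OF onE] 0 by simp
    then have "Brouwer_degree_ball E g 0 1 = 1"
      by (simp add: Brouwer_degree_ball_def)
    moreover have "(\<rho> \<circ> ?f) x = id x" if x: "x \<in> topspace (nsphere k)" for x
    proof
      fix i
      let ?y = "g (\<Sum>j<Suc k. x j *\<^sub>R b j)"
      have yF: "?y \<in> F"
        using g(2) [OF orthonormal_sum_in_sphere [OF b x]] by blast
      have "inner (b 0) ?y = c * x 0"
        using c(2) [OF orthonormal_sum_in_sphere [OF b x]] inner_orthonormal_sum [OF b, of k x] 0 by simp
      then have y: "?y = (c * x 0) *\<^sub>R b 0"
        using orthonormal_expansion [OF b yF] 0 by simp
      have "norm (b 0) = 1"
        using orthonormal_basisD(3) [OF b, of 0 0] by (simp add: norm_eq_1)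
      moreover have x0: "\<bar>x 0\<bar> = 1"
        using x 0 by (simp add: topspace_nsphere_iff abs_square_eq_1)
      ultimately have ny: "norm ?y = \<bar>c\<bar>"
        unfolding y by (simp add: abs_mult)
      have "s * (c * x 0 / \<bar>c\<bar>) = x 0"
        using c(1) ss by (simp add: field_simps)
      then show "(\<rho> \<circ> ?f) x i = id x i"
        using fk [OF x] ny x 0 by (auto simp: \<rho>_def sphere_map_def Let_def topspace_nsphere_iff)
    qed
    then have "Brouwer_degree2 k (\<rho> \<circ> ?f) = 1"
      using Brouwer_degree2_eq [of k "\<rho> \<circ> ?f" id] by simp
    ultimately show ?thesis by simp
  next
    case (Suc m)
    have \<rho>fk: "(\<rho> \<circ> ?f) x k = \<bar>c\<bar> * x k / norm (g (\<Sum>j<Suc k. x j *\<^sub>R b j))"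
      if "x \<in> topspace (nsphere k)" for x
      using fk [OF that] ss by (simp add: \<rho>_def flip: mult.assoc)
    have "Brouwer_degree2 (Suc m) (\<rho> \<circ> ?f) = Brouwer_degree2 m (\<rho> \<circ> ?f)"
    proof (rule Brouwer_degree2_equator)
      show "continuous_map (nsphere (Suc m)) (nsphere (Suc m)) (\<rho> \<circ> ?f)"
        using cm\<rho> cmf Suc continuous_map_compose by metis
    next
      fix x assume "x \<in> topspace (nsphere (Suc m))" "0 \<le> x (Suc m)"
      then show "0 \<le> (\<rho> \<circ> ?f) x (Suc m)"
        using \<rho>fk [of x] Suc by simp
    next
      fix x assume "x \<in> topspace (nsphere (Suc m))" "x (Suc m) \<le> 0"
      then show "(\<rho> \<circ> ?f) x (Suc m) \<le> 0"
        using \<rho>fk [of x] Suc by (simp add: divide_nonpos_nonneg mult_nonneg_nonpos)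
    qed
    also have "\<dots> = Brouwer_degree2 m (sphere_map (Suc m) b g 0 1)"
    proof (rule Brouwer_degree2_eq, rule)
      fix x i assume x: "x \<in> topspace (nsphere m)"
      have xk: "x k = 0"
        using x Suc by (simp add: topspace_nsphere_iff)
      have xt: "x \<in> topspace (nsphere k)"
        using x Suc by (auto simp: topspace_nsphere_iff)
      have "(\<rho> \<circ> ?f) x k = 0"
        using \<rho>fk [OF xt] xk by simp
      moreover have "(\<rho> \<circ> ?f) x i = sphere_map k b g 0 1 x i" if "i \<noteq> k"
        using that xk by (auto simp: \<rho>_def sphere_map_def Let_def)
      ultimately show "(\<rho> \<circ> ?f) x i = sphere_map (Suc m) b g 0 1 x i"
        using Suc by (cases "i = k") (auto simp: sphere_map_def Let_def)
    qed
    also have "\<dots> = Brouwer_degree_ball E g 0 1"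
    proof (rule Brouwer_degree_ball_eq [symmetric])
      show "orthonormal_basis E (Suc m) b"
        using onE Suc by simp
      show "continuous_on (sphere 0 1 \<inter> E) g"
        using g(1) EF by (auto intro: continuous_on_subset)
      show "g x \<in> E - {0}" if "x \<in> sphere 0 1 \<inter> E" for x
      proof -
        have xF: "x \<in> sphere 0 1 \<inter> F" and "g x \<in> F - {0}"
          using that EF g(2) by auto
        moreover have "inner (b k) x = 0"
          using that orthonormal_prefix_iff [OF b] xF by (auto simp: E_def)
        ultimately show ?thesis
          using orthonormal_prefix_iff [OF b, of "g x"] c(2) [OF xF] by (auto simp: E_def)
      qed
    qed
    finally show ?thesis
      using Suc by simp
  qed
  then show ?thesis
    unfolding DF using D\<rho> by (simp add: E_def split: if_splits)
qed

text \<open>For \<open>c > 0\<close> this is the reduction property behind the independence of the Leray--Schauder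
  degree of the approximating subspace; for \<open>c < 0\<close> it produces the sign in the index formula.\<close>

lemma Brouwer_degree_ball_reduction:
  fixes g :: "'a::real_inner \<Rightarrow> 'a"
  assumes F: "subspace F" "finite_dimensional_on F" and E: "subspace E" "E \<subseteq> F"
    and g: "continuous_on (sphere 0 1 \<inter> F) g" "\<And>x. x \<in> sphere 0 1 \<inter> F \<Longrightarrow> g x \<in> F - {0}"
    and c: "c \<noteq> 0" "\<And>x y. x \<in> sphere 0 1 \<inter> F \<Longrightarrow> y \<in> F \<Longrightarrow> (\<And>z. z \<in> E \<Longrightarrow> inner y z = 0)
                \<Longrightarrow> inner y (g x) = c * inner y x"
  shows "Brouwer_degree_ball F g 0 1
           = (if 0 < c then 1 else -1) ^ (dim F - dim E) * Brouwer_degree_ball E g 0 1"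
proof -
  have Efin: "finite_dimensional_on E"
  proof -
    obtain B where B: "B \<subseteq> E" "independent B" "E \<subseteq> span B"
      using maximal_independent_subset by blast
    moreover obtain C where C: "finite C" "span C = F"
      using F by (auto simp: finite_dimensional_on_def)
    ultimately have "finite B"
      using independent_span_bound [of C B] E by auto
    moreover have "span B = E"
      using B E by (simp add: span_subspace)
    ultimately show ?thesis
      by (auto simp: finite_dimensional_on_def)
  qed
  obtain a where a: "orthonormal_basis E (dim E) a"
    using orthonormal_basis_exists [OF E(1) Efin] .
  obtain n b where b: "dim E \<le> n" "orthonormal_basis F n b" "\<And>i. i < dim E \<Longrightarrow> b i = a i"
    using orthonormal_basis_extend [OF F a E(2)] by blast
  have spE: "span (b ` {..<dim E}) = E"
    using orthonormal_basisD(1) [OF a] b(3) by (metis (mono_tags, lifting) image_cong lessThan_iff)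
  have perp: "inner (b j) z = 0" if "dim E \<le> j" "j < n" "z \<in> E" for j z
  proof -
    have "z \<in> span (b ` {..<dim E})"
      using that(3) by (simp only: spE)
    then show ?thesis
      by (induction rule: span_induct_alt)
         (use that orthonormal_basisD(3) [OF b(2)] in \<open>auto simp: inner_add_right\<close>)
  qed
  have pref: "orthonormal_basis (span (b ` {..<k})) k b" "span (b ` {..<k}) \<subseteq> F" if "k \<le> n" for k
  proof -
    show "orthonormal_basis (span (b ` {..<k})) k b"
      by (rule orthonormal_basis_prefix [OF b(2) that])
    show "span (b ` {..<k}) \<subseteq> F"
      using that orthonormal_basisD(4) [OF b(2)] F(1) by (intro span_minimal) auto
  qed
  have cb: "inner (b k) (g x) = c * inner (b k) x" if "dim E \<le> k" "k < n" "x \<in> sphere 0 1 \<inter> F" for k x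
    using c(2) [OF that(3) orthonormal_basisD(4) [OF b(2) that(2)]] perp [OF that(1,2)] by blast
  have "span (b ` {..<n}) = F"
    by (rule orthonormal_basisD(1) [OF b(2)])
  \<comment> \<open>Induction on the number \<open>d\<close> of directions removed from the end of
    the basis. Invariance of the smaller span under \<open>g\<close> has to be carried along,
    because each single step needs a map of the current subspace into itself.\<close>
  have "(\<forall>x \<in> sphere 0 1 \<inter> span (b ` {..<n - d}). g x \<in> span (b ` {..<n - d})) \<and>
        Brouwer_degree_ball F g 0 1
          = (if 0 < c then 1 else -1) ^ d * Brouwer_degree_ball (span (b ` {..<n - d})) g 0 1"
    if "dim E + d \<le> n" for d
    using that
  proof (induction d)
    case 0
    then show ?case
      using g(2) by (auto simp: \<open>span (b ` {..<n}) = F\<close>)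
  next
    case (Suc d)
    define k where "k = n - Suc d"
    have k: "n - d = Suc k" "dim E \<le> k" "k < n" "Suc k \<le> n"
      using Suc.prems by (auto simp: k_def)
    let ?F = "span (b ` {..<Suc k})"
    have b': "orthonormal_basis ?F (Suc k) b" and F': "?F \<subseteq> F"
      using pref [OF k(4)] by auto
    have IH: "\<And>x. x \<in> sphere 0 1 \<inter> ?F \<Longrightarrow> g x \<in> ?F"
      "Brouwer_degree_ball F g 0 1 = (if 0 < c then 1 else -1) ^ d * Brouwer_degree_ball ?F g 0 1"
      using Suc.IH Suc.prems unfolding k(1) by auto
    have "Brouwer_degree_ball ?F g 0 1
            = (if 0 < c then 1 else -1) * Brouwer_degree_ball (span (b ` {..<k})) g 0 1"
    proof (rule Brouwer_degree_ball_reduction_step [OF b' _ _ c(1)])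
      show "continuous_on (sphere 0 1 \<inter> ?F) g"
        using g(1) F' by (auto intro: continuous_on_subset)
      show "g x \<in> ?F - {0}" if "x \<in> sphere 0 1 \<inter> ?F" for x
        using IH(1) [OF that] g(2) that F' by auto
      show "inner (b k) (g x) = c * inner (b k) x" if "x \<in> sphere 0 1 \<inter> ?F" for x
        using cb k that F' by auto
    qed
    moreover have "g x \<in> span (b ` {..<k})" if "x \<in> sphere 0 1 \<inter> span (b ` {..<k})" for x
    proof -
      have x: "x \<in> sphere 0 1 \<inter> ?F"
        using that span_mono [of "b ` {..<k}" "b ` {..<Suc k}"] by (auto simp: lessThan_Suc)
      have "inner (b k) x = 0"
        using orthonormal_prefix_iff [OF b', of x] that x by simp
      then have "inner (b k) (g x) = 0"
        using cb [of k x] k x F' by auto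
      then show ?thesis
        using orthonormal_prefix_iff [OF b' IH(1) [OF x]] by simp
    qed
    ultimately show ?case
      using IH(2) by (simp add: k_def [symmetric] mult.assoc mult.commute mult.left_commute)
  qed
  from this [of "n - dim E"] show ?thesis
    using b(1) spE orthonormal_basis_independent(3) [OF b(2)] by simp
qed

section \<open>The Leray--Schauder degree\<close>

text \<open>The admissible data over which the description in \<open>LS_degree\<close> ranges, named
  so that independence of their choice can be stated.\<close>

definition LS_approximation ::
  "'a::real_inner set \<Rightarrow> ('a \<Rightarrow> 'a) \<Rightarrow> 'a \<Rightarrow> real \<Rightarrow> 'a set \<Rightarrow> ('a \<Rightarrow> 'a) \<Rightarrow> real \<Rightarrow> bool" where
  "LS_approximation S T u r F L \<delta> \<longleftrightarrow>
     subspace F \<and> finite_dimensional_on F \<and> F \<subseteq> S \<and> u \<in> F \<and>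
     continuous_on (cball u r \<inter> S) L \<and> L ` (cball u r \<inter> S) \<subseteq> F \<and>
     (\<forall>x \<in> cball u r \<inter> S. norm (L x - (x - T x)) < \<delta>) \<and>
     (\<forall>x \<in> sphere u r \<inter> S. \<delta> \<le> norm (T x))"

lemma LS_degree_altdef:
  "LS_degree S T u r =
     (THE d. \<exists>F L \<delta>. LS_approximation S T u r F L \<delta> \<and> d = Brouwer_degree_ball F (\<lambda>x. x - L x) u r)"
  by (simp add: LS_degree_def LS_approximation_def conj_assoc)

lemma LS_approximation_rescaled:
  assumes "LS_approximation S T u r F L \<delta>" "0 < r" "subspace E" "F \<subseteq> E" "E \<subseteq> S"
  shows "continuous_on (sphere 0 1 \<inter> E) (\<lambda>x. u + r *\<^sub>R x - L (u + r *\<^sub>R x))"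
    and "\<And>x. x \<in> sphere 0 1 \<inter> E \<Longrightarrow> u + r *\<^sub>R x \<in> sphere u r \<inter> E"
    and "\<And>x. x \<in> sphere 0 1 \<inter> E \<Longrightarrow> u + r *\<^sub>R x - L (u + r *\<^sub>R x) \<in> E"
proof -
  note a = assms(1) [unfolded LS_approximation_def]
  show sph: "u + r *\<^sub>R x \<in> sphere u r \<inter> E" if "x \<in> sphere 0 1 \<inter> E" for x
    using that a assms by (auto simp: dist_norm intro!: subspace_add subspace_scale)
  have sph': "u + r *\<^sub>R x \<in> cball u r \<inter> S" if "x \<in> sphere 0 1 \<inter> E" for x
    using sph [OF that] assms(5) by auto
  show "continuous_on (sphere 0 1 \<inter> E) (\<lambda>x. u + r *\<^sub>R x - L (u + r *\<^sub>R x))"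
    by (rule continuous_on_diff [OF _ continuous_on_compose2 [of "cball u r \<inter> S" L]])
       (use a sph' in \<open>auto intro!: continuous_intros\<close>)
  show "u + r *\<^sub>R x - L (u + r *\<^sub>R x) \<in> E" if "x \<in> sphere 0 1 \<inter> E" for x
  proof -
    have "L (u + r *\<^sub>R x) \<in> E"
      using sph' [OF that] a assms(4) by blast
    then show ?thesis
      using sph [OF that] assms(3) by (auto intro: subspace_diff)
  qed
qed

text \<open>At a zero of \<open>x - L x\<close> the approximation error would equal
  \<open>T x\<close>, although \<open>\<delta>\<close> lies strictly above the error and not above
  \<open>norm (T x)\<close>.\<close>

lemma LS_approximation_nonzero:
  assumes "LS_approximation S T u r F L \<delta>" "x \<in> sphere u r \<inter> S"
  shows "x - L x \<noteq> 0"
proof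
  assume "x - L x = 0"
  then have "L x - (x - T x) = T x"
    by (metis diff_diff_eq2 diff_add_cancel add_diff_cancel_left' eq_iff_diff_eq_0)
  moreover have "norm (L x - (x - T x)) < \<delta>" "\<delta> \<le> norm (T x)"
    using assms by (auto simp: LS_approximation_def)
  ultimately show False
    by simp
qed

text \<open>Since \<open>u\<close> and all values of \<open>L\<close> lie in \<open>F\<close>, the
  rescaled map acts as multiplication by the radius in every direction orthogonal to
  \<open>F\<close>. The radius is positive, so the reduction produces no sign.\<close>

lemma LS_approximation_enlarge:
  assumes a: "LS_approximation S T u r F L \<delta>" and r: "0 < r"
    and E: "subspace E" "finite_dimensional_on E" "F \<subseteq> E" "E \<subseteq> S"
  shows "Brouwer_degree_ball E (\<lambda>x. x - L x) u r = Brouwer_degree_ball F (\<lambda>x. x - L x) u r"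
proof -
  note a' = a [unfolded LS_approximation_def]
  let ?g = "\<lambda>x. u + r *\<^sub>R x - L (u + r *\<^sub>R x)"
  note g = LS_approximation_rescaled [OF a r E(1,3,4)]
  have nz: "?g x \<noteq> 0" if "x \<in> sphere 0 1 \<inter> E" for x
    using LS_approximation_nonzero [OF a] g(2) [OF that] E(4) by auto
  have "Brouwer_degree_ball E ?g 0 1
      = (if 0 < r then 1 else -1) ^ (dim E - dim F) * Brouwer_degree_ball F ?g 0 1"
  proof (rule Brouwer_degree_ball_reduction [OF E(1,2) _ E(3) g(1)])
    show "subspace F" using a' by blast
    show "?g x \<in> E - {0}" if "x \<in> sphere 0 1 \<inter> E" for x
      using g(3) nz that by blast
    show "r \<noteq> 0" using r by simp
    fix x y assume x: "x \<in> sphere 0 1 \<inter> E" and y: "y \<in> E" "\<And>z. z \<in> F \<Longrightarrow> inner y z = 0"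
    have "u + r *\<^sub>R x \<in> cball u r \<inter> S"
      using g(2) [OF x] E(4) by auto
    then have "u \<in> F" "L (u + r *\<^sub>R x) \<in> F"
      using a' by blast+
    then have "inner y u = 0" "inner y (L (u + r *\<^sub>R x)) = 0"
      using y(2) by blast+
    then show "inner y (?g x) = r * inner y x"
      by (simp add: inner_diff_right inner_add_right)
  qed
  then show ?thesis
    using r unfolding Brouwer_degree_ball_rescale [of E _ u r] Brouwer_degree_ball_rescale [of F _ u r]
    by simp
qed

text \<open>Once both subspaces are enlarged to a common \<open>E\<close>, both boundary values at a
  point lie in the open ball around \<open>T x\<close> of radius \<open>norm (T x)\<close>. This
  ball is convex and misses 0, so the segment between the two maps is an admissible
  homotopy.\<close>

lemma LS_approximation_unique:
  assumes a1: "LS_approximation S T u r F1 L1 \<delta>1" and a2: "LS_approximation S T u r F2 L2 \<delta>2"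
    and S: "subspace S" and r: "0 < r"
  shows "Brouwer_degree_ball F1 (\<lambda>x. x - L1 x) u r = Brouwer_degree_ball F2 (\<lambda>x. x - L2 x) u r"
proof -
  note a1' = a1 [unfolded LS_approximation_def] and a2' = a2 [unfolded LS_approximation_def]
  obtain B1 B2 where B: "finite B1" "span B1 = F1" "finite B2" "span B2 = F2"
    using a1' a2' by (auto simp: finite_dimensional_on_def)
  define E where "E = span (B1 \<union> B2)"
  have E: "subspace E" "finite_dimensional_on E"
    unfolding finite_dimensional_on_def using B(1,3) by (auto simp: E_def intro!: exI [of _ "B1 \<union> B2"])
  have FE: "F1 \<subseteq> E" "F2 \<subseteq> E"
    using span_mono [of B1 "B1 \<union> B2"] span_mono [of B2 "B1 \<union> B2"] by (auto simp: E_def B(2,4))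
  have "B1 \<subseteq> S" "B2 \<subseteq> S"
    using a1' a2' B(2,4) span_superset by (metis order_trans)+
  then have ES: "E \<subseteq> S"
    unfolding E_def using S by (intro span_minimal) auto
  let ?g1 = "\<lambda>x. u + r *\<^sub>R x - L1 (u + r *\<^sub>R x)" and ?g2 = "\<lambda>x. u + r *\<^sub>R x - L2 (u + r *\<^sub>R x)"
  note g1 = LS_approximation_rescaled [OF a1 r E(1) FE(1) ES]
    and g2 = LS_approximation_rescaled [OF a2 r E(1) FE(2) ES]
  let ?H = "\<lambda>(t::real) x. (1 - t) *\<^sub>R ?g1 x + t *\<^sub>R ?g2 x"
  have "Brouwer_degree_ball E (?H 0) 0 1 = Brouwer_degree_ball E (?H 1) 0 1"
  proof (rule Brouwer_degree_ball_homotopic [OF E])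
    have c1: "continuous_on ({0..1::real} \<times> (sphere 0 1 \<inter> E)) (\<lambda>p. ?g1 (snd p))"
      by (rule continuous_on_compose2 [OF g1(1)]) (auto intro: continuous_intros)
    have c2: "continuous_on ({0..1::real} \<times> (sphere 0 1 \<inter> E)) (\<lambda>p. ?g2 (snd p))"
      by (rule continuous_on_compose2 [OF g2(1)]) (auto intro: continuous_intros)
    show "continuous_on ({0..1} \<times> (sphere 0 1 \<inter> E)) (\<lambda>(t, x). ?H t x)"
      unfolding case_prod_unfold
      by (rule continuous_on_add [OF continuous_on_scaleR [OF _ c1] continuous_on_scaleR [OF _ c2]];
          intro continuous_intros)
    fix t :: real and x assume t: "t \<in> {0..1}" and x: "x \<in> sphere 0 1 \<inter> E"
    let ?x = "u + r *\<^sub>R x"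
    have xs: "?x \<in> sphere u r \<inter> S" "?x \<in> cball u r \<inter> S"
      using g1(2) [OF x] ES by auto
    have "norm (L1 ?x - (?x - T ?x)) < \<delta>1" "\<delta>1 \<le> norm (T ?x)"
      "norm (L2 ?x - (?x - T ?x)) < \<delta>2" "\<delta>2 \<le> norm (T ?x)"
      using a1' a2' xs by blast+
    moreover have "L1 ?x - (?x - T ?x) = T ?x - ?g1 x" "L2 ?x - (?x - T ?x) = T ?x - ?g2 x"
      by simp_all
    ultimately have n: "norm (T ?x - ?g1 x) < norm (T ?x)" "norm (T ?x - ?g2 x) < norm (T ?x)"
      by (metis less_le_trans)+
    have "?H t x \<noteq> 0"
    proof
      assume "?H t x = 0"
      then have "T ?x = (1 - t) *\<^sub>R (T ?x - ?g1 x) + t *\<^sub>R (T ?x - ?g2 x)"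
        by (simp add: algebra_simps)
      then have "norm (T ?x) \<le> (1 - t) * norm (T ?x - ?g1 x) + t * norm (T ?x - ?g2 x)"
        using t norm_triangle_ineq [of "(1 - t) *\<^sub>R (T ?x - ?g1 x)" "t *\<^sub>R (T ?x - ?g2 x)"] by simp
      also have "\<dots> < norm (T ?x)"
        using n t by (intro convex_bound_lt) auto
      finally show False by simp
    qed
    moreover have "?H t x \<in> E"
      using g1(3) [OF x] g2(3) [OF x] E(1) by (intro subspace_add subspace_scale)
    ultimately show "?H t x \<in> E - {0}" by blast
  qed
  then have "Brouwer_degree_ball E (\<lambda>x. x - L1 x) u r = Brouwer_degree_ball E (\<lambda>x. x - L2 x) u r"
    unfolding Brouwer_degree_ball_rescale [of E _ u r] by simp
  then show ?thesis
    using LS_approximation_enlarge [OF a1 r E FE(1) ES] LS_approximation_enlarge [OF a2 r E FE(2) ES]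
    by simp
qed

text \<open>Makes the definite description usable: a single approximation, whichever is convenient,
  computes the degree.\<close>

lemma LS_degree_eq:
  assumes "LS_approximation S T u r F L \<delta>" "subspace S" "0 < r"
  shows "LS_degree S T u r = Brouwer_degree_ball F (\<lambda>x. x - L x) u r"
  unfolding LS_degree_altdef
  by (rule the_equality) (use assms LS_approximation_unique in blast)+

text \<open>\<open>F\<close> is spanned by a finite \<open>e\<close>-net of \<open>Z\<close>
  together with \<open>A\<close>, and \<open>p\<close> is the orthogonal projection onto
  \<open>F\<close>: a point of \<open>Z\<close> is no farther from \<open>F\<close> than from the
  net. The set \<open>A\<close> forces prescribed vectors, such as the centre of a ball, into
  \<open>F\<close>.\<close>

lemma finite_dimensional_approximation:
  fixes Z :: "'a::real_inner set"
  assumes Z: "compact Z" "Z \<subseteq> S" and S: "subspace S" and A: "finite A" "A \<subseteq> S" and e: "0 < e"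
  obtains F p where "subspace F" "finite_dimensional_on F" "A \<subseteq> F" "F \<subseteq> S"
    "continuous_on UNIV p" "\<And>x. p x \<in> F" "\<And>z. z \<in> Z \<Longrightarrow> norm (p z - z) < e"
proof -
  obtain N where N: "finite N" "N \<subseteq> Z" "Z \<subseteq> (\<Union>x\<in>N. ball x e)"
    using seq_compact_imp_totally_bounded [of Z] Z(1) e
    unfolding compact_eq_seq_compact_metric by blast
  define F where "F = span (A \<union> N)"
  have F: "subspace F" "finite_dimensional_on F"
    unfolding finite_dimensional_on_def using N(1) A(1) by (auto simp: F_def intro!: exI [of _ "A \<union> N"])
  have AF: "A \<subseteq> F" and NF: "N \<subseteq> F"
    using span_superset [of "A \<union> N"] by (auto simp: F_def)
  have FS: "F \<subseteq> S"
    unfolding F_def using N Z A S by (intro span_minimal) auto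
  obtain b where b: "orthonormal_basis F (dim F) b"
    using orthonormal_basis_exists [OF F] .
  define p where "p x = (\<Sum>j<dim F. inner (b j) x *\<^sub>R b j)" for x
  have pF: "p x \<in> F" for x
    unfolding p_def by (rule orthonormal_sum_in [OF b])
  have pN: "norm (p z - z) < e" if z: "z \<in> Z" for z
  proof -
    have "z \<in> (\<Union>x\<in>N. ball x e)"
      using N(3) z by blast
    then obtain y where y: "y \<in> N" "norm (y - z) < e"
      by (auto simp: dist_norm)
    have "inner w (z - p z) = 0" if w: "w \<in> F" for w
    proof -
      have "inner (b j) (z - p z) = 0" if "j < dim F" for j
        using inner_orthonormal_sum [OF b that] by (simp add: p_def inner_diff_right)
      then have "inner (\<Sum>j<dim F. inner (b j) w *\<^sub>R b j) (z - p z) = 0"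
        by (simp add: inner_sum_left)
      then show ?thesis
        by (simp add: orthonormal_expansion [OF b w])
    qed
    moreover have "y - p z \<in> F"
      using y(1) NF pF F(1) by (blast intro: subspace_diff)
    ultimately have "inner (y - p z) (z - p z) = 0"
      by blast
    then have "orthogonal (y - p z) (p z - z)"
      unfolding orthogonal_def by (simp add: inner_diff_right)
    from norm_add_Pythagorean [OF this]
    have "(norm (y - z))\<^sup>2 = (norm (y - p z))\<^sup>2 + (norm (p z - z))\<^sup>2"
      by simp
    then have "norm (p z - z) \<le> norm (y - z)"
      by (metis le_add_same_cancel2 norm_ge_zero power2_le_imp_le zero_le_power2)
    with y show ?thesis by simp
  qed
  have "continuous_on UNIV p"
    unfolding p_def by (intro continuous_intros)
  then show thesis
    using that [OF F AF FS _ pF pN] by blast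
qed

text \<open>If the residuals had infimum 0, compactness would give a subsequence along which both
  the parameter and \<open>C\<close> converge; the points themselves then converge as well, being
  residual plus value of \<open>C\<close>, and the limit is a forbidden fixed point in the closed
  set \<open>M\<close>. The real parameter is included so that one bound serves a whole
  homotopy.\<close>

lemma compact_perturbation_bounded_below:
  fixes C :: "real \<times> 'a::real_normed_vector \<Rightarrow> 'a"
  assumes M: "closed M" "M \<subseteq> {0..1} \<times> UNIV"
    and C: "continuous_on M C" "compact Z" "C ` M \<subseteq> Z"
    and fixfree: "\<And>p. p \<in> M \<Longrightarrow> C p \<noteq> snd p"
  obtains \<delta> where "0 < \<delta>" "\<And>p. p \<in> M \<Longrightarrow> \<delta> \<le> norm (snd p - C p)"
proof (rule ccontr)
  assume "\<not> thesis"
  then have "\<exists>p\<in>M. norm (snd p - C p) < inverse (real (Suc n))" for n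
    using that [of "inverse (real (Suc n))"] by (force simp: not_le)
  then obtain p where p: "\<And>n. p n \<in> M" "\<And>n. norm (snd (p n) - C (p n)) < inverse (real (Suc n))"
    by metis
  have "compact ({0..1::real} \<times> Z)"
    using C(2) by (intro compact_Times) auto
  moreover have "(fst (p n), C (p n)) \<in> {0..1} \<times> Z" for n
    using p(1) [of n] M(2) C(3) by auto
  ultimately obtain l \<sigma> where \<sigma>: "strict_mono \<sigma>" "((\<lambda>n. (fst (p n), C (p n))) \<circ> \<sigma>) \<longlonglongrightarrow> l"
    unfolding compact_eq_seq_compact_metric seq_compact_def by meson
  have t: "(\<lambda>n. fst (p (\<sigma> n))) \<longlonglongrightarrow> fst l" and c: "(\<lambda>n. C (p (\<sigma> n))) \<longlonglongrightarrow> snd l"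
    using tendsto_fst [OF \<sigma>(2)] tendsto_snd [OF \<sigma>(2)] by (simp_all add: o_def)
  have "(\<lambda>n. snd (p n) - C (p n)) \<longlonglongrightarrow> 0"
    by (rule Lim_null_comparison [OF _ LIMSEQ_inverse_real_of_nat])
       (use p(2) in \<open>auto intro!: always_eventually less_imp_le\<close>)
  then have "(\<lambda>n. snd (p (\<sigma> n)) - C (p (\<sigma> n))) \<longlonglongrightarrow> 0"
    using LIMSEQ_subseq_LIMSEQ [OF _ \<sigma>(1)] by (force simp: o_def)
  from tendsto_add [OF this c] have x: "(\<lambda>n. snd (p (\<sigma> n))) \<longlonglongrightarrow> snd l"
    by simp
  have pl: "(\<lambda>n. p (\<sigma> n)) \<longlonglongrightarrow> l"
    using tendsto_Pair [OF t x] by simp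
  have l: "l \<in> M"
    by (rule closed_sequentially [OF M(1) _ pl]) (simp add: p(1))
  have "(\<lambda>n. C (p (\<sigma> n))) \<longlonglongrightarrow> C l"
    by (rule continuous_on_tendsto_compose [OF C(1) pl l]) (simp add: p(1))
  then have "C l = snd l"
    using c LIMSEQ_unique by blast
  with fixfree [OF l] show False by simp
qed

text \<open>One lower bound \<open>\<delta>\<close> valid for all times lets a single
  finite-dimensional projection approximate every \<open>C t\<close>. All degrees are then Brouwer
  degrees on the same \<open>F\<close>, and finite-dimensional homotopy invariance applies. The ball
  of radius \<open>R\<close> provides a fixed domain for the moving spheres.\<close>

lemma LS_degree_homotopy:
  fixes C :: "real \<Rightarrow> 'a::real_inner \<Rightarrow> 'a"
  assumes S: "subspace S" "closed S" "u \<in> S"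
    and \<rho>: "continuous_on {0..1} \<rho>" "\<And>t. t \<in> {0..1} \<Longrightarrow> 0 < \<rho> t \<and> \<rho> t \<le> R"
    and C: "continuous_on ({0..1} \<times> (cball u R \<inter> S)) (\<lambda>(t, x). C t x)"
    and Z: "compact Z" "\<And>t x. t \<in> {0..1} \<Longrightarrow> x \<in> cball u R \<inter> S \<Longrightarrow> C t x \<in> Z \<inter> S"
    and fixfree: "\<And>t x. t \<in> {0..1} \<Longrightarrow> x \<in> sphere u (\<rho> t) \<inter> S \<Longrightarrow> C t x \<noteq> x"
  shows "LS_degree S (\<lambda>x. x - C 0 x) u (\<rho> 0) = LS_degree S (\<lambda>x. x - C 1 x) u (\<rho> 1)"
proof -
  \<comment> \<open>The union of the moving spheres in space-time; it is closed as a zero set of a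
    continuous function on a closed set.\<close>
  define M where "M = {p \<in> {0..1} \<times> S. dist u (snd p) - \<rho> (fst p) = 0}"
  have "continuous_on ({0..1} \<times> S) (\<lambda>p. \<rho> (fst p))"
    by (rule continuous_on_compose2 [OF \<rho>(1)]) (auto intro: continuous_intros)
  then have "closed M"
    unfolding M_def using S(2)
    by (intro continuous_closed_preimage_constant continuous_intros closed_Times) auto
  have MC: "M \<subseteq> {0..1} \<times> (cball u R \<inter> S)"
    using \<rho>(2) by (auto simp: M_def)
  have cM: "continuous_on M (\<lambda>(t, x). C t x)"
    using C MC by (rule continuous_on_subset)
  have ZM: "(\<lambda>(t, x). C t x) ` M \<subseteq> Z"
    using MC Z(2) by (auto simp: subset_iff)
  have fM: "(\<lambda>(t, x). C t x) p \<noteq> snd p" if "p \<in> M" for p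
    using fixfree that by (cases p) (auto simp: M_def)
  have M01: "M \<subseteq> {0..1} \<times> UNIV"
    using MC by auto
  obtain \<delta> where \<delta>: "0 < \<delta>" "\<And>p. p \<in> M \<Longrightarrow> \<delta> \<le> norm (snd p - (\<lambda>(t, x). C t x) p)"
    using compact_perturbation_bounded_below [OF \<open>closed M\<close> M01 cM Z(1) ZM fM] by blast
  have ZS: "compact (Z \<inter> S)" "Z \<inter> S \<subseteq> S"
    using Z(1) S(2) by (auto intro: compact_Int_closed)
  obtain F p where F: "subspace F" "finite_dimensional_on F" "{u} \<subseteq> F" "F \<subseteq> S"
    and p: "continuous_on UNIV p" "\<And>x. p x \<in> F" "\<And>z. z \<in> Z \<inter> S \<Longrightarrow> norm (p z - z) < \<delta>"
    using finite_dimensional_approximation [OF ZS S(1), of "{u}" \<delta>] S(3) \<delta>(1) by auto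
  have Ct: "continuous_on (cball u (\<rho> t) \<inter> S) (C t)" if t: "t \<in> {0..1}" for t
  proof -
    have "continuous_on (cball u (\<rho> t) \<inter> S) (\<lambda>x. (\<lambda>(t, x). C t x) (t, x))"
      by (rule continuous_on_compose2 [OF C]) (use t \<rho>(2) in \<open>force intro!: continuous_intros\<close>)+
    then show ?thesis by simp
  qed
  have ap: "LS_approximation S (\<lambda>x. x - C t x) u (\<rho> t) F (\<lambda>x. p (C t x)) \<delta>" if t: "t \<in> {0..1}" for t
    unfolding LS_approximation_def
  proof (intro conjI ballI F)
    show "u \<in> F" using F(3) by simp
    show "continuous_on (cball u (\<rho> t) \<inter> S) (\<lambda>x. p (C t x))"
      by (rule continuous_on_compose2 [OF p(1) Ct [OF t]]) auto
    show "(\<lambda>x. p (C t x)) ` (cball u (\<rho> t) \<inter> S) \<subseteq> F"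
      using p(2) by auto
    show "norm (p (C t x) - (x - (x - C t x))) < \<delta>" if "x \<in> cball u (\<rho> t) \<inter> S" for x
      using p(3) [OF Z(2) [OF t, of x]] that \<rho>(2) [OF t] by auto
    show "\<delta> \<le> norm (x - C t x)" if "x \<in> sphere u (\<rho> t) \<inter> S" for x
      using \<delta>(2) [of "(t, x)"] that t by (simp add: M_def)
  qed
  let ?H = "\<lambda>t x. u + \<rho> t *\<^sub>R x - p (C t (u + \<rho> t *\<^sub>R x))"
  have eq: "LS_degree S (\<lambda>x. x - C t x) u (\<rho> t) = Brouwer_degree_ball F (?H t) 0 1" if "t \<in> {0..1}" for t
    using LS_degree_eq [OF ap [OF that] S(1)] \<rho>(2) [OF that]
    by (simp add: Brouwer_degree_ball_rescale [of _ _ u "\<rho> t"])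
  have "Brouwer_degree_ball F (?H 0) 0 1 = Brouwer_degree_ball F (?H 1) 0 1"
  proof (rule Brouwer_degree_ball_homotopic [OF F(1,2)])
    let ?P = "{0..1} \<times> (sphere 0 1 \<inter> F)"
    have "continuous_on ?P (\<lambda>q. \<rho> (fst q))"
      by (rule continuous_on_compose2 [OF \<rho>(1)]) (auto intro: continuous_intros)
    then have c1: "continuous_on ?P (\<lambda>q. u + \<rho> (fst q) *\<^sub>R snd q)"
      by (intro continuous_on_add continuous_on_const continuous_on_scaleR continuous_on_snd continuous_on_id)
    have "(fst q, u + \<rho> (fst q) *\<^sub>R snd q) \<in> {0..1} \<times> (cball u R \<inter> S)" if q: "q \<in> ?P" for q
    proof -
      have "fst q \<in> {0..1}" using q by auto
      then have "u + \<rho> (fst q) *\<^sub>R snd q \<in> sphere u (\<rho> (fst q)) \<inter> F"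
        using LS_approximation_rescaled(2) [OF ap _ F(1) order_refl F(4), of "fst q" "snd q"] \<rho>(2) q by auto
      then show ?thesis
        using \<rho>(2) [of "fst q"] \<open>fst q \<in> {0..1}\<close> F(4) by auto
    qed
    then have "continuous_on ?P (\<lambda>q. (\<lambda>(t, x). C t x) (fst q, u + \<rho> (fst q) *\<^sub>R snd q))"
      by (intro continuous_on_compose2 [OF C] continuous_on_Pair continuous_on_fst continuous_on_id c1) blast
    then have "continuous_on ?P (\<lambda>q. p (C (fst q) (u + \<rho> (fst q) *\<^sub>R snd q)))"
      by (intro continuous_on_compose2 [OF p(1)]) auto
    then show "continuous_on ?P (\<lambda>(t, x). ?H t x)"
      unfolding case_prod_unfold by (intro continuous_on_diff c1)
  next
    fix t :: real and x assume t: "t \<in> {0..1}" and x: "x \<in> sphere 0 1 \<inter> F"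
    note g = LS_approximation_rescaled [OF ap [OF t] _ F(1) order_refl F(4)]
    have "?H t x \<in> F"
      using g(3) x \<rho>(2) [OF t] by blast
    moreover have "?H t x \<noteq> 0"
      using LS_approximation_nonzero [OF ap [OF t]] g(2) x \<rho>(2) [OF t] F(4) by blast
    ultimately show "?H t x \<in> F - {0}" by blast
  qed
  then show ?thesis
    using eq [of 0] eq [of 1] by simp
qed

section \<open>The index as the degree on any small ball\<close>

lemma LS_degree_cong:
  assumes "\<And>x. x \<in> S \<Longrightarrow> T x = T' x"
  shows "LS_degree S T u r = LS_degree S T' u r"
proof -
  have "LS_approximation S T u r = LS_approximation S T' u r"
    using assms by (auto simp: LS_approximation_def fun_eq_iff)
  then show ?thesis
    by (simp add: LS_degree_altdef)
qed

text \<open>Moving only the radius is a homotopy without zeros on the spheres, because the punctured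
  ball of radius \<open>e\<close> contains none. Hence the degree is constant in the radius, and the
  eventual value in \<open>LS_index\<close> is determined since the filter \<open>at_right 0\<close>
  is not trivial.\<close>

lemma LS_index_eq_LS_degree:
  fixes T :: "'a::real_inner \<Rightarrow> 'a"
  assumes S: "subspace S" "closed S" "u \<in> S"
    and K: "compact_map_on S K" and T: "\<And>x. x \<in> S \<Longrightarrow> T x = x - K x"
    and nz: "\<And>x. x \<in> S \<Longrightarrow> 0 < norm (x - u) \<Longrightarrow> norm (x - u) < e \<Longrightarrow> T x \<noteq> 0"
    and r: "0 < r" "r < e"
  shows "LS_index S T u = LS_degree S T u r"
proof -
  have const: "LS_degree S T u r' = LS_degree S T u r" if r': "0 < r'" "r' < e" for r'
  proof -
    define \<rho> where "\<rho> t = (1 - t) * r' + t * r" for t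
    define R where "R = max r r'"
    have \<rho>: "0 < \<rho> t \<and> \<rho> t \<le> R" if "t \<in> {0..1}" for t
    proof -
      have "min r r' \<le> \<rho> t" "\<rho> t \<le> max r r'"
        using that mult_left_mono [of "min r r'" r t] mult_left_mono [of "min r r'" r' "1 - t"]
          mult_left_mono [of r "max r r'" t] mult_left_mono [of r' "max r r'" "1 - t"]
        by (auto simp: \<rho>_def algebra_simps)
      then show ?thesis
        using r r' by (auto simp: R_def)
    qed
    have KZ: "K x \<in> closure (K ` (cball u R \<inter> S)) \<inter> S" if "x \<in> cball u R \<inter> S" for x
      using that K closure_subset by (fastforce simp: compact_map_on_def)
    have "LS_degree S (\<lambda>x. x - K x) u (\<rho> 0) = LS_degree S (\<lambda>x. x - K x) u (\<rho> 1)"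
    proof (rule LS_degree_homotopy [OF S, where C = "\<lambda>_. K" and R = R])
      show "continuous_on {0..1} \<rho>"
        unfolding \<rho>_def by (intro continuous_intros)
      have "continuous_on S K"
        using K by (simp add: compact_map_on_def)
      then show "continuous_on ({0..1} \<times> (cball u R \<inter> S)) (\<lambda>(t, x). K x)"
        unfolding case_prod_unfold by (rule continuous_on_compose2) (auto intro: continuous_intros)
      show "compact (closure (K ` (cball u R \<inter> S)))"
        using K bounded_subset [OF bounded_cball [of u R], of "cball u R \<inter> S"]
        by (simp add: compact_map_on_def)
      show "K x \<noteq> x" if "t \<in> {0..1}" "x \<in> sphere u (\<rho> t) \<inter> S" for t x
      proof -
        have "norm (x - u) = \<rho> t" "x \<in> S"
          using that(2) by (auto simp: dist_norm norm_minus_commute)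
        moreover have "0 < \<rho> t" "\<rho> t < e"
          using \<rho> [OF that(1)] r r' by (auto simp: R_def)
        ultimately have "T x \<noteq> 0"
          using nz [of x] by metis
        then show ?thesis
          using T [OF \<open>x \<in> S\<close>] by auto
      qed
    qed (use \<rho> KZ in auto)
    then have "LS_degree S (\<lambda>x. x - K x) u r' = LS_degree S (\<lambda>x. x - K x) u r"
      by (simp add: \<rho>_def)
    then show ?thesis
      using LS_degree_cong [of S T "\<lambda>x. x - K x"] T by metis
  qed
  show ?thesis
    unfolding LS_index_def
  proof (rule the_equality)
    show "\<forall>\<^sub>F r' in at_right 0. LS_degree S T u r' = LS_degree S T u r"
    proof -
      have "0 < e" using r by simp
      then show ?thesis
        unfolding eventually_at_right_field using const by blast
    qed
    fix d assume d: "\<forall>\<^sub>F r' in at_right 0. LS_degree S T u r' = d"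
    have "\<forall>\<^sub>F r' in at_right (0::real). d = LS_degree S T u r"
      using eventually_conj [OF d \<open>\<forall>\<^sub>F r' in at_right 0. LS_degree S T u r' = LS_degree S T u r\<close>]
      by (rule eventually_mono) metis
    then show "d = LS_degree S T u r"
      by (simp add: trivial_limit_at_right_real)
  qed
qed

section \<open>Projections and precompact maps in Hilbert spaces\<close>

text \<open>The representing vector is the minimizer of \<open>J\<close> over \<open>S\<close>: on
  \<open>S\<close>, up to an additive constant, \<open>J\<close> is the squared distance to that
  vector. Stating this for closed subspaces serves both gradients and orthogonal
  projections.\<close>

lemma Riesz_representation_subspace:
  fixes S :: "'a::{real_inner, complete_space} set"
  assumes S: "subspace S" "closed S" and l: "bounded_linear l"
  obtains g where "g \<in> S" "\<And>h. h \<in> S \<Longrightarrow> l h = inner g h"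
proof -
  interpret l: bounded_linear l by fact
  define J where "J y = (norm y)\<^sup>2 - 2 * l y" for y
  obtain B where B: "\<And>y. \<bar>l y\<bar> \<le> norm y * B"
    using l.bounded by auto
  have "- B\<^sup>2 \<le> J y" for y
  proof -
    have "2 * l y \<le> 2 * (norm y * B)"
      using B [of y] by simp
    moreover have "0 \<le> (norm y - B)\<^sup>2" by simp
    ultimately show ?thesis
      by (simp add: J_def power2_diff algebra_simps)
  qed
  then have bdd: "bdd_below (J ` S)"
    by (auto simp: bdd_below_def)
  have ne: "J ` S \<noteq> {}"
    using S(1) subspace_0 by blast
  define m where "m = Inf (J ` S)"
  have m: "m \<le> J y" if "y \<in> S" for y
    unfolding m_def using that bdd by (intro cInf_lower) auto
  have "\<exists>y\<in>S. J y < m + inverse (real (Suc n))" for n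
  proof -
    have "Inf (J ` S) < m + inverse (real (Suc n))"
      by (simp add: m_def)
    then show ?thesis
      using cInf_lessD [OF ne] by blast
  qed
  then obtain y where y: "\<And>n. y n \<in> S" "\<And>n. J (y n) < m + inverse (real (Suc n))"
    by metis
  \<comment> \<open>The parallelogram law makes every minimizing sequence Cauchy.\<close>
  have par: "(norm (a - b))\<^sup>2 \<le> 2 * (J a - m) + 2 * (J b - m)" if "a \<in> S" "b \<in> S" for a b
  proof -
    have "(1/2) *\<^sub>R (a + b) \<in> S"
      using that S(1) by (intro subspace_scale subspace_add)
    then have "m \<le> J ((1/2) *\<^sub>R (a + b))"
      by (rule m)
    moreover have "J ((1/2) *\<^sub>R (a + b)) = (norm (a + b))\<^sup>2 / 4 - l a - l b"
      unfolding J_def l.scaleR l.add norm_scaleR by (simp add: power_divide add_divide_distrib)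
    moreover have "(norm (a - b))\<^sup>2 + (norm (a + b))\<^sup>2 = 2 * (norm a)\<^sup>2 + 2 * (norm b)\<^sup>2"
      by (simp add: power2_norm_eq_inner inner_diff_left inner_diff_right inner_add_left inner_add_right)
    ultimately show ?thesis
      by (simp add: J_def algebra_simps)
  qed
  have "Cauchy y"
  proof (rule metric_CauchyI)
    fix e :: real assume "0 < e"
    then have "0 < e\<^sup>2 / 4" by simp
    then obtain N where N: "inverse (real (Suc N)) < e\<^sup>2 / 4"
      using reals_Archimedean by blast
    have "dist (y i) (y j) < e" if ij: "N \<le> i" "N \<le> j" for i j
    proof -
      have "inverse (real (Suc i)) \<le> inverse (real (Suc N))" "inverse (real (Suc j)) \<le> inverse (real (Suc N))"
        using ij by (simp_all add: le_imp_inverse_le)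
      then have "J (y i) - m < e\<^sup>2 / 4" "J (y j) - m < e\<^sup>2 / 4"
        using y(2) [of i] y(2) [of j] N by linarith+
      then have "2 * (J (y i) - m) + 2 * (J (y j) - m) < e\<^sup>2"
        by (simp add: field_simps)
      then have "(norm (y i - y j))\<^sup>2 < e\<^sup>2"
        using par [OF y(1) y(1), of i j] by (rule le_less_trans [rotated])
      then show ?thesis
        using \<open>0 < e\<close> by (simp add: dist_norm power2_less_imp_less)
    qed
    then show "\<exists>M. \<forall>i\<ge>M. \<forall>j\<ge>M. dist (y i) (y j) < e" by blast
  qed
  then obtain g where g: "y \<longlonglongrightarrow> g"
    using Cauchy_convergent convergent_def by blast
  have gS: "g \<in> S"
    by (rule closed_sequentially [OF S(2) _ g]) (simp add: y(1))
  have "(\<lambda>n. J (y n)) \<longlonglongrightarrow> J g"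
    unfolding J_def by (intro tendsto_intros g l.tendsto)
  moreover have "(\<lambda>n. m + inverse (real (Suc n))) \<longlonglongrightarrow> m + 0"
    by (intro tendsto_intros LIMSEQ_inverse_real_of_nat)
  ultimately have "J g \<le> m + 0"
    using y(2) by (intro LIMSEQ_le) (auto intro: less_imp_le)
  then have min: "J g \<le> J z" if "z \<in> S" for z
    using m [OF that] by simp
  have "l h = inner g h" if h: "h \<in> S" for h
  proof (cases "h = 0")
    case False
    define a where "a = inner g h - l h"
    define q where "q = (norm h)\<^sup>2"
    have q: "0 < q" using False by (simp add: q_def)
    \<comment> \<open>This step length minimizes the quadratic change of \<open>J\<close> along
      \<open>h\<close>. The change there is the negative of the square of \<open>a\<close> divided
      by \<open>q\<close>, so minimality of \<open>g\<close> forces \<open>a = 0\<close>.\<close>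
    have "g + (- a / q) *\<^sub>R h \<in> S"
      using gS h S(1) by (intro subspace_add subspace_scale)
    moreover have "J (g + t *\<^sub>R h) = J g + (2 * t * a + t\<^sup>2 * q)" for t
      unfolding J_def a_def q_def power2_norm_eq_inner l.add l.scaleR
      by (simp add: inner_add_left inner_add_right inner_commute power2_eq_square algebra_simps)
    ultimately have "0 \<le> 2 * (- a / q) * a + (- a / q)\<^sup>2 * q"
      using min by (metis le_add_same_cancel1)
    also have "\<dots> = - (a\<^sup>2 / q)"
      using q by (simp add: power2_eq_square field_simps)
    finally have "a\<^sup>2 \<le> 0"
      using q by (simp add: field_simps)
    then show ?thesis by (simp add: a_def)
  qed simp
  with gS show thesis by (rule that)
qed

text \<open>Encoded by inner products with \<open>S\<close> instead of by minimal distance, so that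
  existence is the Riesz representation of the functional \<open>inner x\<close> on
  \<open>S\<close>.\<close>

definition orth_proj :: "'a::real_inner set \<Rightarrow> 'a \<Rightarrow> 'a" where
  "orth_proj S x = (SOME g. g \<in> S \<and> (\<forall>h\<in>S. inner x h = inner g h))"

lemma orth_proj:
  fixes S :: "'a::{real_inner, complete_space} set"
  assumes "subspace S" "closed S"
  shows "orth_proj S x \<in> S" "h \<in> S \<Longrightarrow> inner (orth_proj S x) h = inner x h"
proof -
  obtain g where "g \<in> S" "\<And>h. h \<in> S \<Longrightarrow> inner x h = inner g h"
    using Riesz_representation_subspace [OF assms bounded_linear_inner_right] by metis
  then have "\<exists>g. g \<in> S \<and> (\<forall>h\<in>S. inner x h = inner g h)" by blast
  from someI_ex [OF this]
  show "orth_proj S x \<in> S" "h \<in> S \<Longrightarrow> inner (orth_proj S x) h = inner x h"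
    by (auto simp: orth_proj_def)
qed

lemma inner_determines_element:
  fixes g g' :: "'a::real_inner"
  assumes "subspace S" "g \<in> S" "g' \<in> S" "\<And>h. h \<in> S \<Longrightarrow> inner g h = inner g' h"
  shows "g = g'"
proof -
  have "inner (g - g') (g - g') = 0"
    using assms(4) [of "g - g'"] subspace_diff [OF assms(1-3)] by (simp add: inner_diff_left)
  then show ?thesis by simp
qed

lemma orth_proj_id:
  fixes S :: "'a::{real_inner, complete_space} set"
  assumes "subspace S" "closed S" "x \<in> S"
  shows "orth_proj S x = x"
  using assms orth_proj [OF assms(1,2)] by (intro inner_determines_element [of S]) auto

lemma inner_orth_proj_self:
  fixes S :: "'a::{real_inner, complete_space} set"
  assumes "subspace S" "closed S"
  shows "inner (orth_proj S x) x = (norm (orth_proj S x))\<^sup>2"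
  using orth_proj [OF assms] by (simp add: power2_norm_eq_inner inner_commute)

lemma norm_orth_proj_le:
  fixes S :: "'a::{real_inner, complete_space} set"
  assumes "subspace S" "closed S"
  shows "norm (orth_proj S x) \<le> norm x"
proof (cases "orth_proj S x = 0")
  case False
  have "norm (orth_proj S x) * norm (orth_proj S x) \<le> norm (orth_proj S x) * norm x"
    using norm_cauchy_schwarz [of "orth_proj S x" x] inner_orth_proj_self [OF assms, of x]
    by (simp add: power2_eq_square)
  then show ?thesis using False by simp
qed simp

lemma bounded_linear_orth_proj:
  fixes S :: "'a::{real_inner, complete_space} set"
  assumes "subspace S" "closed S"
  shows "bounded_linear (orth_proj S)"
proof (rule bounded_linear_intro [of _ 1])
  note P = orth_proj [OF assms]
  show "orth_proj S (x + y) = orth_proj S x + orth_proj S y" for x y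
    using P assms(1) by (intro inner_determines_element [OF assms(1)]) (auto simp: inner_add_left intro: subspace_add)
  show "orth_proj S (c *\<^sub>R x) = c *\<^sub>R orth_proj S x" for c x
    using P assms(1) by (intro inner_determines_element [OF assms(1)]) (auto intro: subspace_scale)
  show "norm (orth_proj S x) \<le> norm x * 1" for x
    using norm_orth_proj_le [OF assms] by simp
qed

text \<open>Phrased by an enclosing compact set instead of a compact closure: sums, differences and
  compositions then follow from products and continuous images of compact sets alone.\<close>

definition precompact_on :: "'b set \<Rightarrow> ('b \<Rightarrow> 'a::topological_space) \<Rightarrow> bool" where
  "precompact_on A g \<longleftrightarrow> (\<exists>Z. compact Z \<and> g ` A \<subseteq> Z)"

lemma precompact_on_const: "precompact_on A (\<lambda>_. c)"
  unfolding precompact_on_def by (intro exI [of _ "{c}"]) auto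

lemma precompact_on_compose:
  assumes "precompact_on A g" "continuous_on UNIV h"
  shows "precompact_on A (\<lambda>x. h (g x))"
proof -
  obtain Z where Z: "compact Z" "g ` A \<subseteq> Z"
    using assms(1) by (auto simp: precompact_on_def)
  have "compact (h ` Z)"
    using Z(1) assms(2) by (intro compact_continuous_image) (auto intro: continuous_on_subset)
  moreover have "(\<lambda>x. h (g x)) ` A \<subseteq> h ` Z"
    using Z(2) by auto
  ultimately show ?thesis
    by (auto simp: precompact_on_def)
qed

lemma precompact_on_Pair:
  assumes "precompact_on A g" "precompact_on A h"
  shows "precompact_on A (\<lambda>x. (g x, h x))"
proof -
  obtain Y Z where "compact Y" "g ` A \<subseteq> Y" "compact Z" "h ` A \<subseteq> Z"
    using assms by (auto simp: precompact_on_def)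
  then show ?thesis
    unfolding precompact_on_def by (intro exI [of _ "Y \<times> Z"]) (auto intro: compact_Times)
qed

lemma precompact_on_add:
  fixes g h :: "'b \<Rightarrow> 'a::real_normed_vector"
  assumes "precompact_on A g" "precompact_on A h"
  shows "precompact_on A (\<lambda>x. g x + h x)"
  using precompact_on_compose [OF precompact_on_Pair [OF assms], of "\<lambda>p. fst p + snd p"]
  by (simp add: continuous_intros)

lemma precompact_on_diff:
  fixes g h :: "'b \<Rightarrow> 'a::real_normed_vector"
  assumes "precompact_on A g" "precompact_on A h"
  shows "precompact_on A (\<lambda>x. g x - h x)"
  using precompact_on_compose [OF precompact_on_Pair [OF assms], of "\<lambda>p. fst p - snd p"]
  by (simp add: continuous_intros)

lemma precompact_on_scaleR:
  fixes g :: "'b \<Rightarrow> 'a::real_normed_vector"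
  assumes "precompact_on A s" "precompact_on A g"
  shows "precompact_on A (\<lambda>x. s x *\<^sub>R g x)"
  using precompact_on_compose [OF precompact_on_Pair [OF assms], of "\<lambda>p. fst p *\<^sub>R snd p"]
  by (simp add: continuous_intros)

lemma precompact_on_reindex:
  assumes "precompact_on A g" "h ` B \<subseteq> A"
  shows "precompact_on B (\<lambda>x. g (h x))"
proof -
  obtain Z where "compact Z" "g ` A \<subseteq> Z"
    using assms(1) by (auto simp: precompact_on_def)
  then show ?thesis
    unfolding precompact_on_def using assms(2) by (intro exI [of _ Z]) auto
qed

text \<open>The enclosing compact set consists of all combinations of an orthonormal basis with
  coefficients in \<open>[-M, M]\<close>, built one coordinate at a time. Boundedness alone would
  not suffice in the ambient space, which may be infinite-dimensional.\<close>

lemma finite_dimensional_bounded_subset_compact: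
  fixes F :: "'a::real_inner set"
  assumes F: "subspace F" "finite_dimensional_on F"
  obtains Z where "compact Z" "\<And>x. x \<in> F \<Longrightarrow> norm x \<le> M \<Longrightarrow> x \<in> Z"
proof -
  obtain b where b: "orthonormal_basis F (dim F) b"
    using orthonormal_basis_exists [OF F] .
  have Z: "compact {y. \<exists>c. (\<forall>j. \<bar>c j\<bar> \<le> M) \<and> y = (\<Sum>j<n. c j *\<^sub>R b j)}" for n
  proof (cases "0 \<le> M")
    case True
    show ?thesis
    proof (induction n)
      case 0
      have "{y. \<exists>c. (\<forall>j. \<bar>c j\<bar> \<le> M) \<and> y = (\<Sum>j<0. c j *\<^sub>R b j)} = {0}"
        using True by (auto intro: exI [of _ "\<lambda>_. 0"])
      then show ?case by simp
    next
      case (Suc n)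
      let ?A = "\<lambda>n. {y. \<exists>c. (\<forall>j::nat. \<bar>c j\<bar> \<le> M) \<and> y = (\<Sum>j<n. c j *\<^sub>R b j)}"
      have eq: "?A (Suc n) = (\<lambda>p. snd p + fst p *\<^sub>R b n) ` ({-M..M} \<times> ?A n)"
      proof (intro equalityI subsetI)
        fix y assume "y \<in> ?A (Suc n)"
        then obtain c where "\<forall>j. \<bar>c j\<bar> \<le> M" "y = (\<Sum>j<Suc n. c j *\<^sub>R b j)" by blast
        then show "y \<in> (\<lambda>p. snd p + fst p *\<^sub>R b n) ` ({-M..M} \<times> ?A n)"
          by (intro image_eqI [of _ _ "(c n, \<Sum>j<n. c j *\<^sub>R b j)"]) (auto simp: abs_le_iff minus_le_iff)
      next
        fix y assume "y \<in> (\<lambda>p. snd p + fst p *\<^sub>R b n) ` ({-M..M} \<times> ?A n)"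
        then obtain s c where s: "s \<in> {-M..M}" "\<forall>j. \<bar>c j\<bar> \<le> M" "y = (\<Sum>j<n. c j *\<^sub>R b j) + s *\<^sub>R b n"
          by auto
        then have "\<forall>j. \<bar>(c(n := s)) j\<bar> \<le> M" "y = (\<Sum>j<Suc n. (c(n := s)) j *\<^sub>R b j)"
          by auto
        then show "y \<in> ?A (Suc n)" by blast
      qed
      show ?case
        unfolding eq using Suc
        by (intro compact_continuous_image compact_Times continuous_intros) auto
    qed
  next
    case False
    then have "{y. \<exists>c. (\<forall>j. \<bar>c j\<bar> \<le> M) \<and> y = (\<Sum>j<n. c j *\<^sub>R b j)} = {}"
      by force
    then show ?thesis by (simp only: compact_empty)
  qed
  show thesis
  proof (rule that [OF Z [of "dim F"]])
    fix x assume x: "x \<in> F" "norm x \<le> M"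
    define c where "c j = (if j < dim F then inner (b j) x else 0)" for j
    have "\<bar>c j\<bar> \<le> M" for j
    proof (cases "j < dim F")
      case True
      have "norm (b j) = 1"
        using orthonormal_basisD(3) [OF b True True] by (simp add: norm_eq_1)
      then show ?thesis
        using Cauchy_Schwarz_ineq2 [of "b j" x] x(2) True by (simp add: c_def)
    next
      case False
      then show ?thesis using order_trans [OF norm_ge_zero x(2)] by (simp add: c_def)
    qed
    moreover have "x = (\<Sum>j<dim F. c j *\<^sub>R b j)"
      using orthonormal_expansion [OF b x(1)] by (simp add: c_def)
    ultimately show "x \<in> {y. \<exists>c. (\<forall>j. \<bar>c j\<bar> \<le> M) \<and> y = (\<Sum>j<dim F. c j *\<^sub>R b j)}"
      by blast
  qed
qed

lemma precompact_on_finite_dimensional: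
  fixes g :: "'b \<Rightarrow> 'a::real_inner"
  assumes "subspace F" "finite_dimensional_on F" "\<And>x. x \<in> A \<Longrightarrow> g x \<in> F" "\<And>x. x \<in> A \<Longrightarrow> norm (g x) \<le> M"
  shows "precompact_on A g"
  using finite_dimensional_bounded_subset_compact [OF assms(1,2), of M] assms(3,4)
  unfolding precompact_on_def by (metis image_subsetI)

lemma precompact_on_compact_map:
  assumes "compact_map_on S K" "g ` A \<subseteq> S" "bounded (g ` A)"
  shows "precompact_on A (\<lambda>x. K (g x))"
proof -
  have "compact (closure (K ` g ` A))"
    using assms by (simp add: compact_map_on_def)
  then show ?thesis
    unfolding precompact_on_def using closure_subset [of "K ` g ` A"] by (auto simp: image_image)
qed

section \<open>Dimension of direct sums\<close>

lemma independent_Un_direct: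
  fixes B C :: "'a::real_vector set"
  assumes "finite C" "independent B" "independent C" "span B \<inter> span C \<subseteq> {0}"
  shows "independent (B \<union> C)"
  using assms
proof (induction C rule: finite_induct)
  case (insert c C)
  have "span C \<subseteq> span (insert c C)"
    by (intro span_mono) auto
  then have ind: "independent (B \<union> C)"
    using insert by (auto simp: independent_insert)
  have c: "c \<notin> span C"
    using insert.prems(2) insert.hyps(2) by (auto simp: independent_insert)
  have "c \<notin> span (B \<union> C)"
  proof
    assume "c \<in> span (B \<union> C)"
    then obtain \<beta> \<gamma> where bg: "\<beta> \<in> span B" "\<gamma> \<in> span C" "c = \<beta> + \<gamma>"
      by (auto simp: span_Un)
    then have "c - \<gamma> \<in> span (insert c C)"
      using \<open>span C \<subseteq> span (insert c C)\<close> by (intro span_diff) (auto intro: span_base)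
    then have "\<beta> \<in> span B \<inter> span (insert c C)"
      using bg by auto
    then have "\<beta> = 0"
      using insert.prems(3) by blast
    with bg c show False by simp
  qed
  with ind show ?case
    by (simp add: independent_insert)
qed simp

lemma dim_sum_direct:
  fixes E F :: "'a::real_vector set"
  assumes E: "subspace E" "finite_dimensional_on E" and F: "subspace F" "finite_dimensional_on F"
    and "E \<inter> F \<subseteq> {0}"
  shows "dim (span (E \<union> F)) = dim E + dim F" "finite_dimensional_on (span (E \<union> F))"
proof -
  have basis: "\<exists>B. finite B \<and> independent B \<and> span B = E" if E: "subspace E" "finite_dimensional_on E" for E :: "'a set"
  proof -
    obtain C where C: "finite C" "span C = E"
      using E by (auto simp: finite_dimensional_on_def)
    obtain B where B: "B \<subseteq> C" "independent B" "C \<subseteq> span B"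
      using maximal_independent_subset by blast
    have "span B = E"
      using B C by (metis dual_order.antisym span_mono span_minimal subspace_span)
    then show ?thesis
      using B C finite_subset by blast
  qed
  obtain B C where B: "finite B" "independent B" "span B = E" and C: "finite C" "independent C" "span C = F"
    using basis [OF E] basis [OF F] by metis
  have sp: "span (E \<union> F) = span (B \<union> C)"
    unfolding span_Un using B C span_eq_iff E F by metis
  have ind: "independent (B \<union> C)"
    using independent_Un_direct [OF C(1) B(2) C(2)] B(3) C(3) assms(5) by simp
  have "B \<inter> C = {}"
  proof -
    have "B \<inter> C \<subseteq> {0}"
      using B(3) C(3) assms(5) span_base by blast
    moreover have "0 \<notin> B" using B(2) dependent_zero by blast
    ultimately show ?thesis by blast
  qed
  then have "card (B \<union> C) = card B + card C"
    using B(1) C(1) by (rule card_Un_disjoint [rotated 2])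
  moreover have "dim E = card B" "dim F = card C" "dim (span (B \<union> C)) = card (B \<union> C)"
    using dim_span_eq_card_independent B C ind by metis+
  ultimately show "dim (span (E \<union> F)) = dim E + dim F"
    by (simp add: sp)
  show "finite_dimensional_on (span (E \<union> F))"
    unfolding finite_dimensional_on_def using sp B(1) C(1) by (intro exI [of _ "B \<union> C"]) auto
qed

lemma Brouwer_degree_ball_cong:
  fixes g g' :: "'a::real_inner \<Rightarrow> 'a"
  assumes F: "subspace F" "finite_dimensional_on F" and eq: "\<And>x. x \<in> sphere 0 1 \<inter> F \<Longrightarrow> g x = g' x"
  shows "Brouwer_degree_ball F g 0 1 = Brouwer_degree_ball F g' 0 1"
proof (cases "dim F")
  case (Suc m)
  define b where "b = (SOME b. orthonormal_basis F (Suc m) b)"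
  have b: "orthonormal_basis F (Suc m) b"
    unfolding b_def using orthonormal_basis_exists [OF F] Suc by (metis someI)
  have "Brouwer_degree2 m (sphere_map (Suc m) b g 0 1) = Brouwer_degree2 m (sphere_map (Suc m) b g' 0 1)"
    by (rule Brouwer_degree2_eq)
       (use eq [OF orthonormal_sum_in_sphere [OF b]] in \<open>simp add: sphere_map_def del: sum.lessThan_Suc\<close>)
  then show ?thesis
    by (simp add: Brouwer_degree_ball_def Suc b_def)
qed (simp add: Brouwer_degree_ball_def)

section \<open>The saddle point reduction\<close>

text \<open>A derivative within \<open>S\<close> is tested only by directions in \<open>S\<close>.
  Restriction to the lines through \<open>x\<close> in such directions reduces the claim to
  uniqueness of one-variable derivatives, and a vector of \<open>S\<close> is determined by its
  inner products with \<open>S\<close>.\<close>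

lemma has_derivative_within_subspace_unique:
  fixes g g' :: "'a::real_inner"
  assumes S: "subspace S" and x: "x \<in> S" and g: "g \<in> S" "g' \<in> S"
    and der: "(F has_derivative (\<lambda>h. inner g h)) (at x within S)"
      "(F has_derivative (\<lambda>h. inner g' h)) (at x within S)"
  shows "g = g'"
proof (rule inner_determines_element [OF S g])
  fix h assume h: "h \<in> S"
  have img: "(\<lambda>t. x + t *\<^sub>R h) ` UNIV \<subseteq> S"
    using S x h by (auto intro: subspace_add subspace_scale)
  have line: "((\<lambda>t::real. x + t *\<^sub>R h) has_derivative (\<lambda>s. s *\<^sub>R h)) (at 0)"
    by (auto intro!: derivative_eq_intros)
  have "((\<lambda>t. F (x + t *\<^sub>R h)) has_derivative (\<lambda>s. inner a (s *\<^sub>R h))) (at 0)"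
    if "(F has_derivative (\<lambda>h. inner a h)) (at x within S)" for a
  proof -
    have "(F has_derivative (\<lambda>h. inner a h)) (at (x + 0 *\<^sub>R h) within range (\<lambda>t. x + t *\<^sub>R h))"
      using has_derivative_subset [OF that img] by simp
    from has_derivative_in_compose [OF line this] show ?thesis .
  qed
  from has_derivative_unique [OF this [OF der(1)] this [OF der(2)]]
  have "inner g (1 *\<^sub>R h) = inner g' (1 *\<^sub>R h)"
    by metis
  then show "inner g h = inner g' h" by simp
qed

lemma gradient_on_eqI:
  assumes "subspace S" "x \<in> S" "g \<in> S" "(F has_derivative (\<lambda>h. inner g h)) (at x within S)"
  shows "gradient_on S F x = g"
  unfolding gradient_on_def
  using has_derivative_within_subspace_unique [OF assms(1,2)] assms(3,4)
  by (intro the_equality) blast+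

text \<open>About \<open>\<psi>\<close> only maximality is assumed. Its continuity, the gradient of
  \<open>\<phi>\<close> and the compactness of the perturbation are derived from the concavity
  condition.\<close>

locale saddle_point_reduction =
  fixes f :: "'a::{real_inner, complete_space} \<Rightarrow> real"
    and K :: "'a \<Rightarrow> 'a"
    and Xm Xp :: "'a set"
    and \<kappa> :: real
    and \<psi> :: "'a \<Rightarrow> 'a"
    and \<phi> :: "'a \<Rightarrow> real"
  assumes f_C1: "C1 f"
    and K_compact: "compact_map_on UNIV K"
    and gradient_f: "\<And>x. gradient_on UNIV f x = x - K x"
    and Xm: "subspace Xm" "closed Xm"
    and Xp: "subspace Xp" "closed Xp"
    and sum: "direct_sum Xm Xp"
    and Xp_finite: "finite_dimensional_on Xp"
    and kappa_pos: "\<kappa> > 0"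
    and monotone: "\<And>v w1 w2. v \<in> Xm \<Longrightarrow> w1 \<in> Xp \<Longrightarrow> w2 \<in> Xp \<Longrightarrow>
        - inner (gradient_on UNIV f (v + w1) - gradient_on UNIV f (v + w2)) (w1 - w2)
          \<ge> \<kappa> * (norm (w1 - w2))\<^sup>2"
    and psi: "\<And>v. v \<in> Xm \<Longrightarrow> \<psi> v \<in> Xp"
    and psi_max: "\<And>v w. v \<in> Xm \<Longrightarrow> w \<in> Xp \<Longrightarrow> f (v + w) \<le> f (v + \<psi> v)"
    and phi: "\<And>v. v \<in> Xm \<Longrightarrow> \<phi> v = f (v + \<psi> v)"
begin

definition T :: "'a \<Rightarrow> 'a" where "T x = x - K x"
definition P :: "'a \<Rightarrow> 'a" where "P = orth_proj Xm"
definition R :: "'a \<Rightarrow> 'a" where "R = orth_proj Xp"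
text \<open>The oblique projection onto \<open>Xm\<close> along \<open>Xp\<close>. It agrees with
  the orthogonal projection \<open>P\<close> only when the two subspaces are orthogonal.\<close>

definition \<pi> :: "'a \<Rightarrow> 'a" where "\<pi> x = (SOME v. v \<in> Xm \<and> x - v \<in> Xp)"
text \<open>\<open>G\<close> will be identified with the gradient of \<open>\<phi>\<close>, and
  \<open>Q\<close> with its compact part. The summand \<open>P (\<psi> v)\<close> in
  \<open>Q\<close> is there because \<open>\<psi> v\<close> need not be orthogonal to
  \<open>Xm\<close>.\<close>

definition G :: "'a \<Rightarrow> 'a" where "G v = P (T (v + \<psi> v))"
definition Q :: "'a \<Rightarrow> 'a" where "Q v = P (K (v + \<psi> v)) - P (\<psi> v)"

lemma K_cont: "continuous_on UNIV K"
  using K_compact by (simp add: compact_map_on_def)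

lemma T_cont: "continuous_on UNIV T"
  unfolding T_def by (intro continuous_intros K_cont)

text \<open>The hypothesis on the gradient speaks about a definite description. Differentiability
  together with Riesz representation shows that the described vector exists, and only then does the
  hypothesis say something about the derivative.\<close>

lemma f_derivative: "(f has_derivative (\<lambda>h. inner (T x) h)) (at x)"
proof -
  obtain f' where f': "\<And>x. (f has_derivative blinfun_apply (f' x)) (at x)"
    using f_C1 by (auto simp: C1_def)
  obtain g where g: "\<And>h. blinfun_apply (f' x) h = inner g h"
    using Riesz_representation_subspace [of UNIV "blinfun_apply (f' x)"]
    by (auto intro: blinfun.bounded_linear_right)
  have der: "(f has_derivative (\<lambda>h. inner g h)) (at x)"
    using has_derivative_eq_rhs [OF f' [of x]] g by (simp add: fun_eq_iff)
  have "gradient_on UNIV f x = g"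
    using der by (intro gradient_on_eqI) auto
  with der gradient_f [of x] show ?thesis
    by (simp add: T_def)
qed

lemma f_line_derivative:
  "((\<lambda>t. f (a + t *\<^sub>R h)) has_real_derivative inner (T (a + t *\<^sub>R h)) h) (at t)"
proof -
  have "((\<lambda>t::real. a + t *\<^sub>R h) has_derivative (\<lambda>s. s *\<^sub>R h)) (at t)"
    by (auto intro!: derivative_eq_intros)
  from has_derivative_compose [OF this f_derivative]
  have "((\<lambda>t. f (a + t *\<^sub>R h)) has_derivative (\<lambda>s. inner (T (a + t *\<^sub>R h)) (s *\<^sub>R h))) (at t)" .
  then show ?thesis
    unfolding has_field_derivative_def by (rule has_derivative_eq_rhs) (auto simp: fun_eq_iff)
qed

lemma f_mean_value:
  obtains s where "0 < s" "s < 1" "f (a + h) - f a = inner (T (a + s *\<^sub>R h)) h"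
proof -
  have "\<exists>z>0. z < 1 \<and> f (a + 1 *\<^sub>R h) - f (a + 0 *\<^sub>R h) = (1 - 0) * inner (T (a + z *\<^sub>R h)) h"
    by (rule MVT2) (auto intro: f_line_derivative)
  then show thesis using that by auto
qed

section \<open>The orthogonal projections and the oblique projection\<close>

lemma P_in: "P x \<in> Xm"
  and P_inner: "h \<in> Xm \<Longrightarrow> inner (P x) h = inner x h"
  and P_id: "x \<in> Xm \<Longrightarrow> P x = x"
  and P_norm: "norm (P x) \<le> norm x"
  and P_lin: "bounded_linear P"
  unfolding P_def
  using orth_proj [OF Xm] orth_proj_id [OF Xm] norm_orth_proj_le [OF Xm] bounded_linear_orth_proj [OF Xm] by auto

lemma R_in: "R x \<in> Xp"
  and R_inner: "h \<in> Xp \<Longrightarrow> inner (R x) h = inner x h"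
  and R_norm: "norm (R x) \<le> norm x"
  and R_lin: "bounded_linear R"
  unfolding R_def
  using orth_proj [OF Xp] norm_orth_proj_le [OF Xp] bounded_linear_orth_proj [OF Xp] by auto

lemma Xm_Int_Xp: "x \<in> Xm \<Longrightarrow> x \<in> Xp \<Longrightarrow> x = 0"
  using sum by (auto simp: direct_sum_def)

lemma pi_in: "\<pi> x \<in> Xm" and pi_compl: "x - \<pi> x \<in> Xp"
proof -
  obtain a b where "a \<in> Xm" "b \<in> Xp" "x = a + b"
    using sum unfolding direct_sum_def by blast
  then have "\<exists>v. v \<in> Xm \<and> x - v \<in> Xp"
    by (intro exI [of _ a]) auto
  from someI_ex [OF this] show "\<pi> x \<in> Xm" "x - \<pi> x \<in> Xp"
    by (auto simp: \<pi>_def)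
qed

lemma pi_unique:
  assumes "v \<in> Xm" "x - v \<in> Xp"
  shows "\<pi> x = v"
proof -
  have "\<pi> x - v \<in> Xm"
    using pi_in assms Xm by (auto intro: subspace_diff)
  moreover have "(x - v) - (x - \<pi> x) \<in> Xp"
    by (rule subspace_diff [OF Xp(1) assms(2) pi_compl])
  ultimately show ?thesis
    using Xm_Int_Xp [of "\<pi> x - v"] by simp
qed

lemma pi_id: "x \<in> Xm \<Longrightarrow> \<pi> x = x"
  using Xp by (intro pi_unique) (auto simp: subspace_0)

lemma direct_sum_zero:
  assumes "a \<in> Xm" "b \<in> Xp" "a + b = 0"
  shows "a = 0" "b = 0"
proof -
  have "a = - b"
    using assms(3) by (simp add: eq_neg_iff_add_eq_0)
  then have "a \<in> Xp"
    using assms(2) Xp by (simp add: subspace_neg)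
  with assms(1) show "a = 0" by (rule Xm_Int_Xp)
  with assms(3) show "b = 0" by simp
qed

text \<open>Boundedness expresses a positive angle between the subspaces: on the compact unit sphere
  of \<open>Xp\<close> the distance \<open>norm (w - P w)\<close> to \<open>Xm\<close> has a
  positive minimum \<open>m\<close> (any \<open>m\<close> serves if \<open>Xp\<close> is zero). As
  \<open>x\<close> and \<open>x - \<pi> x\<close> differ by an element of \<open>Xm\<close>, their
  distances to \<open>Xm\<close> agree, and that of \<open>x\<close> is at most
  \<open>2 * norm x\<close>.\<close>

lemma pi_lin: "bounded_linear \<pi>"
proof -
  obtain m where m: "0 < m" "\<And>w. w \<in> Xp \<Longrightarrow> m * norm w \<le> norm (w - P w)"
  proof (cases "sphere 0 1 \<inter> Xp = {}")
    case True
    have "w = 0" if "w \<in> Xp" for w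
    proof (rule ccontr)
      assume "w \<noteq> 0"
      then have "(1 / norm w) *\<^sub>R w \<in> sphere 0 1 \<inter> Xp"
        using that Xp by (auto intro: subspace_scale)
      with True show False by blast
    qed
    then show thesis by (intro that [of 1]) force+
  next
    case False
    obtain Z where Z: "compact Z" "\<And>x. x \<in> Xp \<Longrightarrow> norm x \<le> 1 \<Longrightarrow> x \<in> Z"
      using finite_dimensional_bounded_subset_compact [OF Xp(1) Xp_finite, of 1] by blast
    have "sphere 0 1 = {x::'a. norm x = 1}"
      by auto
    then have "closed (sphere (0::'a) 1)"
      by (simp add: closed_Collect_eq continuous_on_norm continuous_on_id)
    then have "compact (Z \<inter> (sphere 0 1 \<inter> Xp))"
      using Z(1) Xp(2) by (intro compact_Int_closed closed_Int)
    moreover have "Z \<inter> (sphere 0 1 \<inter> Xp) = sphere 0 1 \<inter> Xp"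
      using Z(2) by auto
    ultimately have comp: "compact (sphere 0 1 \<inter> Xp)" by simp
    have "continuous_on (sphere 0 1 \<inter> Xp) (\<lambda>w. norm (w - P w))"
      by (intro continuous_intros bounded_linear.continuous_on [OF P_lin])
    then obtain w0 where w0: "w0 \<in> sphere 0 1 \<inter> Xp"
        "\<And>w. w \<in> sphere 0 1 \<inter> Xp \<Longrightarrow> norm (w0 - P w0) \<le> norm (w - P w)"
      using continuous_attains_inf [OF comp False] by blast
    have "w0 - P w0 \<noteq> 0"
    proof
      assume "w0 - P w0 = 0"
      then have "w0 \<in> Xm" using P_in [of w0] by simp
      then show False using w0(1) Xm_Int_Xp [of w0] by auto
    qed
    moreover have "norm (w0 - P w0) * norm w \<le> norm (w - P w)" if "w \<in> Xp" for w
    proof (cases "w = 0")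
      case False
      then have "(1 / norm w) *\<^sub>R w \<in> sphere 0 1 \<inter> Xp"
        using that Xp by (auto intro: subspace_scale)
      from w0(2) [OF this] have "norm (w0 - P w0) \<le> norm ((1 / norm w) *\<^sub>R (w - P w))"
        by (simp add: bounded_linear.linear [OF P_lin] linear_scale scaleR_diff_right)
      then have "norm (w0 - P w0) \<le> norm (w - P w) / norm w"
        unfolding norm_scaleR by simp
      then show ?thesis using False by (simp add: pos_le_divide_eq)
    qed (simp add: bounded_linear.linear [OF P_lin] linear_0)
    ultimately show thesis by (intro that [of "norm (w0 - P w0)"]) auto
  qed
  show ?thesis
  proof (rule bounded_linear_intro [of _ "1 + 2 / m"])
    show "\<pi> (x + y) = \<pi> x + \<pi> y" for x y
    proof (rule pi_unique)
      show "\<pi> x + \<pi> y \<in> Xm" using pi_in Xm by (intro subspace_add)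
      have "(x - \<pi> x) + (y - \<pi> y) \<in> Xp" using pi_compl Xp by (intro subspace_add)
      then show "x + y - (\<pi> x + \<pi> y) \<in> Xp" by (simp add: algebra_simps)
    qed
    show "\<pi> (c *\<^sub>R x) = c *\<^sub>R \<pi> x" for c x
    proof (rule pi_unique)
      show "c *\<^sub>R \<pi> x \<in> Xm" using pi_in Xm by (intro subspace_scale)
      have "c *\<^sub>R (x - \<pi> x) \<in> Xp" using pi_compl Xp by (intro subspace_scale)
      then show "c *\<^sub>R x - c *\<^sub>R \<pi> x \<in> Xp" by (simp add: algebra_simps)
    qed
    show "norm (\<pi> x) \<le> norm x * (1 + 2 / m)" for x
    proof -
      let ?w = "x - \<pi> x"
      have "?w - P ?w = x - P x"
        using P_id [OF pi_in [of x]] by (simp add: bounded_linear.linear [OF P_lin] linear_diff)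
      then have "m * norm ?w \<le> norm (x - P x)"
        using m(2) [OF pi_compl [of x]] by (simp only:)
      also have "\<dots> \<le> 2 * norm x"
        using norm_triangle_ineq4 [of x "P x"] P_norm [of x] by simp
      finally have "norm ?w \<le> 2 / m * norm x"
        using m(1) by (simp add: field_simps)
      then show ?thesis
        using norm_triangle_ineq4 [of x ?w] by (simp add: algebra_simps)
    qed
  qed
qed

text \<open>Fermat's rule along every line through the maximizer in a direction of
  \<open>Xp\<close>.\<close>

lemma R_T_zero: "v \<in> Xm \<Longrightarrow> R (T (v + \<psi> v)) = 0"
proof -
  assume v: "v \<in> Xm"
  have "inner (R (T (v + \<psi> v))) h = inner 0 h" if h: "h \<in> Xp" for h
  proof -
    have "f (v + \<psi> v + t *\<^sub>R h) \<le> f (v + \<psi> v + 0 *\<^sub>R h)" for t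
      using psi_max [OF v, of "\<psi> v + t *\<^sub>R h"] psi [OF v] h Xp
      by (simp add: subspace_add subspace_scale add.assoc)
    then have "inner (T (v + \<psi> v + 0 *\<^sub>R h)) h = 0"
      using DERIV_local_max [OF f_line_derivative zero_less_one] by blast
    then show ?thesis
      using R_inner [OF h] by simp
  qed
  then show ?thesis
    using inner_determines_element [OF Xp(1) R_in subspace_0 [OF Xp(1)]] by blast
qed

lemma T_monotone:
  assumes "v \<in> Xm" "w \<in> Xp"
  shows "\<kappa> * (norm (w - \<psi> v))\<^sup>2 \<le> - inner (R (T (v + w))) (w - \<psi> v)"
proof -
  have wp: "w - \<psi> v \<in> Xp"
    using assms psi Xp by (auto intro: subspace_diff)
  have "\<kappa> * (norm (w - \<psi> v))\<^sup>2 \<le> - inner (T (v + w) - T (v + \<psi> v)) (w - \<psi> v)"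
    using monotone [OF assms psi [OF assms(1)]] unfolding gradient_f T_def .
  moreover have "inner (T (v + \<psi> v)) (w - \<psi> v) = 0"
    using R_inner [OF wp, of "T (v + \<psi> v)"] R_T_zero [OF assms(1)] by simp
  ultimately show ?thesis
    using R_inner [OF wp, of "T (v + w)"] by (simp add: inner_diff_left)
qed

text \<open>Cauchy-Schwarz applied to \<open>T_monotone\<close>. The \<open>Xp\<close>-part of the
  gradient at any trial point controls the distance to the maximizer; uniqueness, continuity and
  boundedness of \<open>\<psi>\<close> are read off by choosing the trial point.\<close>

lemma psi_estimate:
  assumes "v \<in> Xm" "w \<in> Xp"
  shows "\<kappa> * norm (w - \<psi> v) \<le> norm (R (T (v + w)))"
proof (cases "w = \<psi> v")
  case False
  have "\<kappa> * (norm (w - \<psi> v))\<^sup>2 \<le> norm (R (T (v + w))) * norm (w - \<psi> v)"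
    using T_monotone [OF assms] Cauchy_Schwarz_ineq2 [of "R (T (v + w))" "w - \<psi> v"] by simp
  with False show ?thesis
    by (simp add: power2_eq_square)
qed simp

lemma R_T_zero_iff:
  assumes "v \<in> Xm" "w \<in> Xp"
  shows "R (T (v + w)) = 0 \<longleftrightarrow> w = \<psi> v"
proof
  assume "R (T (v + w)) = 0"
  then have "\<kappa> * norm (w - \<psi> v) \<le> 0"
    using psi_estimate [OF assms] by simp
  then show "w = \<psi> v"
    using kappa_pos by (simp add: mult_le_0_iff)
qed (simp add: R_T_zero assms)

text \<open>Trial point \<open>\<psi> v\<close> at the base point \<open>y\<close>: the right side
  of the estimate depends continuously on \<open>y\<close> and vanishes at
  \<open>y = v\<close>.\<close>

lemma psi_cont: "continuous_on Xm \<psi>"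
proof (clarsimp simp: continuous_on_def)
  fix v assume v: "v \<in> Xm"
  have "((\<lambda>y. R (T (y + \<psi> v))) \<longlongrightarrow> R (T (v + \<psi> v))) (at v within Xm)"
    by (intro bounded_linear.tendsto [OF R_lin] continuous_on_tendsto_compose [OF T_cont] tendsto_intros) auto
  then have "((\<lambda>y. norm (R (T (y + \<psi> v))) / \<kappa>) \<longlongrightarrow> norm (R (T (v + \<psi> v))) / \<kappa>) (at v within Xm)"
    using kappa_pos by (intro tendsto_divide tendsto_norm tendsto_const) auto
  then have "((\<lambda>y. norm (R (T (y + \<psi> v))) / \<kappa>) \<longlongrightarrow> 0) (at v within Xm)"
    using R_T_zero [OF v] by simp
  moreover have "\<forall>\<^sub>F y in at v within Xm. norm (\<psi> y - \<psi> v) \<le> norm (R (T (y + \<psi> v))) / \<kappa>"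
    unfolding eventually_at_filter
  proof (intro always_eventually allI impI)
    fix y assume "y \<in> Xm"
    from psi_estimate [OF this psi [OF v]] show "norm (\<psi> y - \<psi> v) \<le> norm (R (T (y + \<psi> v))) / \<kappa>"
      using kappa_pos by (simp add: field_simps norm_minus_commute)
  qed
  ultimately have "((\<lambda>y. \<psi> y - \<psi> v) \<longlongrightarrow> 0) (at v within Xm)"
    by (rule Lim_null_comparison [rotated])
  then show "(\<psi> \<longlongrightarrow> \<psi> v) (at v within Xm)"
    by (simp add: LIM_zero_iff)
qed

text \<open>Trial point 0 in the estimate, together with boundedness of \<open>K\<close> on
  balls.\<close>

lemma psi_bounded:
  obtains C where "\<And>v. v \<in> Xm \<Longrightarrow> norm v \<le> M \<Longrightarrow> norm (\<psi> v) \<le> C"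
proof -
  have "compact (closure (K ` cball 0 M))"
    using K_compact by (simp add: compact_map_on_def)
  then have "bounded (K ` cball 0 M)"
    using bounded_subset [OF compact_imp_bounded closure_subset] by blast
  then obtain B where "\<forall>x\<in>K ` cball 0 M. norm x \<le> B"
    unfolding bounded_iff by blast
  then have B: "norm (K x) \<le> B" if "norm x \<le> M" for x
    using that by simp
  show thesis
  proof (rule that [of "(M + B) / \<kappa>"])
    fix v assume v: "v \<in> Xm" "norm v \<le> M"
    have "\<kappa> * norm (0 - \<psi> v) \<le> norm (R (T (v + 0)))"
      using psi_estimate [OF v(1) subspace_0 [OF Xp(1)]] .
    also have "\<dots> \<le> norm (T v)"
      using R_norm by simp
    also have "\<dots> \<le> M + B"
      unfolding T_def using norm_triangle_ineq4 [of v "K v"] v(2) B [OF v(2)] by simp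
    finally show "norm (\<psi> v) \<le> (M + B) / \<kappa>"
      using kappa_pos by (simp add: field_simps)
  qed
qed

text \<open>Maximality of \<^term>\<open>\<psi>\<close> squeezes \<open>\<phi> y - \<phi> v\<close> between two increments of \<^term>\<open>f\<close> in the
  direction \<open>y - v\<close>, so no differentiability of \<^term>\<open>\<psi>\<close> is needed.\<close>

lemma phi_derivative:
  assumes v: "v \<in> Xm"
  shows "(\<phi> has_derivative (\<lambda>h. inner (G v) h)) (at v within Xm)"
  unfolding has_derivative_within_alt
proof (intro conjI allI impI bounded_linear_inner_right)
  fix e :: real assume e: "0 < e"
  let ?u = "v + \<psi> v"
  have "continuous (at ?u) T"
    using T_cont by (simp add: continuous_on_eq_continuous_at)
  then obtain d0 where d0: "0 < d0" "\<And>z. dist z ?u < d0 \<Longrightarrow> dist (T z) (T ?u) < e"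
    using e unfolding continuous_at_eps_delta by metis
  \<comment> \<open>One half of \<open>d0\<close> is reserved for the displacement in
    \<open>Xp\<close>, the other for the displacement along \<open>y - v\<close>.\<close>
  have "0 < d0 / 2" using d0(1) by simp
  then obtain d1 where d1: "0 < d1" "\<And>y. y \<in> Xm \<Longrightarrow> dist y v < d1 \<Longrightarrow> dist (\<psi> y) (\<psi> v) < d0 / 2"
    using psi_cont v unfolding continuous_on_iff by metis
  show "\<exists>d>0. \<forall>y\<in>Xm. norm (y - v) < d \<longrightarrow>
          norm (\<phi> y - \<phi> v - inner (G v) (y - v)) \<le> e * norm (y - v)"
  proof (intro exI [of _ "min d1 (d0 / 2)"] conjI ballI impI)
    show "0 < min d1 (d0 / 2)" using d0 d1 by simp
    fix y assume y: "y \<in> Xm" "norm (y - v) < min d1 (d0 / 2)"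
    have yv: "y - v \<in> Xm" using y v Xm by (auto intro: subspace_diff)
    have GI: "inner (G v) (y - v) = inner (T ?u) (y - v)"
      using P_inner [OF yv] by (simp add: G_def)
    have est: "\<bar>inner (T (v + w + s *\<^sub>R (y - v))) (y - v) - inner (T ?u) (y - v)\<bar> \<le> e * norm (y - v)"
      if s: "0 < s" "s < 1" and w: "norm (w - \<psi> v) < d0 / 2" for s w
    proof -
      have "norm (s *\<^sub>R (y - v)) \<le> norm (y - v)"
        using s by (simp add: mult_left_le_one_le)
      then have "norm ((w - \<psi> v) + s *\<^sub>R (y - v)) < d0"
        using norm_triangle_ineq [of "w - \<psi> v" "s *\<^sub>R (y - v)"] w y(2) by simp
      then have "dist (v + w + s *\<^sub>R (y - v)) ?u < d0"
        by (simp add: dist_norm algebra_simps)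
      from d0(2) [OF this] have "norm (T (v + w + s *\<^sub>R (y - v)) - T ?u) \<le> e"
        by (simp add: dist_norm)
      then have "norm (T (v + w + s *\<^sub>R (y - v)) - T ?u) * norm (y - v) \<le> e * norm (y - v)"
        by (rule mult_right_mono) simp
      then show ?thesis
        using Cauchy_Schwarz_ineq2 [of "T (v + w + s *\<^sub>R (y - v)) - T ?u" "y - v"]
        by (simp add: inner_diff_left)
    qed
    have "norm (\<psi> y - \<psi> v) < d0 / 2" "norm (\<psi> v - \<psi> v) < d0 / 2"
      using d1(2) [OF y(1)] y(2) d0(1) by (simp_all add: dist_norm)
    moreover obtain s1 where s1: "0 < s1" "s1 < 1"
      "f ((v + \<psi> y) + (y - v)) - f (v + \<psi> y) = inner (T ((v + \<psi> y) + s1 *\<^sub>R (y - v))) (y - v)"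
      by (rule f_mean_value)
    moreover obtain s2 where s2: "0 < s2" "s2 < 1"
      "f ((v + \<psi> v) + (y - v)) - f (v + \<psi> v) = inner (T ((v + \<psi> v) + s2 *\<^sub>R (y - v))) (y - v)"
      by (rule f_mean_value)
    \<comment> \<open>Testing maximality at \<open>v\<close> with \<open>\<psi> y\<close> yields the
      upper bound of the increment of \<open>\<phi>\<close>, testing it at \<open>y\<close> with
      \<open>\<psi> v\<close> the lower bound.\<close>
    moreover have "f (v + \<psi> y) \<le> \<phi> v" "f (y + \<psi> v) \<le> \<phi> y"
      using psi_max [OF v psi [OF y(1)]] psi_max [OF y(1) psi [OF v]] phi v y by simp_all
    moreover have "\<phi> y = f ((v + \<psi> y) + (y - v))" "\<phi> v = f (v + \<psi> v)" "y + \<psi> v = (v + \<psi> v) + (y - v)"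
      using phi v y by (simp_all add: algebra_simps)
    ultimately show "norm (\<phi> y - \<phi> v - inner (G v) (y - v)) \<le> e * norm (y - v)"
      using est [OF s1(1,2), of "\<psi> y"] est [OF s2(1,2), of "\<psi> v"] unfolding GI real_norm_def
      by (smt (verit))
  qed
qed

section \<open>The gradient of the reduced function as a compact perturbation of the
  identity\<close>

lemma gradient_phi:
  assumes "v \<in> Xm"
  shows "gradient_on Xm \<phi> v = G v"
  using assms Xm phi_derivative by (intro gradient_on_eqI) (auto simp: G_def P_in)

lemma G_eq: "v \<in> Xm \<Longrightarrow> G v = v - Q v"
  by (simp add: G_def Q_def T_def P_id bounded_linear.linear [OF P_lin] linear_diff linear_add algebra_simps)

lemma cont_P [continuous_intros]: "continuous_on A g \<Longrightarrow> continuous_on A (\<lambda>x. P (g x))"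
  and cont_R [continuous_intros]: "continuous_on A g \<Longrightarrow> continuous_on A (\<lambda>x. R (g x))"
  and cont_pi [continuous_intros]: "continuous_on A g \<Longrightarrow> continuous_on A (\<lambda>x. \<pi> (g x))"
  by (intro bounded_linear.continuous_on [OF P_lin] bounded_linear.continuous_on [OF R_lin]
      bounded_linear.continuous_on [OF pi_lin]; assumption)+

lemma cont_K [continuous_intros]: "continuous_on A g \<Longrightarrow> continuous_on A (\<lambda>x. K (g x))"
  by (rule continuous_on_compose2 [OF K_cont]) auto

lemma cont_psi: "continuous_on A g \<Longrightarrow> (\<And>x. x \<in> A \<Longrightarrow> g x \<in> Xm) \<Longrightarrow> continuous_on A (\<lambda>x. \<psi> (g x))"
  by (rule continuous_on_compose2 [OF psi_cont]) auto

lemma cont_Q: "continuous_on A g \<Longrightarrow> (\<And>x. x \<in> A \<Longrightarrow> g x \<in> Xm) \<Longrightarrow> continuous_on A (\<lambda>x. Q (g x))"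
  unfolding Q_def by (intro continuous_intros cont_psi) auto

lemma Q_in: "Q v \<in> Xm"
  unfolding Q_def using P_in Xm by (intro subspace_diff)

text \<open>This is where finite dimension of \<open>Xp\<close> turns the bound on
  \<open>\<psi>\<close> into compactness.\<close>

lemma precompact_psi:
  assumes "bounded (g ` A)" "g ` A \<subseteq> Xm"
  shows "precompact_on A (\<lambda>x. \<psi> (g x))"
proof -
  obtain M where M: "\<And>x. x \<in> A \<Longrightarrow> norm (g x) \<le> M"
    using assms(1) by (auto simp: bounded_iff)
  obtain C where C: "\<And>v. v \<in> Xm \<Longrightarrow> norm v \<le> M \<Longrightarrow> norm (\<psi> v) \<le> C"
    using psi_bounded [of M] by blast
  show ?thesis
    by (rule precompact_on_finite_dimensional [OF Xp(1) Xp_finite, of _ _ C])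
       (use assms M C psi in auto)
qed

lemma Q_compact: "compact_map_on Xm Q"
  unfolding compact_map_on_def
proof (intro conjI allI impI)
  show "Q ` Xm \<subseteq> Xm" using Q_in by auto
  show "continuous_on Xm Q" using cont_Q [of Xm "\<lambda>x. x"] by (simp add: continuous_on_id)
  fix B assume B: "B \<subseteq> Xm" "bounded B"
  have pp: "precompact_on B (\<lambda>v. \<psi> v)"
    using precompact_psi [of "\<lambda>v. v" B] B by simp
  then obtain Z where "compact Z" "\<psi> ` B \<subseteq> Z"
    by (auto simp: precompact_on_def)
  then have "bounded (\<psi> ` B)"
    using bounded_subset compact_imp_bounded by blast
  then have "bounded ((\<lambda>v. v + \<psi> v) ` B)"
    using bounded_plus_comp [of "\<lambda>v. v" B \<psi>] B(2) by simp
  then have "precompact_on B (\<lambda>v. K (v + \<psi> v))"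
    by (intro precompact_on_compact_map [OF K_compact]) auto
  then have "precompact_on B (\<lambda>v. P (K (v + \<psi> v)) - P (\<psi> v))"
    using pp by (intro precompact_on_diff precompact_on_compose [of _ _ P] bounded_linear.continuous_on [OF P_lin] continuous_on_id)
  then obtain Y where Y: "compact Y" "Q ` B \<subseteq> Y"
    by (auto simp: precompact_on_def Q_def)
  then have "closure (Q ` B) \<subseteq> Y"
    using closure_minimal compact_imp_closed by blast
  then show "compact (closure (Q ` B))"
    using Y(1) compact_closure bounded_subset compact_imp_bounded
    by (metis closed_closure closed_Int_compact inf.absorb_iff1)
qed

end

section \<open>The index formula\<close>

lemma precompact_on_imp_bounded:
  fixes g :: "'b \<Rightarrow> 'a::real_normed_vector"
  assumes "precompact_on A g"
  shows "bounded (g ` A)"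
  using assms bounded_subset compact_imp_bounded by (auto simp: precompact_on_def)

lemma bounded_linear_image_bounded:
  assumes "bounded_linear h" "bounded (g ` A)"
  shows "bounded ((\<lambda>x. h (g x)) ` A)"
  using bounded_linear_image [OF assms(2,1)] by (simp add: image_image)

lemma LS_degree_homotopy_ball:
  fixes C :: "real \<Rightarrow> 'a::real_inner \<Rightarrow> 'a"
  assumes r: "0 < r"
    and cont: "continuous_on ({0..1} \<times> cball u r) (\<lambda>q. C (fst q) (snd q))"
    and pre: "precompact_on ({0..1} \<times> cball u r) (\<lambda>q. C (fst q) (snd q))"
    and fixfree: "\<And>t x. t \<in> {0..1} \<Longrightarrow> x \<in> sphere u r \<Longrightarrow> C t x \<noteq> x"
  shows "LS_degree UNIV (\<lambda>x. x - C 0 x) u r = LS_degree UNIV (\<lambda>x. x - C 1 x) u r"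
proof -
  obtain Z where Z: "compact Z" "(\<lambda>q. C (fst q) (snd q)) ` ({0..1} \<times> cball u r) \<subseteq> Z"
    using pre by (auto simp: precompact_on_def)
  have ZC: "C t x \<in> Z" if "t \<in> {0..1}" "x \<in> cball u r" for t x
    using Z(2) that by (force simp: image_subset_iff)
  show ?thesis
    using LS_degree_homotopy [of UNIV u "\<lambda>_. r" r C Z] r cont Z(1) ZC fixfree
    by (simp add: case_prod_unfold)
qed

text \<open>\<open>\<pi>\<close> sends the ball of radius \<open>r\<close> around \<open>u\<close>
  into the ball of radius \<open>r * onorm \<pi>\<close> around \<open>v0\<close>, so the constraint
  on \<open>r\<close> keeps projected points where \<open>v0\<close> is the only zero of
  \<open>G\<close>. The summand 1 also gives \<open>r < e\<close>, which is used when
  \<open>x - u\<close> itself lies in \<open>Xm\<close>.\<close>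

locale isolated_saddle_point = saddle_point_reduction +
  fixes v0 u :: 'a and r e :: real
  assumes v0: "v0 \<in> Xm"
    and isolated: "\<And>v. v \<in> Xm \<Longrightarrow> norm (v - v0) < e \<Longrightarrow> G v = 0 \<Longrightarrow> v = v0"
    and u: "u = v0 + \<psi> v0"
    and r: "0 < r" "r * (onorm \<pi> + 1) < e"
begin

lemma P_simps: "P (a + b) = P a + P b" "P (a - b) = P a - P b" "P (c *\<^sub>R a) = c *\<^sub>R P a" "P 0 = 0"
  using bounded_linear.linear [OF P_lin] by (auto simp: linear_add linear_diff linear_scale linear_0)

lemma R_simps: "R (a + b) = R a + R b" "R (a - b) = R a - R b" "R (c *\<^sub>R a) = c *\<^sub>R R a" "R 0 = 0"
  using bounded_linear.linear [OF R_lin] by (auto simp: linear_add linear_diff linear_scale linear_0)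

lemma pi_simps: "\<pi> (a + b) = \<pi> a + \<pi> b" "\<pi> (a - b) = \<pi> a - \<pi> b" "\<pi> (c *\<^sub>R a) = c *\<^sub>R \<pi> a" "\<pi> 0 = 0"
  using bounded_linear.linear [OF pi_lin] by (auto simp: linear_add linear_diff linear_scale linear_0)

lemma norm_pi: "norm (\<pi> z) \<le> onorm \<pi> * norm z"
  by (rule onorm [OF pi_lin])

lemma onorm_pi_nonneg: "0 \<le> onorm \<pi>"
  by (rule onorm_pos_le [OF pi_lin])

lemma r_less_e: "r < e"
proof -
  have "r * 1 \<le> r * (onorm \<pi> + 1)"
    using r(1) onorm_pi_nonneg by (intro mult_left_mono) auto
  then show ?thesis using r(2) by simp
qed

lemma pi_u: "\<pi> u = v0"
  using pi_unique [OF v0, of u] psi [OF v0] by (simp add: u)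

text \<open>The \<open>Xp\<close>-part of the equation places \<open>x\<close> on the graph of
  \<open>\<psi>\<close>; there the \<open>Xm\<close>-part reads \<open>G (\<pi> x) = 0\<close>, and
  isolation applies. So \<open>u\<close> is an isolated zero of the full gradient.\<close>

lemma T_zeroD:
  assumes "T x = 0" "norm (x - u) * (onorm \<pi> + 1) < e"
  shows "x = u"
proof -
  have w: "x - \<pi> x = \<psi> (\<pi> x)"
    using R_T_zero_iff [OF pi_in pi_compl, of x x] assms(1) by (simp add: R_simps)
  then have eq: "\<pi> x + \<psi> (\<pi> x) = x"
    by (simp add: algebra_simps)
  have "norm (\<pi> x - v0) \<le> onorm \<pi> * norm (x - u)"
    using norm_pi [of "x - u"] by (simp add: pi_simps pi_u)
  also have "\<dots> \<le> norm (x - u) * (onorm \<pi> + 1)"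
    by (simp add: algebra_simps)
  finally have "norm (\<pi> x - v0) < e"
    using assms(2) by simp
  moreover have "G (\<pi> x) = 0"
    by (simp add: G_def eq assms(1) P_simps)
  ultimately have "\<pi> x = v0"
    using isolated pi_in by blast
  with eq show ?thesis by (simp add: u)
qed

lemma T_nonzero_sphere:
  assumes "x \<in> sphere u r"
  shows "T x \<noteq> 0"
proof
  assume "T x = 0"
  moreover have "norm (x - u) = r"
    using assms by (simp add: dist_norm norm_minus_commute)
  ultimately have "x = u"
    using T_zeroD r(2) by simp
  with \<open>norm (x - u) = r\<close> r(1) show False by simp
qed

lemma G_zero_sphere:
  assumes "x \<in> sphere u r" "G (\<pi> x) = 0"
  shows "\<pi> x = v0"
proof -
  have "norm (x - u) = r"
    using assms by (simp add: dist_norm norm_minus_commute)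
  then have "norm (\<pi> x - v0) \<le> onorm \<pi> * r"
    using norm_pi [of "x - u"] by (simp add: pi_simps pi_u)
  also have "\<dots> < e"
    using r by (simp add: algebra_simps)
  finally show ?thesis
    using isolated pi_in assms(2) by blast
qed

section \<open>Precompactness of the terms occurring in the homotopies\<close>

abbreviation "B \<equiv> {0..1::real} \<times> cball u r"

lemma bounded_snd: "bounded (snd ` B)"
  by (rule bounded_subset [OF bounded_cball [of u r]]) auto

lemma precompact_P: "precompact_on A g \<Longrightarrow> precompact_on A (\<lambda>x. P (g x))"
  and precompact_R: "precompact_on A g \<Longrightarrow> precompact_on A (\<lambda>x. R (g x))"
  by (erule precompact_on_compose, intro continuous_intros)+

lemma precompact_on_Xp:
  assumes "bounded (g ` A)" "g ` A \<subseteq> Xp"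
  shows "precompact_on A g"
proof -
  obtain M where "\<And>x. x \<in> A \<Longrightarrow> norm (g x) \<le> M"
    using assms(1) by (auto simp: bounded_iff)
  then show ?thesis
    using assms(2) by (intro precompact_on_finite_dimensional [OF Xp(1) Xp_finite, of _ _ M]) auto
qed

lemma precompact_fst: "precompact_on B fst"
  unfolding precompact_on_def by (intro exI [of _ "{0..1}"]) auto

lemma precompact_w: "precompact_on B (\<lambda>q. snd q - \<pi> (snd q))"
proof (rule precompact_on_Xp)
  show "bounded ((\<lambda>q. snd q - \<pi> (snd q)) ` B)"
    by (intro bounded_minus_comp bounded_snd bounded_linear_image_bounded [OF pi_lin])
qed (use pi_compl in auto)

text \<open>\<open>P\<close> fixes \<open>\<pi> x\<close>, so \<open>x - P x\<close> depends only on
  the component of \<open>x\<close> in \<open>Xp\<close>. Thus the complementary orthogonal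
  projection has finite rank although its range need not be \<open>Xp\<close>.\<close>

lemma precompact_P_compl: "precompact_on B (\<lambda>q. snd q - P (snd q))"
proof -
  have "(x - \<pi> x) - P (x - \<pi> x) = x - P x" for x
    by (simp add: P_simps P_id pi_in)
  then show ?thesis
    using precompact_on_diff [OF precompact_w precompact_P [OF precompact_w]] by (simp only:)
qed

lemma precompact_R_snd: "precompact_on B (\<lambda>q. R (snd q))"
proof (rule precompact_on_Xp)
  show "bounded ((\<lambda>q. R (snd q)) ` B)"
    by (intro bounded_snd bounded_linear_image_bounded [OF R_lin])
qed (use R_in in auto)

lemma bounded_pi_snd: "bounded ((\<lambda>q. \<pi> (snd q)) ` B)"
  by (intro bounded_snd bounded_linear_image_bounded [OF pi_lin])

lemma precompact_psi_pi: "precompact_on B (\<lambda>q. \<psi> (\<pi> (snd q)))"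
  using bounded_pi_snd pi_in by (intro precompact_psi) auto

lemma precompact_K_snd: "precompact_on B (\<lambda>q. K (snd q))"
  using bounded_snd by (intro precompact_on_compact_map [OF K_compact]) auto

lemma precompact_Q_pi: "precompact_on B (\<lambda>q. Q (\<pi> (snd q)))"
  using bounded_pi_snd pi_in by (intro precompact_on_compact_map [OF Q_compact]) auto

lemmas precompact_intros =
  precompact_on_add precompact_on_diff precompact_on_scaleR precompact_P precompact_R precompact_on_const
  precompact_fst precompact_w precompact_P_compl precompact_R_snd precompact_psi_pi precompact_K_snd precompact_Q_pi

text \<open>The map \<^term>\<open>\<lambda>y. P y + R y\<close> is positive definite, so it can be joined to the identity.
  It separates the two components of the gradient although \<^term>\<open>Xm\<close> and \<^term>\<open>Xp\<close>
  need not be orthogonal.\<close>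

lemma homotopy_split_gradient:
  "LS_degree UNIV T u r = LS_degree UNIV (\<lambda>x. P (T x) + R (T x)) u r"
proof -
  define C where "C t x = K x + t *\<^sub>R ((x - P x) - R x - (K x - P (K x) - R (K x)))" for t x
  have C: "x - C t x = T x - t *\<^sub>R (T x - P (T x) - R (T x))" for t x
    by (simp add: C_def T_def P_simps R_simps algebra_simps)
  have "LS_degree UNIV (\<lambda>x. x - C 0 x) u r = LS_degree UNIV (\<lambda>x. x - C 1 x) u r"
  proof (rule LS_degree_homotopy_ball [OF r(1)])
    show "continuous_on B (\<lambda>q. C (fst q) (snd q))"
      unfolding C_def by (intro continuous_intros)
    show "precompact_on B (\<lambda>q. C (fst q) (snd q))"
      unfolding C_def by (intro precompact_intros)
    fix t x assume t: "t \<in> {0..1::real}" and x: "x \<in> sphere u r"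
    let ?y = "T x"
    show "C t x \<noteq> x"
    proof
      assume "C t x = x"
      then have "?y = t *\<^sub>R (?y - P ?y - R ?y)"
        using C [of x t] by simp
      then have "inner ?y ?y = inner (t *\<^sub>R (?y - P ?y - R ?y)) ?y"
        by simp
      moreover have "inner (P ?y) ?y = (norm (P ?y))\<^sup>2" "inner (R ?y) ?y = (norm (R ?y))\<^sup>2"
        unfolding P_def R_def using inner_orth_proj_self [OF Xm] inner_orth_proj_self [OF Xp] by auto
      ultimately have "(1 - t) * (norm ?y)\<^sup>2 + t * ((norm (P ?y))\<^sup>2 + (norm (R ?y))\<^sup>2) = 0"
        by (simp add: inner_diff_left algebra_simps power2_norm_eq_inner)
      moreover have "0 \<le> (1 - t) * (norm ?y)\<^sup>2" "0 \<le> t * ((norm (P ?y))\<^sup>2 + (norm (R ?y))\<^sup>2)"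
        using t by auto
      \<comment> \<open>Since \<open>T x\<close> is nonzero, the first term forces
        \<open>t = 1\<close>, and then the second makes both projections of \<open>T x\<close>
        vanish. A vector orthogonal to \<open>Xm\<close> and to \<open>Xp\<close> is orthogonal to
        itself.\<close>
      ultimately have "(1 - t) * (norm ?y)\<^sup>2 = 0" "t * ((norm (P ?y))\<^sup>2 + (norm (R ?y))\<^sup>2) = 0"
        by linarith+
      then have PR: "P ?y = 0" "R ?y = 0"
        using T_nonzero_sphere [OF x] by (auto simp: add_nonneg_eq_0_iff)
      have "inner ?y ?y = inner ?y (\<pi> ?y) + inner ?y (?y - \<pi> ?y)"
        by (simp flip: inner_add_right)
      also have "\<dots> = 0"
        using P_inner [OF pi_in, of ?y ?y] R_inner [OF pi_compl, of ?y ?y] PR by simp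
      finally show False
        using T_nonzero_sphere [OF x] by simp
    qed
  qed
  moreover have "(\<lambda>x. x - C 0 x) = T" "(\<lambda>x. x - C 1 x) = (\<lambda>x. P (T x) + R (T x))"
    unfolding C by auto
  ultimately show ?thesis by simp
qed

text \<open>The argument of the \<open>Xm\<close>-part slides along \<open>z\<close> from
  \<open>x\<close> to the graph of \<open>\<psi>\<close> while the \<open>Xp\<close>-part is
  deformed. At a zero both parts vanish because the sum is direct. The \<open>Xp\<close>-part forces
  \<open>x\<close> onto the graph, where \<open>z\<close> no longer depends on \<open>t\<close>, so
  the \<open>Xm\<close>-part becomes \<open>G (\<pi> x) = 0\<close>.\<close>

lemma homotopy_monotone:
  "LS_degree UNIV (\<lambda>x. P (T x) + R (T x)) u r
     = LS_degree UNIV (\<lambda>x. G (\<pi> x) - (x - \<pi> x - \<psi> (\<pi> x))) u r"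
proof -
  define z where "z t x = \<pi> x + ((1 - t) *\<^sub>R (x - \<pi> x) + t *\<^sub>R \<psi> (\<pi> x))" for t x
  define C where "C t x = (x - \<pi> x) - (1 - t) *\<^sub>R P (x - \<pi> x) - t *\<^sub>R P (\<psi> (\<pi> x)) + P (K (z t x))
      - (1 - t) *\<^sub>R R x + (1 - t) *\<^sub>R R (K x) + t *\<^sub>R (x - \<pi> x) - t *\<^sub>R \<psi> (\<pi> x)" for t x
  have C: "x - C t x = P (T (z t x)) + ((1 - t) *\<^sub>R R (T x) - t *\<^sub>R (x - \<pi> x - \<psi> (\<pi> x)))" for t x
    by (simp add: C_def T_def P_simps R_simps P_id [OF pi_in] z_def algebra_simps)
  have "LS_degree UNIV (\<lambda>x. x - C 0 x) u r = LS_degree UNIV (\<lambda>x. x - C 1 x) u r"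
  proof (rule LS_degree_homotopy_ball [OF r(1)])
    show "continuous_on B (\<lambda>q. C (fst q) (snd q))"
      unfolding C_def z_def by (intro continuous_intros cont_psi) (auto simp: pi_in)
    have "precompact_on B (\<lambda>q. (1 - fst q) *\<^sub>R (snd q - \<pi> (snd q)) + fst q *\<^sub>R \<psi> (\<pi> (snd q)))"
      by (intro precompact_intros)
    then have "bounded ((\<lambda>q. z (fst q) (snd q)) ` B)"
      unfolding z_def by (intro bounded_plus_comp bounded_pi_snd precompact_on_imp_bounded)
    then have "precompact_on B (\<lambda>q. K (z (fst q) (snd q)))"
      by (intro precompact_on_compact_map [OF K_compact]) auto
    then show "precompact_on B (\<lambda>q. C (fst q) (snd q))"
      unfolding C_def by (intro precompact_intros)
    fix t x assume t: "t \<in> {0..1::real}" and x: "x \<in> sphere u r"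
    let ?d = "x - \<pi> x - \<psi> (\<pi> x)"
    show "C t x \<noteq> x"
    proof
      assume "C t x = x"
      then have "P (T (z t x)) + ((1 - t) *\<^sub>R R (T x) - t *\<^sub>R ?d) = 0"
        using C [of x t] by simp
      moreover have "(1 - t) *\<^sub>R R (T x) - t *\<^sub>R ?d \<in> Xp"
        by (intro subspace_diff [OF Xp(1)] subspace_scale [OF Xp(1)] R_in pi_compl psi pi_in)
      ultimately have PT: "P (T (z t x)) = 0" and RT: "(1 - t) *\<^sub>R R (T x) - t *\<^sub>R ?d = 0"
        using direct_sum_zero [OF P_in] by blast+
      have "inner ((1 - t) *\<^sub>R R (T x) - t *\<^sub>R ?d) ?d = 0"
        by (simp only: RT inner_zero_left)
      then have "t * (norm ?d)\<^sup>2 = (1 - t) * inner (R (T x)) ?d"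
        by (simp add: inner_diff_left [of "_ *\<^sub>R _"] power2_norm_eq_inner)
      moreover have "\<kappa> * (norm ?d)\<^sup>2 \<le> - inner (R (T x)) ?d"
        using T_monotone [OF pi_in pi_compl, of x x] by simp
      then have "(1 - t) * (\<kappa> * (norm ?d)\<^sup>2) \<le> (1 - t) * - inner (R (T x)) ?d"
        using t by (intro mult_left_mono) auto
      ultimately have le: "(1 - t) * (\<kappa> * (norm ?d)\<^sup>2) + t * (norm ?d)\<^sup>2 \<le> 0"
        by simp
      have "(norm ?d)\<^sup>2 = 0"
      proof (rule ccontr)
        assume "(norm ?d)\<^sup>2 \<noteq> 0"
        then have pos: "0 < (norm ?d)\<^sup>2" "0 < \<kappa> * (norm ?d)\<^sup>2"
          using kappa_pos by auto
        show False
        \<comment> \<open>For \<open>t < 1\<close> the concavity term is already positive; at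
          \<open>t = 1\<close> it vanishes and the plain square takes over.\<close>
        proof (cases "t = 1")
          case False
          then have "0 < (1 - t) * (\<kappa> * (norm ?d)\<^sup>2)" "0 \<le> t * (norm ?d)\<^sup>2"
            using t pos by auto
          with le show False by linarith
        qed (use le pos in simp)
      qed
      then have d: "x - \<pi> x = \<psi> (\<pi> x)"
        by simp
      then have "z t x = \<pi> x + \<psi> (\<pi> x)"
        by (simp add: z_def flip: scaleR_left_distrib)
      with PT have "G (\<pi> x) = 0"
        by (simp add: G_def)
      then have "\<pi> x = v0"
        by (rule G_zero_sphere [OF x])
      with d have "x = u"
        by (simp add: u algebra_simps)
      with x r(1) show False by simp
    qed
  qed
  moreover have "x - C 0 x = P (T x) + R (T x)" "x - C 1 x = G (\<pi> x) - (x - \<pi> x - \<psi> (\<pi> x))" for x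
    unfolding C by (simp_all add: z_def G_def)
  ultimately show ?thesis by simp
qed

text \<open>A zero has \<open>\<pi> x = v0\<close>, where \<open>\<psi> (\<pi> x)\<close> and
  \<open>\<psi> v0\<close> coincide, so the interpolation is invisible at zeros. With
  \<open>\<psi>\<close> frozen, every zero satisfies \<open>x - u \<in> Xm\<close> even when the
  projection varies, as the next deformation requires.\<close>

lemma homotopy_freeze_psi:
  "LS_degree UNIV (\<lambda>x. G (\<pi> x) - (x - \<pi> x - \<psi> (\<pi> x))) u r
     = LS_degree UNIV (\<lambda>x. G (\<pi> x) - (x - \<pi> x - \<psi> v0)) u r"
proof -
  \<comment> \<open>The factor 2 reverses the sign of the identity on the
    \<open>Xp\<close>-component; as that component has finite rank, the map stays a compact
    perturbation of the identity.\<close>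
  define C where "C t x = 2 *\<^sub>R (x - \<pi> x) + Q (\<pi> x) - (1 - t) *\<^sub>R \<psi> (\<pi> x) - t *\<^sub>R \<psi> v0" for t x
  have C: "x - C t x = G (\<pi> x) + - (x - \<pi> x - (1 - t) *\<^sub>R \<psi> (\<pi> x) - t *\<^sub>R \<psi> v0)" for t x
    by (simp add: C_def G_eq [OF pi_in] scaleR_2)
  have "LS_degree UNIV (\<lambda>x. x - C 0 x) u r = LS_degree UNIV (\<lambda>x. x - C 1 x) u r"
  proof (rule LS_degree_homotopy_ball [OF r(1)])
    show "continuous_on B (\<lambda>q. C (fst q) (snd q))"
      unfolding C_def by (intro continuous_intros cont_psi cont_Q) (auto simp: pi_in)
    show "precompact_on B (\<lambda>q. C (fst q) (snd q))"
      unfolding C_def by (intro precompact_intros)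
    fix t x assume t: "t \<in> {0..1::real}" and x: "x \<in> sphere u r"
    show "C t x \<noteq> x"
    proof
      assume "C t x = x"
      then have "G (\<pi> x) + - (x - \<pi> x - (1 - t) *\<^sub>R \<psi> (\<pi> x) - t *\<^sub>R \<psi> v0) = 0"
        using C [of x t] by simp
      moreover have "- (x - \<pi> x - (1 - t) *\<^sub>R \<psi> (\<pi> x) - t *\<^sub>R \<psi> v0) \<in> Xp"
        using pi_compl psi [OF pi_in] psi [OF v0] Xp by (intro subspace_neg subspace_diff [OF _ subspace_diff] subspace_scale)
      moreover have "G (\<pi> x) \<in> Xm"
        by (simp add: G_def P_in)
      ultimately have Gz: "G (\<pi> x) = 0" and w: "- (x - \<pi> x - (1 - t) *\<^sub>R \<psi> (\<pi> x) - t *\<^sub>R \<psi> v0) = 0"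
        using direct_sum_zero by blast+
      have "\<pi> x = v0"
        by (rule G_zero_sphere [OF x Gz])
      with w have "x = u"
        by (simp add: u algebra_simps)
      with x r(1) show False by simp
    qed
  qed
  moreover have "x - C 0 x = G (\<pi> x) - (x - \<pi> x - \<psi> (\<pi> x))" "x - C 1 x = G (\<pi> x) - (x - \<pi> x - \<psi> v0)" for x
    unfolding C by simp_all
  ultimately show ?thesis by simp
qed

text \<open>Convex combinations of \<open>\<pi>\<close> and \<open>P\<close> still map into
  \<open>Xm\<close> and fix it pointwise. A zero puts \<open>x - u\<close> in \<open>Xm\<close>,
  where the choice of projection does not matter, and the equation becomes
  \<open>G (v0 + (x - u)) = 0\<close> at distance \<open>r\<close> from \<open>v0\<close>.\<close>

lemma homotopy_orthogonalize:
  "LS_degree UNIV (\<lambda>x. G (\<pi> x) - (x - \<pi> x - \<psi> v0)) u r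
     = LS_degree UNIV (\<lambda>x. G (v0 + P (x - u)) - (x - u - P (x - u))) u r"
proof -
  define p where "p t x = (1 - t) *\<^sub>R \<pi> (x - u) + t *\<^sub>R P (x - u)" for t x
  define C where "C t x = 2 *\<^sub>R ((1 - t) *\<^sub>R ((x - \<pi> x) - (u - \<pi> u)) + t *\<^sub>R ((x - P x) - (u - P u)))
      + \<psi> v0 + Q (v0 + p t x)" for t x
  have p_in: "p t x \<in> Xm" and vp_in: "v0 + p t x \<in> Xm" for t x
    using v0 pi_in P_in Xm by (auto simp: p_def intro!: subspace_add subspace_scale)
  have C: "x - C t x = G (v0 + p t x) - (x - u - p t x)" for t x
  proof -
    have "(1 - t) *\<^sub>R ((x - \<pi> x) - (u - \<pi> u)) + t *\<^sub>R ((x - P x) - (u - P u)) = x - u - p t x"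
      by (simp add: p_def pi_simps P_simps algebra_simps)
    then show ?thesis
      by (simp add: C_def G_eq [OF vp_in] scaleR_2 u)
  qed
  have "LS_degree UNIV (\<lambda>x. x - C 0 x) u r = LS_degree UNIV (\<lambda>x. x - C 1 x) u r"
  proof (rule LS_degree_homotopy_ball [OF r(1)])
    have "continuous_on B (\<lambda>q. p (fst q) (snd q))"
      unfolding p_def by (intro continuous_intros)
    then show "continuous_on B (\<lambda>q. C (fst q) (snd q))"
      unfolding C_def by (intro continuous_intros cont_Q) (auto simp: vp_in)
    have "norm (p t x) \<le> onorm \<pi> * r + r" if "t \<in> {0..1}" "x \<in> cball u r" for t x
    proof -
      have xu: "norm (x - u) \<le> r"
        using that by (simp add: dist_norm norm_minus_commute)
      have "norm (\<pi> (x - u)) \<le> onorm \<pi> * r"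
        using norm_pi [of "x - u"] mult_left_mono [OF xu onorm_pi_nonneg] by linarith
      moreover have "norm (P (x - u)) \<le> r"
        using P_norm [of "x - u"] xu by linarith
      moreover have "(1 - t) * norm (\<pi> (x - u)) \<le> norm (\<pi> (x - u))" "t * norm (P (x - u)) \<le> norm (P (x - u))"
        using that(1) by (auto intro: mult_left_le_one_le)
      moreover have "norm (p t x) \<le> (1 - t) * norm (\<pi> (x - u)) + t * norm (P (x - u))"
        unfolding p_def using that(1) norm_triangle_ineq [of "(1 - t) *\<^sub>R \<pi> (x - u)" "t *\<^sub>R P (x - u)"] by simp
      ultimately show ?thesis by linarith
    qed
    then have "bounded ((\<lambda>q. p (fst q) (snd q)) ` B)"
      unfolding bounded_iff by (intro exI [of _ "onorm \<pi> * r + r"]) auto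
    then have "bounded ((\<lambda>q. v0 + p (fst q) (snd q)) ` B)"
      using bounded_translation [of "(\<lambda>q. p (fst q) (snd q)) ` B" v0] by (simp add: image_image)
    then have "precompact_on B (\<lambda>q. Q (v0 + p (fst q) (snd q)))"
      using vp_in by (intro precompact_on_compact_map [OF Q_compact]) auto
    then show "precompact_on B (\<lambda>q. C (fst q) (snd q))"
      unfolding C_def by (intro precompact_intros)
    fix t x assume t: "t \<in> {0..1::real}" and x: "x \<in> sphere u r"
    show "C t x \<noteq> x"
    proof
      assume "C t x = x"
      then have eq: "x - u = p t x + G (v0 + p t x)"
        using C [of x t] by (simp add: algebra_simps)
      also have "\<dots> \<in> Xm"
        using p_in Xm P_in by (auto simp: G_def intro: subspace_add)
      finally have "p t x = x - u"
        by (simp add: p_def pi_id P_id flip: scaleR_left_distrib)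
      with eq have "G (v0 + (x - u)) = 0" "v0 + (x - u) \<in> Xm"
        using vp_in [of t x] by simp_all
      moreover have nx: "norm (x - u) = r"
        using x by (simp add: dist_norm norm_minus_commute)
      ultimately have "v0 + (x - u) = v0"
        using r_less_e by (intro isolated) simp_all
      with nx r(1) show False by simp
    qed
  qed
  moreover have "x - C 0 x = G (\<pi> x) - (x - \<pi> x - \<psi> v0)"
    "x - C 1 x = G (v0 + P (x - u)) - (x - u - P (x - u))" for x
    unfolding C by (simp_all add: p_def pi_simps pi_u) (simp add: u)
  ultimately show ?thesis by simp
qed

text \<open>Both degrees are computed from one projection \<open>p\<close>: on \<open>E\<close> it
  approximates \<open>G\<close>, and on \<open>F\<close>, the sum of \<open>E\<close> and
  \<open>Xp\<close>, the full map. The orthogonal complement of \<open>E\<close> in \<open>F\<close>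
  may differ from \<open>Xp\<close> but has the same dimension, and this dimension alone determines
  the sign.\<close>

lemma LS_degree_orthogonal_product:
  "LS_degree UNIV (\<lambda>x. G (v0 + P (x - u)) - (x - u - P (x - u))) u r
     = (-1) ^ dim Xp * LS_degree Xm G v0 r"
proof -
  define N where "N x = G (v0 + P (x - u)) - (x - u - P (x - u))" for x
  \<comment> \<open>The finite-rank part of the perturbation. It enters the approximation unchanged,
    so only \<open>Q\<close> has to be projected.\<close>
  define D where "D x = 2 *\<^sub>R ((x - P x) - (u - P u)) + \<psi> v0" for x
  have vP: "v0 + P z \<in> Xm" for z
    using v0 P_in Xm by (simp add: subspace_add)
  have N: "N x = x - (D x + Q (v0 + P (x - u)))" for x
  proof -
    have "(x - P x) - (u - P u) = x - u - P (x - u)"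
      by (simp add: P_simps algebra_simps)
    then show ?thesis
      by (simp add: N_def D_def G_eq [OF vP] scaleR_2 u) (simp add: P_simps)
  qed
  have ball: "v0 + P (x - u) \<in> cball v0 r \<inter> Xm" if "x \<in> cball u r" for x
    using P_norm [of "x - u"] that vP by (auto simp: dist_norm norm_minus_commute)
  have closed_sph: "closed (sphere a r)" for a :: 'a
  proof -
    have "sphere a r = {x. dist a x = r}" by auto
    then show ?thesis
      by (simp add: closed_Collect_eq continuous_on_dist continuous_on_const continuous_on_id)
  qed
  have D_cont: "continuous_on A D" for A
    unfolding D_def by (intro continuous_intros)
  have DQ_cont: "continuous_on A (\<lambda>x. D x + Q (v0 + P (x - u)))" for A
    by (intro continuous_intros D_cont cont_Q) (use vP in auto)

  define Z where "Z = closure (Q ` (cball v0 r \<inter> Xm))"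
  have Z: "compact Z" "Z \<subseteq> Xm"
  proof -
    show "compact Z"
      using Q_compact bounded_subset [OF bounded_cball [of v0 r], of "cball v0 r \<inter> Xm"]
      by (simp add: Z_def compact_map_on_def)
    show "Z \<subseteq> Xm"
      unfolding Z_def using Q_in Xm(2) by (intro closure_minimal) auto
  qed
  have QZ: "Q v \<in> Z" if "v \<in> cball v0 r \<inter> Xm" for v
    unfolding Z_def by (rule subsetD [OF closure_subset imageI [OF that]])

  have "precompact_on (cball u r) (\<lambda>x. D x + Q (v0 + P (x - u)))"
  proof (rule precompact_on_add)
    have pre: "precompact_on B (\<lambda>q. D (snd q))"
      unfolding D_def by (intro precompact_intros)
    have "(\<lambda>x. (0, x)) ` cball u r \<subseteq> B"
      by (auto simp: image_subset_iff)
    from precompact_on_reindex [OF pre this] show "precompact_on (cball u r) D"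
      by simp
    show "precompact_on (cball u r) (\<lambda>x. Q (v0 + P (x - u)))"
      unfolding precompact_on_def by (intro exI [of _ Z] conjI Z(1) image_subsetI QZ ball)
  qed
  then obtain Y where Y: "compact Y" "(\<lambda>x. D x + Q (v0 + P (x - u))) ` cball u r \<subseteq> Y"
    by (auto simp: precompact_on_def)
  obtain \<delta>1 where \<delta>1: "0 < \<delta>1" "\<And>x. x \<in> sphere u r \<Longrightarrow> \<delta>1 \<le> norm (N x)"
  proof (rule compact_perturbation_bounded_below
      [of "{0} \<times> sphere u r" "\<lambda>q. D (snd q) + Q (v0 + P (snd q - u))" Y])
    show "closed ({0::real} \<times> sphere u r)"
      by (intro closed_Times closed_sph) simp
    show "continuous_on ({0} \<times> sphere u r) (\<lambda>q. D (snd q) + Q (v0 + P (snd q - u)))"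
      by (rule continuous_on_compose2 [OF DQ_cont [of UNIV] continuous_on_snd [OF continuous_on_id]]) simp
    show "(\<lambda>q. D (snd q) + Q (v0 + P (snd q - u))) ` ({0} \<times> sphere u r) \<subseteq> Y"
      using Y(2) by force
    fix q :: "real \<times> 'a" assume q: "q \<in> {0} \<times> sphere u r"
    let ?x = "snd q"
    have nx: "norm (?x - u) = r"
      using q by (auto simp: dist_norm norm_minus_commute)
    show "D ?x + Q (v0 + P (?x - u)) \<noteq> ?x"
    proof
      assume "D ?x + Q (v0 + P (?x - u)) = ?x"
      then have "N ?x = 0"
        by (simp add: N)
      then have eq: "?x - u = P (?x - u) + G (v0 + P (?x - u))"
        by (simp add: N_def)
      also have "\<dots> \<in> Xm"
        using Xm P_in by (auto simp: G_def intro: subspace_add)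
      finally have Px: "P (?x - u) = ?x - u"
        by (rule P_id)
      with eq have "G (v0 + (?x - u)) = 0" "v0 + (?x - u) \<in> Xm"
        using vP [of "?x - u"] by simp_all
      then have "v0 + (?x - u) = v0"
        using r_less_e nx by (intro isolated) simp_all
      with nx r(1) show False by simp
    qed
  qed (use Y(1) in \<open>auto simp: N intro: that\<close>)
  obtain \<delta>2 where \<delta>2: "0 < \<delta>2" "\<And>x. x \<in> sphere v0 r \<inter> Xm \<Longrightarrow> \<delta>2 \<le> norm (G x)"
  proof (rule compact_perturbation_bounded_below [of "{0} \<times> (sphere v0 r \<inter> Xm)" "\<lambda>q. Q (snd q)" Z])
    show "closed ({0::real} \<times> (sphere v0 r \<inter> Xm))"
      by (intro closed_Times closed_Int closed_sph Xm) simp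
    show "continuous_on ({0} \<times> (sphere v0 r \<inter> Xm)) (\<lambda>q. Q (snd q))"
      by (intro cont_Q continuous_intros) auto
    show "(\<lambda>q. Q (snd q)) ` ({0} \<times> (sphere v0 r \<inter> Xm)) \<subseteq> Z"
      using QZ by auto
    fix q :: "real \<times> 'a" assume q: "q \<in> {0} \<times> (sphere v0 r \<inter> Xm)"
    then have x: "snd q \<in> Xm" "norm (snd q - v0) = r"
      by (auto simp: dist_norm norm_minus_commute)
    show "Q (snd q) \<noteq> snd q"
    proof
      assume "Q (snd q) = snd q"
      then have "G (snd q) = 0"
        using G_eq [OF x(1)] by simp
      then have "snd q = v0"
        using isolated [OF x(1)] x(2) r_less_e by simp
      with x(2) r(1) show False by simp
    qed
  qed (use Z(1) in \<open>auto simp: G_eq intro: that\<close>)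

  \<comment> \<open>A single tolerance below both boundary bounds, so that the same \<open>p\<close>
    is admissible for both degrees.\<close>
  define \<delta> where "\<delta> = min \<delta>1 \<delta>2"
  obtain bs where bs: "finite bs" "span bs = Xp"
    using Xp_finite by (auto simp: finite_dimensional_on_def)
  \<comment> \<open>Including the projected basis of \<open>Xp\<close> places \<open>P\<close> of
    all of \<open>Xp\<close> inside \<open>E\<close>; this makes \<open>F\<close> invariant under
    \<open>P\<close>.\<close>
  have "finite (insert v0 (P ` bs))" "insert v0 (P ` bs) \<subseteq> Xm" "0 < \<delta>"
    using bs(1) v0 P_in \<delta>1(1) \<delta>2(1) by (auto simp: \<delta>_def)
  from finite_dimensional_approximation [OF Z Xm(1) this]
  obtain E p where E: "subspace E" "finite_dimensional_on E" "insert v0 (P ` bs) \<subseteq> E" "E \<subseteq> Xm"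
    and p: "continuous_on UNIV p" "\<And>x. p x \<in> E" "\<And>z. z \<in> Z \<Longrightarrow> norm (p z - z) < \<delta>"
    by blast
  have v0E: "v0 \<in> E" using E(3) by simp
  have PXp: "P w \<in> E" if "w \<in> Xp" for w
  proof -
    have "P w \<in> span (P ` bs)"
      using linear_span_image [OF bounded_linear.linear [OF P_lin], of bs] bs(2) that by simp
    then show ?thesis
      using span_minimal [of "P ` bs" E] E(1,3) by auto
  qed
  have pcont: "continuous_on A (\<lambda>x. p (g x))" if "continuous_on A g" for A and g :: "'a \<Rightarrow> 'a"
    by (rule continuous_on_compose2 [OF p(1) that]) auto

  have apE: "LS_approximation Xm G v0 r E (\<lambda>v. p (Q v)) \<delta>"
    unfolding LS_approximation_def
  proof (intro conjI ballI E v0E)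
    show "continuous_on (cball v0 r \<inter> Xm) (\<lambda>v. p (Q v))"
      by (intro pcont cont_Q continuous_on_id) auto
    show "(\<lambda>v. p (Q v)) ` (cball v0 r \<inter> Xm) \<subseteq> E"
      using p(2) by auto
    show "norm (p (Q x) - (x - G x)) < \<delta>" if "x \<in> cball v0 r \<inter> Xm" for x
      using p(3) [OF QZ [OF that]] G_eq [of x] that by simp
    show "\<delta> \<le> norm (G x)" if "x \<in> sphere v0 r \<inter> Xm" for x
      using \<delta>2(2) [OF that] by (simp add: \<delta>_def)
  qed

  define F where "F = span (E \<union> Xp)"
  have EXp: "E \<inter> Xp \<subseteq> {0}"
    using E(4) Xm_Int_Xp by blast
  note F = dim_sum_direct [OF E(1,2) Xp(1) Xp_finite EXp, folded F_def]
  have sF: "subspace F"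
    by (simp add: F_def)
  have EF: "E \<subseteq> F" and XpF: "Xp \<subseteq> F"
    using span_superset [of "E \<union> Xp"] by (auto simp: F_def)
  have PF: "P x \<in> E" if x: "x \<in> F" for x
  proof -
    obtain a b where ab: "a \<in> E" "b \<in> Xp" "x = a + b"
      using x unfolding F_def span_Un using E(1) Xp(1) by (auto simp: span_eq_iff [THEN iffD2])
    then have "P x = a + P b"
      using E(4) P_id [of a] by (auto simp: P_simps)
    then show ?thesis
      using subspace_add [OF E(1) ab(1) PXp [OF ab(2)]] by simp
  qed
  have complF: "x - P x \<in> F" for x
  proof -
    have "x - P x = (x - \<pi> x) - P (x - \<pi> x)"
      by (simp add: P_simps P_id pi_in)
    also have "\<dots> \<in> F"
      by (rule subspace_diff [OF sF subsetD [OF XpF pi_compl] subsetD [OF EF PXp [OF pi_compl]]])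
    finally show ?thesis .
  qed
  have uF: "u \<in> F"
    unfolding u by (rule subspace_add [OF sF subsetD [OF EF v0E] subsetD [OF XpF psi [OF v0]]])
  have DF: "D x \<in> F" for x
    unfolding D_def
    by (rule subspace_add [OF sF subspace_scale [OF sF subspace_diff [OF sF complF complF]]
          subsetD [OF XpF psi [OF v0]]])

  define L where "L x = D x + p (Q (v0 + P (x - u)))" for x
  have apF: "LS_approximation UNIV N u r F L \<delta>"
    unfolding LS_approximation_def Int_UNIV_right
  proof (intro conjI ballI sF F(2) uF subset_UNIV)
    show "continuous_on (cball u r) L"
      unfolding L_def by (intro continuous_on_add D_cont pcont cont_Q continuous_intros) (use vP in auto)
    show "L ` cball u r \<subseteq> F"
      unfolding L_def by (intro image_subsetI subspace_add [OF sF DF subsetD [OF EF p(2)]])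
    show "norm (L x - (x - N x)) < \<delta>" if "x \<in> cball u r" for x
      using p(3) [OF QZ [OF ball [OF that]]] by (simp add: L_def N)
    show "\<delta> \<le> norm (N x)" if "x \<in> sphere u r" for x
      using \<delta>1(2) [OF that] by (simp add: \<delta>_def)
  qed

  let ?g = "\<lambda>x. u + r *\<^sub>R x - L (u + r *\<^sub>R x)"
  have g: "?g x = v0 + r *\<^sub>R P x - r *\<^sub>R (x - P x) - p (Q (v0 + r *\<^sub>R P x))" for x
  proof -
    have "(u + r *\<^sub>R x - P (u + r *\<^sub>R x)) - (u - P u) = r *\<^sub>R (x - P x)"
      by (simp add: P_simps algebra_simps)
    then show ?thesis
      unfolding L_def D_def scaleR_2 by (simp add: P_simps(3) algebra_simps) (simp add: u)
  qed
  note gF = LS_approximation_rescaled [OF apF r(1) sF order_refl subset_UNIV]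
  \<comment> \<open>Orthogonally to \<open>E\<close> only the term with \<open>- r\<close> times
    \<open>x\<close> survives, because \<open>v0\<close>, \<open>P x\<close> and all values of
    \<open>p\<close> lie in \<open>E\<close>. The negative factor gives one sign per lost
    dimension.\<close>
  have "Brouwer_degree_ball F ?g 0 1
      = (if 0 < - r then 1 else -1) ^ (dim F - dim E) * Brouwer_degree_ball E ?g 0 1"
  proof (rule Brouwer_degree_ball_reduction [OF sF F(2) E(1) EF gF(1)])
    show "?g x \<in> F - {0}" if "x \<in> sphere 0 1 \<inter> F" for x
      using gF(2,3) [OF that] LS_approximation_nonzero [OF apF, of "u + r *\<^sub>R x"] by auto
    show "- r \<noteq> 0" using r(1) by simp
    fix x y assume x: "x \<in> sphere 0 1 \<inter> F" and y: "y \<in> F" "\<And>z. z \<in> E \<Longrightarrow> inner y z = 0"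
    have "inner y v0 = 0" "inner y (P x) = 0" "inner y (p (Q (v0 + r *\<^sub>R P x))) = 0"
      using y(2) v0E PF x p(2) by auto
    then show "inner y (?g x) = - r * inner y x"
      unfolding g by (simp add: inner_diff_right inner_add_right)
  qed
  also have "Brouwer_degree_ball E ?g 0 1 = Brouwer_degree_ball E (\<lambda>x. (v0 + r *\<^sub>R x) - p (Q (v0 + r *\<^sub>R x))) 0 1"
  proof (rule Brouwer_degree_ball_cong [OF E(1,2)])
    fix x assume "x \<in> sphere 0 1 \<inter> E"
    then have "P x = x"
      using E(4) by (intro P_id) auto
    then show "?g x = (v0 + r *\<^sub>R x) - p (Q (v0 + r *\<^sub>R x))"
      unfolding g by simp
  qed
  also have "\<dots> = LS_degree Xm G v0 r"
    using LS_degree_eq [OF apE Xm(1) r(1)] Brouwer_degree_ball_rescale [of E "\<lambda>v. v - p (Q v)" v0 r] by simp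
  finally have "Brouwer_degree_ball F ?g 0 1 = (-1) ^ dim Xp * LS_degree Xm G v0 r"
    using r(1) F(1) by simp
  then have "LS_degree UNIV N u r = (-1) ^ dim Xp * LS_degree Xm G v0 r"
    using LS_degree_eq [OF apF subspace_UNIV r(1)] Brouwer_degree_ball_rescale [of F "\<lambda>x. x - L x" u r] by simp
  then show ?thesis
    by (simp add: N_def [abs_def])
qed

lemma LS_degree_gradient:
  "LS_degree UNIV T u r = (-1) ^ dim Xp * LS_degree Xm G v0 r"
  using homotopy_split_gradient homotopy_monotone homotopy_freeze_psi homotopy_orthogonalize
    LS_degree_orthogonal_product by simp

end

theorem mainTheorem2:
  fixes f :: "'a::{real_inner, complete_space} \<Rightarrow> real"
    and K :: "'a \<Rightarrow> 'a"
    and Xm Xp :: "'a set"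
    and \<kappa> :: real
    and \<psi> :: "'a \<Rightarrow> 'a"
    and \<phi> :: "'a \<Rightarrow> real"
    and v0 :: 'a
  assumes separable: "separable_space (euclidean :: 'a topology)"
    and f_C1: "C1 f"
    and K_compact: "compact_map_on UNIV K"
    and gradient_f: "\<And>x. gradient_on UNIV f x = x - K x"
    and Xm: "subspace Xm" "closed Xm"
    and Xp: "subspace Xp" "closed Xp"
    and sum: "direct_sum Xm Xp"
    and Xp_finite: "finite_dimensional_on Xp"
    and kappa_pos: "\<kappa> > 0"
    and monotone: "\<And>v w1 w2. v \<in> Xm \<Longrightarrow> w1 \<in> Xp \<Longrightarrow> w2 \<in> Xp \<Longrightarrow>
        - inner (gradient_on UNIV f (v + w1) - gradient_on UNIV f (v + w2)) (w1 - w2)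
          \<ge> \<kappa> * (norm (w1 - w2))\<^sup>2"
    and psi: "\<And>v. v \<in> Xm \<Longrightarrow> \<psi> v \<in> Xp"
    and psi_max: "\<And>v w. v \<in> Xm \<Longrightarrow> w \<in> Xp \<Longrightarrow> f (v + w) \<le> f (v + \<psi> v)"
    and phi: "\<And>v. v \<in> Xm \<Longrightarrow> \<phi> v = f (v + \<psi> v)"
    and isolated: "isolated_zero_on Xm (gradient_on Xm \<phi>) v0"
  shows "LS_index UNIV (gradient_on UNIV f) (v0 + \<psi> v0)
           = (-1) ^ dim Xp * LS_index Xm (gradient_on Xm \<phi>) v0"
proof -
  interpret saddle_point_reduction f K Xm Xp \<kappa> \<psi> \<phi>
    by unfold_locales fact+
  obtain e where v0: "v0 \<in> Xm" and e: "0 < e"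
    "\<And>v. v \<in> Xm \<Longrightarrow> 0 < norm (v - v0) \<Longrightarrow> norm (v - v0) < e \<Longrightarrow> G v \<noteq> 0"
    using isolated gradient_phi unfolding isolated_zero_on_def by metis
  define c where "c = onorm \<pi> + 1"
  have c: "1 \<le> c"
    using onorm_pos_le [OF pi_lin] by (simp add: c_def)
  \<comment> \<open>One radius must serve both indices: \<open>e\<close> isolates \<open>v0\<close>
    for the reduced gradient and \<open>e / c\<close> isolates the critical point of
    \<open>f\<close>. Any positive number below \<open>e / c\<close> would do.\<close>
  define r where "r = e / c / 2"
  have "0 < e / c"
    using e(1) c by simp
  then have "0 < r" "r < e / c"
    unfolding r_def by simp_all
  moreover from this have "r * (onorm \<pi> + 1) < e"
    using c by (simp add: pos_less_divide_eq flip: c_def)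
  ultimately have r_bounds: "0 < r" "r < e / c" "r * (onorm \<pi> + 1) < e"
    by blast+
  have ec: "e / c \<le> e"
    using e(1) c by (simp add: divide_le_eq mult_le_cancel_left1)
  interpret isolated_saddle_point f K Xm Xp \<kappa> \<psi> \<phi> v0 "v0 + \<psi> v0" r e
  proof
    show "v = v0" if "v \<in> Xm" "norm (v - v0) < e" "G v = 0" for v
      using e(2) that by force
  qed (use v0 r_bounds in auto)
  have "LS_index UNIV (gradient_on UNIV f) (v0 + \<psi> v0) = LS_degree UNIV (gradient_on UNIV f) (v0 + \<psi> v0) r"
  proof (rule LS_index_eq_LS_degree [OF _ _ _ K_compact])
    show "gradient_on UNIV f x = x - K x" for x
      by (rule gradient_f)
    show "gradient_on UNIV f x \<noteq> 0"
      if x: "0 < norm (x - (v0 + \<psi> v0))" "norm (x - (v0 + \<psi> v0)) < e / c" for x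
    proof
      assume "gradient_on UNIV f x = 0"
      then have "T x = 0"
        by (simp add: gradient_f T_def)
      moreover have "norm (x - (v0 + \<psi> v0)) * (onorm \<pi> + 1) < e"
        using x(2) c by (simp add: pos_less_divide_eq flip: c_def)
      ultimately have "x = v0 + \<psi> v0"
        by (rule T_zeroD)
      with x(1) show False by simp
    qed
  qed (use r_bounds in auto)
  also have "LS_degree UNIV (gradient_on UNIV f) (v0 + \<psi> v0) r = LS_degree UNIV T (v0 + \<psi> v0) r"
    by (rule LS_degree_cong) (simp add: gradient_f T_def)
  also have "\<dots> = (-1) ^ dim Xp * LS_degree Xm G v0 r"
    by (rule LS_degree_gradient)
  also have "LS_degree Xm G v0 r = LS_degree Xm (gradient_on Xm \<phi>) v0 r"
    by (rule LS_degree_cong) (simp add: gradient_phi)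
  also have "\<dots> = LS_index Xm (gradient_on Xm \<phi>) v0"
  proof (rule LS_index_eq_LS_degree [OF Xm v0 Q_compact, symmetric])
    show "gradient_on Xm \<phi> x = x - Q x" if "x \<in> Xm" for x
      using that by (simp add: gradient_phi G_eq)
    show "gradient_on Xm \<phi> x \<noteq> 0" if "x \<in> Xm" "0 < norm (x - v0)" "norm (x - v0) < e" for x
      using e(2) [OF that] that(1) by (simp add: gradient_phi)
  qed (use r_bounds ec in auto)
  finally show ?thesis .
qed

end
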